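(* With the setting and notation of the context (compact Riemann surface $X$ of genus $g>1$, deformation map $f:X\to\tilde X$, smooth projective connection $h$ on $X$, good cover $\mathcal U_X$), the total cochain $$\Omega = 2\pi\sqrt{-1}\,\bigl(\{\omega_i\},\ \{\theta_{ij}\},\ \{-\Theta_{ijk}\},\ \{-m_{ijkl}\}\bigr)$$ of total degree $3$ in $\mathcal C^{\bullet,\bullet}=\check C^{\bullet}(\mathcal U_X,\mathbb Z(3)^\bullet_{\mathcal D})$, whose component of degree $(3,0)$ is given by the Polyakov form $$\omega_i=\frac{\partial^2 f_i}{\partial f_i}\,\partial\mu_i\,dz_i\wedge d\bar z_i+2\mu_i h_i\,dz_i\wedge d\bar z_i ,$$ is a cocycle (i.e. $m_{ijkl}\in\mathbb Z(2)$ and $D\Omega=0$), and hence represents a class in the smooth Deligne cohomology group $H^3_{\mathcal D}(X,\mathbb Z(3))$.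
   Context: Notation: $\mathbb Z(p)=(2\pi i)^p\mathbb Z$; $A^p_X$ is the sheaf of smooth complex $p$-forms on $X$. Smooth Deligne complex: $\mathbb Z(3)^\bullet_{\mathcal D}:\ \mathbb Z(3)_X\hookrightarrow A^0_X\xrightarrow{d}A^1_X\xrightarrow{d}A^2_X$, with $\mathbb Z(3)_X$ in degree $0$ and $A^r_X$ in degree $r+1$, zero after degree $3$. $H^q_{\mathcal D}(X,\mathbb Z(3))$ is its $q$-th hypercohomology group. It is computed by the total complex of $\mathcal C^{p,q}=\check C^q(\mathcal U_X,\mathbb Z(3)^p_{\mathcal D})$ with total differential $D=d+(-1)^p\check\delta$ in degree $(p,q)$ ($d$ being the differential of $\mathbb Z(3)_{\mathcal D}^\bullet$). Setting: $X$ is a compact Riemann surface of genus $g>1$; $f:X\to\tilde X$ is an orientation-preserving diffeomorphism onto a Riemann surface $\tilde X$. $\mathcal U_X=\{U_i\}_{i\in I}$ is a good open cover of $X$ (all nonempty finite intersections are contractible), with holomorphic coordinates $z_i:U_i\to\mathbb C$ and transition functions $z_i=z_{ij}\circ z_j$ on $U_i\cap U_j$. $V_i=f(U_i)$ are the sets of the corresponding good cover of $\tilde X$, with holomorphic coordinates $w_i:V_i\to\mathbb C$ and $w_i=w_{ij}\circ w_j$. Put $f_i=w_i\circ f\circ z_i^{-1}$, so $f_i\circ z_{ij}=w_{ij}\circ f_j$; $\partial=\partial/\partial z_i$, $\bar\partial=\partial/\partial\bar z_i$; $\mu_i=\bar\partial f_i/\partial f_i$ (local representatives of the Beltrami differential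 $\mu$). Čech convention: the component $\phi_{i_0\dots i_{q-1}}$ of a cochain is expressed in the coordinate $z_{i_{q-1}}$ of the last index, and $\check\delta\phi_{i_0\dots i_q}=\sum_{k=0}^{q-1}(-1)^k\phi_{i_0\dots\hat{i_k}\dots i_q}+(-1)^q (z_{i_{q-1}i_q})^*\phi_{i_0\dots i_{q-1}}$. On a $(q+1)$-fold intersection all functions are thus evaluated in the last coordinate; in particular $\log w'_{jk}$ below stands for $\log w'_{jk}\circ f_k$, and $\log z'_{ij}$ on $U_i\cap U_j\cap U_k$ stands for $\log z'_{ij}\circ z_{jk}$. Smooth projective connection: a collection $h=\{h_i\}$ of smooth functions with $h_j-h_i\circ z_{ij}\,(z'_{ij})^2=\{z_i,z_j\}$ on $U_i\cap U_j$, where $\{z_i,z_j\}=\frac{z_{ij}'''}{z_{ij}'}-\frac32\bigl(\frac{z_{ij}''}{z_{ij}'}\bigr)^2$ is the Schwarzian derivative. Logarithms: fix branches of $\log z'_{ij}$, $\log w'_{ij}$, $\log\partial f_i$ and set $c_{ijk}=(\check\delta\log z'_{\cdot\cdot})_{ijk}$, $\tilde c_{ijk}=(\check\delta \log w'_{\cdot\cdot}\circ f_\cdot)_{ijk}$; these are in $\mathbb Z(1)$. Trivialization of the tame symbol: since $H^4_{\mathcal D,hol}(X,\mathbb Z(2))=0$ there exist holomorphic $1$-forms $\tau_{ij}$ on $U_i\cap U_j$, holomorphic functions $\phi_{ijk}$ on triple intersections, and $n_{ijkl}\in\mathbb Z(2)$ with $$-\log z'_{ij}\,d\log z'_{jk}=(\check\delta\tau)_{ijk}+d\phi_{ijk},\quad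 c_{ijk}\log z'_{kl}=-(\check\delta\phi)_{ijkl}+n_{ijkl},\quad c_{ijk}c_{klm}=(\check\delta n)_{ijklm}.$$ Fix such a triple, and fix a triple $(\tilde\tau_{ij},\tilde\phi_{ijk},\tilde n_{ijkl})$ satisfying the analogous relations on $\tilde X$ (with $w'_{ij}$, $\tilde c_{ijk}$ in place of $z'_{ij}$, $c_{ijk}$). Components of $\Omega$: $$\theta_{ij}=2\mu_j\frac{z''_{ij}}{z'_{ij}}d\bar z_j-\bigl(\log(w'_{ij}\circ f_j)+\log z'_{ij}\bigr)d\log\partial f_j+\log(w'_{ij}\circ f_j)\,d\log z'_{ij}-f^*(\tilde\tau_{ij})+\tau_{ij},$$ $$\Theta_{ijk}=f^*(\tilde\phi_{ijk})-\phi_{ijk}-(\tilde c_{ijk}+c_{ijk})\log\partial f_k-\log z'_{ij}\,\log w'_{jk}+\tilde c_{ijk}\log z'_{ik},$$ $$m_{ijkl}=(\check\delta\Theta)_{ijkl}.$$ *)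

theory Defs
  imports
    "HOL-Complex_Analysis.Complex_Analysis"
    "HOL-Homology.Homology"
    "HOL-Algebra.Free_Abelian_Groups"
    "HOL-Library.Function_Algebras"
begin

text \<open>
  These derivative notions are only used at points of open sets, so values outside the set are
  irrelevant.
\<close>

primrec Ck_on :: "nat \<Rightarrow> (complex \<Rightarrow> 'b::real_normed_vector) \<Rightarrow> complex set \<Rightarrow> bool" where
  "Ck_on 0 f S \<longleftrightarrow> continuous_on S f"
| "Ck_on (Suc k) f S \<longleftrightarrow>
     (\<forall>x\<in>S. f differentiable (at x)) \<and> (\<forall>v. Ck_on k (\<lambda>x. frechet_derivative f (at x) v) S)"

definition smooth_on :: "(complex \<Rightarrow> 'b::real_normed_vector) \<Rightarrow> complex set \<Rightarrow> bool" where
  "smooth_on f S \<longleftrightarrow> (\<forall>k. Ck_on k f S)"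

definition del :: "(complex \<Rightarrow> complex) \<Rightarrow> complex \<Rightarrow> complex" where
  "del f x = (frechet_derivative f (at x) 1 - \<i> * frechet_derivative f (at x) \<i>) / 2"

definition delbar :: "(complex \<Rightarrow> complex) \<Rightarrow> complex \<Rightarrow> complex" where
  "delbar f x = (frechet_derivative f (at x) 1 + \<i> * frechet_derivative f (at x) \<i>) / 2"

definition jacobian :: "(complex \<Rightarrow> complex) \<Rightarrow> complex \<Rightarrow> real" where
  "jacobian f x =
     Re (frechet_derivative f (at x) 1) * Im (frechet_derivative f (at x) \<i>)
   - Im (frechet_derivative f (at x) 1) * Re (frechet_derivative f (at x) \<i>)"

definition schwarzian :: "(complex \<Rightarrow> complex) \<Rightarrow> complex \<Rightarrow> complex" where
  "schwarzian u x =
     (deriv ^^ 3) u x / deriv u x - 3 / 2 * ((deriv ^^ 2) u x / deriv u x)\<^sup>2"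

definition log_branch :: "(complex \<Rightarrow> complex) \<Rightarrow> (complex \<Rightarrow> complex) \<Rightarrow> complex set \<Rightarrow> bool" where
  "log_branch L u S \<longleftrightarrow> continuous_on S L \<and> (\<forall>x\<in>S. exp (L x) = u x)"

type_synonym 'a chart = "'a set \<times> ('a \<Rightarrow> complex)"

definition is_chart :: "'a topology \<Rightarrow> 'a chart \<Rightarrow> bool" where
  "is_chart X = (\<lambda>(U, u). openin X U \<and> open (u ` U) \<and>
     homeomorphic_map (subtopology X U) (top_of_set (u ` U)) u)"

definition chart_change_holomorphic :: "'a chart \<Rightarrow> 'a chart \<Rightarrow> bool" where
  "chart_change_holomorphic = (\<lambda>(U, u) (V, v). (v \<circ> inv_into U u) holomorphic_on u ` (U \<inter> V))"

definition riemann_surface :: "'a topology \<Rightarrow> 'a chart set \<Rightarrow> bool" where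
  "riemann_surface X A \<longleftrightarrow>
     Hausdorff_space X \<and> connected_space X \<and>
     (\<forall>c\<in>A. is_chart X c) \<and> (\<Union>c\<in>A. fst c) = topspace X \<and>
     (\<forall>c\<in>A. \<forall>c'\<in>A. chart_change_holomorphic c c')"

text \<open>A chart of the maximal atlas generated by \<open>A\<close>.\<close>

definition holomorphic_coordinate ::
    "'a topology \<Rightarrow> 'a chart set \<Rightarrow> 'a set \<Rightarrow> ('a \<Rightarrow> complex) \<Rightarrow> bool" where
  "holomorphic_coordinate X A U u \<longleftrightarrow>
     is_chart X (U, u) \<and>
     (\<forall>c\<in>A. chart_change_holomorphic c (U, u) \<and> chart_change_holomorphic (U, u) c)"

text \<open>The genus is half the first Betti number: \<open>H\<^sub>1(X; \<int>)\<close> is free of rank \<open>2g\<close>.\<close>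

definition has_genus :: "'a topology \<Rightarrow> nat \<Rightarrow> bool" where
  "has_genus X g \<longleftrightarrow> homology_group 1 X \<cong> free_Abelian_group {..<2 * g}"

definition smooth_map ::
    "'a topology \<Rightarrow> 'a chart set \<Rightarrow> 'b topology \<Rightarrow> 'b chart set \<Rightarrow> ('a \<Rightarrow> 'b) \<Rightarrow> bool" where
  "smooth_map X A Y B f \<longleftrightarrow> continuous_map X Y f \<and>
     (\<forall>(U, u)\<in>A. \<forall>(V, v)\<in>B. smooth_on (v \<circ> f \<circ> inv_into U u) (u ` (U \<inter> f -` V)))"

definition diffeomorphism ::
    "'a topology \<Rightarrow> 'a chart set \<Rightarrow> 'b topology \<Rightarrow> 'b chart set \<Rightarrow> ('a \<Rightarrow> 'b) \<Rightarrow> bool" where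
  "diffeomorphism X A Y B f \<longleftrightarrow>
     bij_betw f (topspace X) (topspace Y) \<and>
     smooth_map X A Y B f \<and> smooth_map Y B X A (inv_into (topspace X) f)"

definition orientation_preserving :: "'a chart set \<Rightarrow> 'b chart set \<Rightarrow> ('a \<Rightarrow> 'b) \<Rightarrow> bool" where
  "orientation_preserving A B f \<longleftrightarrow>
     (\<forall>(U, u)\<in>A. \<forall>(V, v)\<in>B. \<forall>x\<in>u ` (U \<inter> f -` V). 0 < jacobian (v \<circ> f \<circ> inv_into U u) x)"

text \<open>
  The value \<open>(a, b, c, e)\<close> of a form at a point stands for
  \<open>a + b dz + c dzbar + e dz \<and> dzbar\<close>, with \<open>dzbar\<close> the conjugate of \<open>dz\<close>.
\<close>

type_synonym form = "complex \<Rightarrow> complex \<times> complex \<times> complex \<times> complex"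

definition fun_form :: "(complex \<Rightarrow> complex) \<Rightarrow> form" where
  "fun_form a = (\<lambda>x. (a x, 0, 0, 0))"

definition dz :: form where "dz = (\<lambda>x. (0, 1, 0, 0))"
definition dzbar :: form where "dzbar = (\<lambda>x. (0, 0, 1, 0))"
definition dz_dzbar :: form where "dz_dzbar = (\<lambda>x. (0, 0, 0, 1))"

definition scale_form :: "(complex \<Rightarrow> complex) \<Rightarrow> form \<Rightarrow> form" (infixr "\<odot>" 75) where
  "a \<odot> \<eta> = (\<lambda>x. case \<eta> x of (p, q, r, s) \<Rightarrow> (a x * p, a x * q, a x * r, a x * s))"

abbreviation coef_one :: "form \<Rightarrow> complex \<Rightarrow> complex" where
  "coef_one \<eta> \<equiv> \<lambda>x. fst (\<eta> x)"
abbreviation coef_dz :: "form \<Rightarrow> complex \<Rightarrow> complex" where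
  "coef_dz \<eta> \<equiv> \<lambda>x. fst (snd (\<eta> x))"
abbreviation coef_dzbar :: "form \<Rightarrow> complex \<Rightarrow> complex" where
  "coef_dzbar \<eta> \<equiv> \<lambda>x. fst (snd (snd (\<eta> x)))"
abbreviation coef_dz_dzbar :: "form \<Rightarrow> complex \<Rightarrow> complex" where
  "coef_dz_dzbar \<eta> \<equiv> \<lambda>x. snd (snd (snd (\<eta> x)))"

definition ext_d :: "form \<Rightarrow> form" where
  "ext_d \<eta> = (\<lambda>x. (0, del (coef_one \<eta>) x, delbar (coef_one \<eta>) x,
                    del (coef_dzbar \<eta>) x - delbar (coef_dz \<eta>) x))"

text \<open>Pullback along \<open>u\<close>, with \<open>dz\<close> and \<open>dzbar\<close> pulling back to \<open>du\<close> and \<open>d(cnj u)\<close>.\<close>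

definition pullback :: "(complex \<Rightarrow> complex) \<Rightarrow> form \<Rightarrow> form" where
  "pullback u \<eta> = (\<lambda>x. let uc = (\<lambda>y. cnj (u y)) in
     (coef_one \<eta> (u x),
      coef_dz \<eta> (u x) * del u x + coef_dzbar \<eta> (u x) * del uc x,
      coef_dz \<eta> (u x) * delbar u x + coef_dzbar \<eta> (u x) * delbar uc x,
      coef_dz_dzbar \<eta> (u x) * (del u x * delbar uc x - delbar u x * del uc x)))"

fun homogeneous :: "nat \<Rightarrow> complex \<times> complex \<times> complex \<times> complex \<Rightarrow> bool" where
  "homogeneous r (a, b, c, e) \<longleftrightarrow>
     (r \<noteq> 0 \<longrightarrow> a = 0) \<and> (r \<noteq> 1 \<longrightarrow> b = 0 \<and> c = 0) \<and> (r \<noteq> 2 \<longrightarrow> e = 0)"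

text \<open>
  Sections over \<open>S\<close> are represented by total functions vanishing off \<open>S\<close>, so that equality of
  sections is equality of functions.
\<close>

definition restrict_form :: "complex set \<Rightarrow> form \<Rightarrow> form" where
  "restrict_form S \<eta> = (\<lambda>x. if x \<in> S then \<eta> x else 0)"

definition smooth_forms :: "nat \<Rightarrow> complex set \<Rightarrow> form set" where
  "smooth_forms r S =
     {\<eta>. smooth_on \<eta> S \<and> (\<forall>x\<in>S. homogeneous r (\<eta> x)) \<and> (\<forall>x. x \<notin> S \<longrightarrow> \<eta> x = 0)}"

text \<open>
  \<open>Ztw p\<close> is the Tate twist \<open>\<int>(p) = (2\<pi>\<i>)\<^sup>p \<int>\<close>; sections of the constant sheaf are the locally
  constant functions.
\<close>

definition Ztw :: "nat \<Rightarrow> complex set" where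
  "Ztw p = range (\<lambda>k::int. (2 * of_real pi * \<i>) ^ p * of_int k)"

definition Ztw_sections :: "nat \<Rightarrow> complex set \<Rightarrow> form set" where
  "Ztw_sections p S =
     {\<eta>. (\<forall>x\<in>S. \<exists>k\<in>Ztw p. \<forall>\<^sub>F y in nhds x. y \<in> S \<longrightarrow> \<eta> y = (k, 0, 0, 0)) \<and>
         (\<forall>x. x \<notin> S \<longrightarrow> \<eta> x = 0)}"

text \<open>
  The term of degree \<open>p\<close> of \<open>\<int>(N) \<rightarrow> A\<^sup>0 \<rightarrow> \<dots> \<rightarrow> A\<^sup>N\<^sup>-\<^sup>1\<close>: the \<open>(p - 1)\<close>-forms if \<open>1 \<le> p \<le> N\<close>.
\<close>

definition deligne_sections :: "nat \<Rightarrow> nat \<Rightarrow> complex set \<Rightarrow> form set" where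
  "deligne_sections N p S =
     (if p = 0 then Ztw_sections N S else if p \<le> N then smooth_forms (p - 1) S else {0})"

definition deligne_d :: "nat \<Rightarrow> nat \<Rightarrow> form \<Rightarrow> form" where
  "deligne_d N p \<eta> = (if p = 0 then \<eta> else if p < N then ext_d \<eta> else 0)"

record ('i, 'a) coord_cover =
  idx :: "'i set"
  patch :: "'i \<Rightarrow> 'a set"
  coord :: "'i \<Rightarrow> 'a \<Rightarrow> complex"

definition good_cover :: "'a topology \<Rightarrow> 'i set \<Rightarrow> ('i \<Rightarrow> 'a set) \<Rightarrow> bool" where
  "good_cover X I U \<longleftrightarrow>
     (\<forall>i\<in>I. openin X (U i)) \<and> (\<Union>i\<in>I. U i) = topspace X \<and>
     (\<forall>J. finite J \<and> J \<noteq> {} \<and> J \<subseteq> I \<and> (\<Inter>i\<in>J. U i) \<noteq> {} \<longrightarrow>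
        contractible_space (subtopology X (\<Inter>i\<in>J. U i)))"

definition transition :: "('i, 'a) coord_cover \<Rightarrow> 'i \<Rightarrow> 'i \<Rightarrow> complex \<Rightarrow> complex" where
  "transition C i j = coord C i \<circ> inv_into (patch C j) (coord C j)"

text \<open>The intersection of the patches in the list, in the coordinate of its last index.\<close>

definition cdom :: "('i, 'a) coord_cover \<Rightarrow> 'i list \<Rightarrow> complex set" where
  "cdom C is = coord C (last is) ` (\<Inter>i\<in>set is. patch C i)"

type_synonym 'i cochain = "'i list \<Rightarrow> form"

text \<open>
  A \<open>q\<close>-cochain is evaluated on lists of length \<open>q + 1\<close>; each component is written in the
  coordinate of the last index. Hence only deleting the last index involves a pullback.
\<close>

definition cech_delta :: "('i, 'a) coord_cover \<Rightarrow> 'i cochain \<Rightarrow> 'i cochain" where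
  "cech_delta C \<phi> = (\<lambda>is x. let q = length is - 1 in
     if q = 0 then 0
     else (\<Sum>k<q. (-1) ^ k *\<^sub>R \<phi> (take k is @ drop (Suc k) is) x)
        + (-1) ^ q *\<^sub>R pullback (transition C (is ! (q - 1)) (is ! q)) (\<phi> (butlast is)) x)"

definition cech_delta_fun ::
    "('i, 'a) coord_cover \<Rightarrow> ('i list \<Rightarrow> complex \<Rightarrow> complex) \<Rightarrow> 'i list \<Rightarrow> complex \<Rightarrow> complex" where
  "cech_delta_fun C \<phi> is = coef_one (cech_delta C (\<lambda>js. fun_form (\<phi> js)) is)"

text \<open>
  Total complex: \<open>\<Psi> p\<close> is the component of degree \<open>(p, n - p)\<close>.
\<close>

definition tot_cochains :: "nat \<Rightarrow> ('i, 'a) coord_cover \<Rightarrow> nat \<Rightarrow> (nat \<Rightarrow> 'i cochain) set" where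
  "tot_cochains N C n =
     {\<Psi>. \<forall>p is. if p \<le> n \<and> length is = n - p + 1 \<and> set is \<subseteq> idx C
               then \<Psi> p is \<in> deligne_sections N p (cdom C is)
               else \<Psi> p is = 0}"

definition tot_D :: "nat \<Rightarrow> ('i, 'a) coord_cover \<Rightarrow> (nat \<Rightarrow> 'i cochain) \<Rightarrow> nat \<Rightarrow> 'i cochain" where
  "tot_D N C \<Psi> = (\<lambda>p is.
     if is \<noteq> [] \<and> set is \<subseteq> idx C
     then restrict_form (cdom C is)
            ((if p = 0 then 0 else deligne_d N (p - 1) (\<Psi> (p - 1) is))
             + (\<lambda>x. (-1) ^ p *\<^sub>R cech_delta C (\<Psi> p) is x))
     else 0)"

definition tot_cocycles :: "nat \<Rightarrow> ('i, 'a) coord_cover \<Rightarrow> nat \<Rightarrow> (nat \<Rightarrow> 'i cochain) set" where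
  "tot_cocycles N C n = {\<Psi> \<in> tot_cochains N C n. tot_D N C \<Psi> = 0}"

definition tot_coboundaries :: "nat \<Rightarrow> ('i, 'a) coord_cover \<Rightarrow> nat \<Rightarrow> (nat \<Rightarrow> 'i cochain) set" where
  "tot_coboundaries N C n = (if n = 0 then {0} else tot_D N C ` tot_cochains N C (n - 1))"

definition cocycle_group :: "nat \<Rightarrow> ('i, 'a) coord_cover \<Rightarrow> nat \<Rightarrow> (nat \<Rightarrow> 'i cochain) monoid" where
  "cocycle_group N C n = \<lparr>carrier = tot_cocycles N C n, monoid.mult = (+), one = 0\<rparr>"

text \<open>The hypercohomology of the smooth Deligne complex, computed by a good cover \<open>C\<close>.\<close>

definition deligne_cohomology ::
    "nat \<Rightarrow> ('i, 'a) coord_cover \<Rightarrow> nat \<Rightarrow> (nat \<Rightarrow> 'i cochain) set monoid" where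
  "deligne_cohomology N C n = cocycle_group N C n Mod tot_coboundaries N C n"

definition deligne_class ::
    "nat \<Rightarrow> ('i, 'a) coord_cover \<Rightarrow> nat \<Rightarrow> (nat \<Rightarrow> 'i cochain) \<Rightarrow> (nat \<Rightarrow> 'i cochain) set" where
  "deligne_class N C n \<Psi> = tot_coboundaries N C n #>\<^bsub>cocycle_group N C n\<^esub> \<Psi>"

definition smooth_projective_connection ::
    "('i, 'a) coord_cover \<Rightarrow> ('i \<Rightarrow> complex \<Rightarrow> complex) \<Rightarrow> bool" where
  "smooth_projective_connection C h \<longleftrightarrow>
     (\<forall>i\<in>idx C. smooth_on (h i) (cdom C [i])) \<and>
     (\<forall>i\<in>idx C. \<forall>j\<in>idx C. \<forall>x\<in>cdom C [i, j].
        h j x - h i (transition C i j x) * (deriv (transition C i j) x)\<^sup>2 = schwarzian (transition C i j) x)"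

text \<open>
  \<open>L [i, j]\<close> is a branch of the logarithm of the derivative of the transition function, and the
  holomorphic 1-forms are \<open>\<tau> [i, j] dz\<close>.
\<close>

definition tame_trivialization ::
    "('i, 'a) coord_cover \<Rightarrow> ('i list \<Rightarrow> complex \<Rightarrow> complex) \<Rightarrow>
     ('i list \<Rightarrow> complex \<Rightarrow> complex) \<Rightarrow> ('i list \<Rightarrow> complex \<Rightarrow> complex) \<Rightarrow> ('i list \<Rightarrow> complex) \<Rightarrow> bool" where
  "tame_trivialization C L \<tau> \<phi> n \<longleftrightarrow>
     (\<forall>i\<in>idx C. \<forall>j\<in>idx C. \<tau> [i, j] holomorphic_on cdom C [i, j]) \<and>
     (\<forall>i\<in>idx C. \<forall>j\<in>idx C. \<forall>k\<in>idx C.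
        \<phi> [i, j, k] holomorphic_on cdom C [i, j, k] \<and>
        (\<forall>x\<in>cdom C [i, j, k].
           (- ((L [i, j] \<circ> transition C j k) \<odot> ext_d (fun_form (L [j, k])))) x
           = (cech_delta C (\<lambda>is. \<tau> is \<odot> dz) [i, j, k] + ext_d (fun_form (\<phi> [i, j, k]))) x)) \<and>
     (\<forall>i\<in>idx C. \<forall>j\<in>idx C. \<forall>k\<in>idx C. \<forall>l\<in>idx C. \<forall>x\<in>cdom C [i, j, k, l].
        n [i, j, k, l] \<in> Ztw 2 \<and>
        cech_delta_fun C L [i, j, k] (transition C k l x) * L [k, l] x
        = - cech_delta_fun C \<phi> [i, j, k, l] x + n [i, j, k, l]) \<and>
     (\<forall>i\<in>idx C. \<forall>j\<in>idx C. \<forall>k\<in>idx C. \<forall>l\<in>idx C. \<forall>m\<in>idx C. \<forall>x\<in>cdom C [i, j, k, l, m].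
        cech_delta_fun C L [i, j, k] (transition C k m x) * cech_delta_fun C L [k, l, m] x
        = cech_delta_fun C (\<lambda>is y. n is) [i, j, k, l, m] x)"

text \<open>
  \<open>C\<close> and \<open>E\<close> are the covers of the source and target of \<open>f\<close>, with \<open>z\<close>- and \<open>w\<close>-coordinates;
  \<open>Lz\<close>, \<open>Lw\<close>, \<open>Lf\<close> are the branches of the logarithms of \<open>z'\<^sub>i\<^sub>j\<close>, \<open>w'\<^sub>i\<^sub>j\<close>, \<open>\<partial>f\<^sub>i\<close>; and
  \<open>\<tau>, \<phi>\<close> (resp. \<open>\<tau>', \<phi>'\<close>) belong to the trivialization on the source (resp. target).
\<close>

definition local_rep ::
    "('i, 'a) coord_cover \<Rightarrow> ('i, 'b) coord_cover \<Rightarrow> ('a \<Rightarrow> 'b) \<Rightarrow> 'i \<Rightarrow> complex \<Rightarrow> complex" where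
  "local_rep C E f i = coord E i \<circ> f \<circ> inv_into (patch C i) (coord C i)"

definition beltrami ::
    "('i, 'a) coord_cover \<Rightarrow> ('i, 'b) coord_cover \<Rightarrow> ('a \<Rightarrow> 'b) \<Rightarrow> 'i \<Rightarrow> complex \<Rightarrow> complex" where
  "beltrami C E f i = (\<lambda>x. delbar (local_rep C E f i) x / del (local_rep C E f i) x)"

definition polyakov_form ::
    "('i, 'a) coord_cover \<Rightarrow> ('i, 'b) coord_cover \<Rightarrow> ('a \<Rightarrow> 'b) \<Rightarrow> ('i \<Rightarrow> complex \<Rightarrow> complex) \<Rightarrow>
     'i \<Rightarrow> form" where
  "polyakov_form C E f h i =
     (let F = local_rep C E f i; \<mu> = beltrami C E f i in
       (\<lambda>x. del (del F) x / del F x * del \<mu> x) \<odot> dz_dzbar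
     + (\<lambda>x. 2 * \<mu> x * h i x) \<odot> dz_dzbar)"

definition theta ::
    "('i, 'a) coord_cover \<Rightarrow> ('i, 'b) coord_cover \<Rightarrow> ('a \<Rightarrow> 'b) \<Rightarrow>
     ('i list \<Rightarrow> complex \<Rightarrow> complex) \<Rightarrow> ('i list \<Rightarrow> complex \<Rightarrow> complex) \<Rightarrow> ('i \<Rightarrow> complex \<Rightarrow> complex) \<Rightarrow>
     ('i list \<Rightarrow> complex \<Rightarrow> complex) \<Rightarrow> ('i list \<Rightarrow> complex \<Rightarrow> complex) \<Rightarrow> 'i \<Rightarrow> 'i \<Rightarrow> form" where
  "theta C E f Lz Lw Lf \<tau> \<tau>' i j =
     (let F = local_rep C E f j; \<mu> = beltrami C E f j;
          a = Lw [i, j] \<circ> F; b = Lz [i, j]; u = transition C i j in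
       (\<lambda>x. 2 * \<mu> x * ((deriv ^^ 2) u x / deriv u x)) \<odot> dzbar
     - (\<lambda>x. a x + b x) \<odot> ext_d (fun_form (Lf j))
     + a \<odot> ext_d (fun_form b)
     - pullback F (\<tau>' [i, j] \<odot> dz)
     + \<tau> [i, j] \<odot> dz)"

definition Theta ::
    "('i, 'a) coord_cover \<Rightarrow> ('i, 'b) coord_cover \<Rightarrow> ('a \<Rightarrow> 'b) \<Rightarrow>
     ('i list \<Rightarrow> complex \<Rightarrow> complex) \<Rightarrow> ('i list \<Rightarrow> complex \<Rightarrow> complex) \<Rightarrow> ('i \<Rightarrow> complex \<Rightarrow> complex) \<Rightarrow>
     ('i list \<Rightarrow> complex \<Rightarrow> complex) \<Rightarrow> ('i list \<Rightarrow> complex \<Rightarrow> complex) \<Rightarrow>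
     'i \<Rightarrow> 'i \<Rightarrow> 'i \<Rightarrow> complex \<Rightarrow> complex" where
  "Theta C E f Lz Lw Lf \<phi> \<phi>' i j k =
     (let F = local_rep C E f k;
          c = cech_delta_fun C Lz [i, j, k];
          c' = cech_delta_fun C (\<lambda>is. Lw is \<circ> local_rep C E f (last is)) [i, j, k] in
      (\<lambda>x. \<phi>' [i, j, k] (F x) - \<phi> [i, j, k] x - (c' x + c x) * Lf k x
         - Lz [i, j] (transition C j k x) * Lw [j, k] (F x) + c' x * Lz [i, k] x))"

definition m_cochain ::
    "('i, 'a) coord_cover \<Rightarrow> ('i, 'b) coord_cover \<Rightarrow> ('a \<Rightarrow> 'b) \<Rightarrow>
     ('i list \<Rightarrow> complex \<Rightarrow> complex) \<Rightarrow> ('i list \<Rightarrow> complex \<Rightarrow> complex) \<Rightarrow> ('i \<Rightarrow> complex \<Rightarrow> complex) \<Rightarrow>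
     ('i list \<Rightarrow> complex \<Rightarrow> complex) \<Rightarrow> ('i list \<Rightarrow> complex \<Rightarrow> complex) \<Rightarrow>
     'i \<Rightarrow> 'i \<Rightarrow> 'i \<Rightarrow> 'i \<Rightarrow> complex \<Rightarrow> complex" where
  "m_cochain C E f Lz Lw Lf \<phi> \<phi>' i j k l =
     cech_delta_fun C (\<lambda>is. Theta C E f Lz Lw Lf \<phi> \<phi>' (is ! 0) (is ! 1) (is ! 2)) [i, j, k, l]"

definition Omega ::
    "('i, 'a) coord_cover \<Rightarrow> ('i, 'b) coord_cover \<Rightarrow> ('a \<Rightarrow> 'b) \<Rightarrow> ('i \<Rightarrow> complex \<Rightarrow> complex) \<Rightarrow>
     ('i list \<Rightarrow> complex \<Rightarrow> complex) \<Rightarrow> ('i list \<Rightarrow> complex \<Rightarrow> complex) \<Rightarrow> ('i \<Rightarrow> complex \<Rightarrow> complex) \<Rightarrow>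
     ('i list \<Rightarrow> complex \<Rightarrow> complex) \<Rightarrow> ('i list \<Rightarrow> complex \<Rightarrow> complex) \<Rightarrow>
     ('i list \<Rightarrow> complex \<Rightarrow> complex) \<Rightarrow> ('i list \<Rightarrow> complex \<Rightarrow> complex) \<Rightarrow>
     nat \<Rightarrow> 'i cochain" where
  "Omega C E f h Lz Lw Lf \<tau> \<phi> \<tau>' \<phi>' = (\<lambda>p is.
     if p \<le> 3 \<and> length is = 3 - p + 1 \<and> set is \<subseteq> idx C
     then restrict_form (cdom C is) ((\<lambda>x. 2 * of_real pi * \<i>) \<odot>
       (if p = 3 then polyakov_form C E f h (is ! 0)
        else if p = 2 then theta C E f Lz Lw Lf \<tau> \<tau>' (is ! 0) (is ! 1)
        else if p = 1 then
          - fun_form (Theta C E f Lz Lw Lf \<phi> \<phi>' (is ! 0) (is ! 1) (is ! 2))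
        else
          - fun_form (m_cochain C E f Lz Lw Lf \<phi> \<phi>' (is ! 0) (is ! 1) (is ! 2) (is ! 3))))
     else 0)"

end

theory Submission
  imports Defs
begin

text \<open>
  Throughout, \<open>F\<^sub>i\<close> is the deformation map in the coordinates \<open>z\<^sub>i\<close> and \<open>w\<^sub>i\<close>. Put
  \<open>U\<^sub>i\<^sub>j = log z\<^sub>i\<^sub>j'\<close>, \<open>V\<^sub>i\<^sub>j = log w\<^sub>i\<^sub>j' \<circ> F\<^sub>j\<close> and \<open>\<Lambda>\<^sub>i = log \<partial>F\<^sub>i\<close>. Up to the common
  factor \<open>2\<pi>\<i>\<close>, the equation \<open>D\<Omega> = 0\<close> splits by bidegree into

  \<^item> \<open>d\<theta> = \<delta>\<omega>\<close> on double overlaps,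
  \<^item> \<open>\<delta>\<theta> = d\<Theta>\<close> on triple overlaps,
  \<^item> \<open>\<delta>\<Theta> = m\<close>, which is the definition of \<open>m\<close>, and hence \<open>\<delta>m = \<delta>\<delta>\<Theta> = 0\<close>,

  and there remains the integrality of \<open>m\<close>.

  Everything rests on the chain rule for \<open>F\<^sub>i \<circ> z\<^sub>i\<^sub>j = w\<^sub>i\<^sub>j \<circ> F\<^sub>j\<close>. Its \<open>dz\<close> part says
  \<open>\<Lambda>\<^sub>i \<circ> z\<^sub>i\<^sub>j + U\<^sub>i\<^sub>j = V\<^sub>i\<^sub>j + \<Lambda>\<^sub>j + 2\<pi>\<i> e\<^sub>i\<^sub>j\<close> with an integer \<open>e\<^sub>i\<^sub>j\<close>, constant because overlaps of a
  good cover are connected (\<open>log_del_F_transition\<close>). Its \<open>dzbar\<close> part then says that \<open>\<mu>\<close> is a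
  \<open>(-1,1)\<close>-form (\<open>beltrami_transition\<close>). Together with the symmetry of second derivatives, which
  gives \<open>\<partial>bar \<Lambda> = \<partial>\<mu> + \<mu> \<partial>\<Lambda>\<close>, and with \<open>{z\<^sub>i, z\<^sub>j} = U\<^sub>i\<^sub>j'' - (U\<^sub>i\<^sub>j')\<^sup>2 / 2\<close>, this turns both sides of the
  first equation into the same polynomial in \<open>\<mu>\<close>, \<open>\<partial>\<mu>\<close>, \<open>\<partial>\<Lambda>\<close>, \<open>\<partial>V\<close>, \<open>U'\<close> and \<open>U''\<close> (\<open>d_theta\<close>); the
  Schwarzian in the transformation law of \<open>h\<close> supplies the term \<open>2\<mu> U''\<close> of \<open>d(2\<mu> U' dzbar)\<close>.

  For the second equation, applying \<open>\<delta>\<close> to \<open>\<theta>\<close> leaves \<open>- (c' + c) d\<Lambda>\<close>, products of \<open>U\<close>, \<open>V\<close>, \<open>dU\<close>, \<open>dV\<close>,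
  and \<open>\<delta>\<tau> - f\<^sup>* \<delta>\<tau>'\<close>. By the trivializations, \<open>\<delta>\<tau> = - U dU - d\<phi>\<close> and \<open>f\<^sup>* \<delta>\<tau>' = - V dV - d(f\<^sup>* \<phi>')\<close>;
  since \<open>c = \<delta>U\<close>, \<open>c' = \<delta>V\<close> are constants, what is left is exact by the Leibniz rule
  (\<open>delta_theta\<close>).

  Finally \<open>\<delta>(U V) = c V - U c'\<close>, and in \<open>\<delta>\<Theta>\<close> the remaining trivialization relations cancel all
  non-constant terms. What survives is
  \<open>n' - n + 2\<pi>\<i> e\<^sub>k\<^sub>l (c'\<^sub>i\<^sub>j\<^sub>k + c\<^sub>i\<^sub>j\<^sub>k) + c'\<^sub>j\<^sub>k\<^sub>l c\<^sub>i\<^sub>j\<^sub>l - c'\<^sub>i\<^sub>j\<^sub>k c\<^sub>i\<^sub>k\<^sub>l\<close>,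
  an element of \<open>\<int>(2)\<close> (\<open>m_cochain_in_Ztw\<close>).
\<close>

section \<open>Symmetry of second derivatives\<close>

text \<open>
  Along the segment from \<open>x\<close> to \<open>x + t v\<close>, the difference of \<open>f\<close> and of its translate by \<open>t w\<close> has
  derivative \<open>t (D(\<cdot> + t w) v - D(\<cdot>) v)\<close>, which is \<open>t\<^sup>2 V w\<close> up to \<open>o(t\<^sup>2)\<close>. The mean value inequality
  for this difference minus \<open>s t\<^sup>2 V w\<close>, \<open>s\<close> the parameter of the segment, gives the estimate, from differentiability of \<open>D(\<cdot>) v\<close> at the
  single point \<open>x\<close>.
\<close>
lemma second_difference_estimate:
  fixes f :: "'a::real_normed_vector \<Rightarrow> 'b::real_normed_vector"
  assumes S: "open S" "x \<in> S"
    and f: "\<And>y. y \<in> S \<Longrightarrow> (f has_derivative D y) (at y)"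
    and V: "((\<lambda>y. D y v) has_derivative V) (at x)"
    and e: "e > 0"
  shows "\<exists>d>0. \<forall>t. 0 < t \<and> t < d \<longrightarrow>
    norm (f (x + t *\<^sub>R v + t *\<^sub>R w) - f (x + t *\<^sub>R v) - f (x + t *\<^sub>R w) + f x - t\<^sup>2 *\<^sub>R V w) \<le> e * t\<^sup>2"
proof -
  define K where "K = norm v + norm w"
  have K: "K \<ge> 0" by (simp add: K_def)
  \<comment> \<open>Two points at distance at most \<open>t K\<close> from \<open>x\<close> are compared, each with error \<open>e' t K\<close>.\<close>
  define e' where "e' = e / (2 * K + 1)"
  have e': "e' > 0" using e K by (simp add: e'_def add_nonneg_pos)
  have e'K: "2 * e' * K \<le> e"
    using e K by (simp add: e'_def field_simps)
  obtain d1 where d1: "d1 > 0" "\<And>y. norm (y - x) < d1 \<Longrightarrow> norm (D y v - D x v - V (y - x)) \<le> e' * norm (y - x)"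
    using V e' unfolding has_derivative_at_alt by blast
  obtain d0 where d0: "d0 > 0" "ball x d0 \<subseteq> S" using S open_contains_ball by blast
  define d where "d = min d1 d0 / (K + 1)"
  have d: "d > 0" using d1 d0 K by (simp add: d_def)
  interpret V: bounded_linear V using V by (rule has_derivative_bounded_linear)
  show ?thesis
  proof (intro exI[of _ d] conjI allI impI d)
    fix t :: real assume t: "0 < t \<and> t < d"
    have tK: "t * K < min d1 d0"
    proof -
      have "t * (K + 1) < min d1 d0" using t K unfolding d_def by (simp add: pos_less_divide_eq)
      then show ?thesis using t by (simp add: algebra_simps)
    qed
    define G where "G = (\<lambda>s::real. f (x + (s * t) *\<^sub>R v + t *\<^sub>R w) - f (x + (s * t) *\<^sub>R v) - s *\<^sub>R (t\<^sup>2
      *\<^sub>R V w))"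
    define G' where "G' = (\<lambda>s h::real. D (x + (s * t) *\<^sub>R v + t *\<^sub>R w) ((h * t) *\<^sub>R v)
        - D (x + (s * t) *\<^sub>R v) ((h * t) *\<^sub>R v) - h *\<^sub>R (t\<^sup>2 *\<^sub>R V w))"
    have near: "norm ((s * t) *\<^sub>R v + b *\<^sub>R (t *\<^sub>R w)) \<le> t * K" if s: "s \<in> {0..1}" and "b = 0 \<or> b = 1" for s b
    proof -
      have "norm ((s * t) *\<^sub>R v + b *\<^sub>R (t *\<^sub>R w)) \<le> (s * t) * norm v + t * norm w"
        using that t by (intro order_trans[OF norm_triangle_ineq]) (auto simp: abs_mult)
      also have "\<dots> \<le> 1 * t * norm v + t * norm w"
        using s t by (intro add_mono mult_right_mono) auto
      finally show ?thesis by (simp add: K_def algebra_simps)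
    qed
    have inS: "x + (s * t) *\<^sub>R v + t *\<^sub>R w \<in> S" "x + (s * t) *\<^sub>R v \<in> S" if "s \<in> {0..1}" for s
    proof -
      have "norm ((s * t) *\<^sub>R v + t *\<^sub>R w) < d0" "norm ((s * t) *\<^sub>R v) < d0"
        using near[OF that, of 1] near[OF that, of 0] tK by auto
      moreover have "dist x (x + a) = norm a" for a by (simp add: dist_norm)
      ultimately have "x + ((s * t) *\<^sub>R v + t *\<^sub>R w) \<in> ball x d0" "x + (s * t) *\<^sub>R v \<in> ball x d0"
        by (simp_all only: mem_ball)
      then show "x + (s * t) *\<^sub>R v + t *\<^sub>R w \<in> S" "x + (s * t) *\<^sub>R v \<in> S" 
        using d0 by (auto simp: add.assoc)
    qed
    have der: "(G has_derivative G' s) (at s within {0..1})" if s: "s \<in> {0..1}" for s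
    proof -
      have 1: "((\<lambda>s. x + (s * t) *\<^sub>R v + t *\<^sub>R w) has_derivative (\<lambda>h. (h * t) *\<^sub>R v)) (at s within {0..1})"
       and 2: "((\<lambda>s. x + (s * t) *\<^sub>R v) has_derivative (\<lambda>h. (h * t) *\<^sub>R v)) (at s within {0..1})"
        by (auto intro!: derivative_eq_intros)
      show ?thesis unfolding G_def G'_def
        by (intro has_derivative_diff has_derivative_compose[OF 1 f] has_derivative_compose[OF 2 f] inS s)
           (auto intro!: derivative_eq_intros)
    qed
    have bound: "onorm (G' s) \<le> e * t\<^sup>2" if s: "s \<in> {0..1}" for s
    proof (rule onorm_le)
      fix h :: real
      let ?p = "x + (s * t) *\<^sub>R v + t *\<^sub>R w" and ?q = "x + (s * t) *\<^sub>R v"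
      interpret p: bounded_linear "D ?p" using f[OF inS(1)[OF s]] by (rule has_derivative_bounded_linear)
      interpret q: bounded_linear "D ?q" using f[OF inS(2)[OF s]] by (rule has_derivative_bounded_linear)
      have 0: "V (?p - x) - V (?q - x) = t *\<^sub>R V w"
        by (simp add: V.add V.diff V.scaleR)
      have eq: "G' s h = (h * t) *\<^sub>R ((D ?p v - D x v - V (?p - x)) - (D ?q v - D x v - V (?q - x)))"
        unfolding G'_def p.scaleR q.scaleR using 0
        by (simp add: algebra_simps power2_eq_square flip: scaleR_scaleR) 
      have np: "norm (?p - x) \<le> t * K" "norm (?q - x) \<le> t * K"
        using near[OF s, of 1] near[OF s, of 0] by (simp_all add: algebra_simps)
      have small: "norm (D y v - D x v - V (y - x)) \<le> e' * (t * K)" if "norm (y - x) \<le> t * K" for y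
      proof -
        have "norm (D y v - D x v - V (y - x)) \<le> e' * norm (y - x)"
          using that tK by (intro d1(2)) auto
        also have "\<dots> \<le> e' * (t * K)" using that e' by (intro mult_left_mono) auto
        finally show ?thesis .
      qed
      have "norm ((D ?p v - D x v - V (?p - x)) - (D ?q v - D x v - V (?q - x))) \<le> e' * (t * K) + e' * (t
        * K)"
        by (rule order_trans[OF norm_triangle_ineq4 add_mono[OF small[OF np(1)] small[OF np(2)]]])
      also have "\<dots> = t * (2 * e' * K)" by simp
      also have "\<dots> \<le> t * e" using e'K t by (intro mult_left_mono) auto
      finally have "norm (G' s h) \<le> (\<bar>h\<bar> * t) * (t * e)"
        unfolding eq using t by (auto simp: abs_mult intro!: mult_left_mono)
      then show "norm (G' s h) \<le> e * t\<^sup>2 * norm h" by (simp add: power2_eq_square mult_ac)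
    qed
    have "norm (G 1 - G 0) \<le> e * t\<^sup>2 * norm (1 - 0 :: real)"
      by (rule differentiable_bound[OF _ der bound]) auto
    then show "norm (f (x + t *\<^sub>R v + t *\<^sub>R w) - f (x + t *\<^sub>R v) - f (x + t *\<^sub>R w) + f x - t\<^sup>2 *\<^sub>R V w) \<le>
      e * t\<^sup>2"
      by (simp add: G_def algebra_simps)
  qed
qed

text \<open>
  The second difference of \<open>f\<close> is symmetric in \<open>v\<close> and \<open>w\<close>, and \<open>V w\<close> and \<open>W v\<close> are both its limits
  after division by \<open>t\<^sup>2\<close>.
\<close>
lemma second_derivative_symmetric:
  fixes f :: "'a::real_normed_vector \<Rightarrow> 'b::real_normed_vector"
  assumes S: "open S" "x \<in> S"
    and f: "\<And>y. y \<in> S \<Longrightarrow> (f has_derivative D y) (at y)"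
    and V: "((\<lambda>y. D y v) has_derivative V) (at x)"
    and W: "((\<lambda>y. D y w) has_derivative W) (at x)"
  shows "V w = W v"
proof (rule ccontr)
  assume ne: "V w \<noteq> W v"
  define e where "e = norm (V w - W v) / 4"
  have e: "e > 0" using ne by (simp add: e_def)
  obtain d1 where d1: "d1 > 0" "\<And>t. 0 < t \<and> t < d1 \<Longrightarrow>
    norm (f (x + t *\<^sub>R v + t *\<^sub>R w) - f (x + t *\<^sub>R v) - f (x + t *\<^sub>R w) + f x - t\<^sup>2 *\<^sub>R V w) \<le> e * t\<^sup>2"
    using second_difference_estimate[OF S f V e] by blast
  obtain d2 where d2: "d2 > 0" "\<And>t. 0 < t \<and> t < d2 \<Longrightarrow>
    norm (f (x + t *\<^sub>R w + t *\<^sub>R v) - f (x + t *\<^sub>R w) - f (x + t *\<^sub>R v) + f x - t\<^sup>2 *\<^sub>R W v) \<le> e * t\<^sup>2"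
    using second_difference_estimate[OF S f W e] by blast
  define t where "t = min d1 d2 / 2"
  have t: "0 < t" "t < d1" "t < d2" using d1 d2 by (auto simp: t_def)
  let ?Q = "f (x + t *\<^sub>R v + t *\<^sub>R w) - f (x + t *\<^sub>R v) - f (x + t *\<^sub>R w) + f x"
  have Q: "f (x + t *\<^sub>R w + t *\<^sub>R v) - f (x + t *\<^sub>R w) - f (x + t *\<^sub>R v) + f x = ?Q"
    by (simp add: algebra_simps)
  have "t\<^sup>2 *\<^sub>R (V w - W v) = (?Q - t\<^sup>2 *\<^sub>R W v) - (?Q - t\<^sup>2 *\<^sub>R V w)"
    by (simp add: algebra_simps)
  then have "norm (t\<^sup>2 *\<^sub>R (V w - W v)) \<le> norm (?Q - t\<^sup>2 *\<^sub>R W v) + norm (?Q - t\<^sup>2 *\<^sub>R V w)"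
    by (simp only: norm_triangle_ineq4)
  also have "\<dots> \<le> e * t\<^sup>2 + e * t\<^sup>2" 
    using d1(2)[of t] d2(2)[of t] t unfolding Q by (intro add_mono) auto
  also have "norm (t\<^sup>2 *\<^sub>R (V w - W v)) = t\<^sup>2 * (4 * e)" by (simp only: norm_scaleR e_def) simp
  finally have "t\<^sup>2 * (4 * e) \<le> t\<^sup>2 * (2 * e)" by (simp only: algebra_simps)
  then show False using t e by simp
qed

section \<open>Wirtinger derivatives\<close>

text \<open>
  The relation \<open>df = a dz + b dzbar\<close> at \<open>x\<close>. A relation rather than a pair of functions, so that
  differentiability and both derivatives of a compound expression come out of one rule application.
\<close>
definition has_wirtinger :: "(complex \<Rightarrow> complex) \<Rightarrow> complex \<Rightarrow> complex \<Rightarrow> complex \<Rightarrow> bool" where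
  "has_wirtinger f a b x \<longleftrightarrow> (f has_derivative (\<lambda>v. a * v + b * cnj v)) (at x)"

lemma linear_complex_decomposition:
  fixes D :: "complex \<Rightarrow> complex"
  assumes "bounded_linear D"
  shows "D v = (D 1 - \<i> * D \<i>) / 2 * v + (D 1 + \<i> * D \<i>) / 2 * cnj v"
proof -
  interpret bounded_linear D by fact
  have v: "v = Re v *\<^sub>R 1 + Im v *\<^sub>R \<i>" by (simp add: complex_eq_iff)
  have "D v = Re v *\<^sub>R D 1 + Im v *\<^sub>R D \<i>" by (subst v) (simp only: add scaleR)
  then show ?thesis
    by (simp add: complex_eq_iff field_simps)
qed

lemma differentiable_imp_has_wirtinger:
  assumes "f differentiable (at x)" shows "has_wirtinger f (del f x) (delbar f x) x"
proof -
  have D: "(f has_derivative frechet_derivative f (at x)) (at x)"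
    using assms frechet_derivative_works by blast
  show ?thesis unfolding has_wirtinger_def del_def delbar_def
    by (rule has_derivative_eq_rhs[OF D], rule ext,
        rule linear_complex_decomposition[OF has_derivative_bounded_linear[OF D]])
qed

lemma has_wirtinger_differentiable: "has_wirtinger f a b x \<Longrightarrow> f differentiable (at x)"
  unfolding has_wirtinger_def differentiable_def by blast

lemma has_wirtinger_frechet:
  assumes "has_wirtinger f a b x" shows "frechet_derivative f (at x) v = a * v + b * cnj v"
  using frechet_derivative_at[of f "\<lambda>v. a * v + b * cnj v" x] assms unfolding has_wirtinger_def
  by (metis (no_types, lifting))

lemma has_wirtinger_del:
  assumes "has_wirtinger f a b x" shows "del f x = a" 
  unfolding del_def has_wirtinger_frechet[OF assms] by (simp add: field_simps)

lemma has_wirtinger_delbar: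
  assumes "has_wirtinger f a b x" shows "delbar f x = b"
  unfolding delbar_def has_wirtinger_frechet[OF assms] by (simp add: field_simps)

lemma has_wirtinger_const: "has_wirtinger (\<lambda>y. c) 0 0 x"
  unfolding has_wirtinger_def by simp

lemma has_wirtinger_add:
  "\<lbrakk>has_wirtinger f a b x; has_wirtinger g a' b' x\<rbrakk> \<Longrightarrow> has_wirtinger (\<lambda>y. f y + g y) (a + a') (b + b') x"
  unfolding has_wirtinger_def by (auto intro!: derivative_eq_intros simp: algebra_simps)

lemma has_wirtinger_diff:
  "\<lbrakk>has_wirtinger f a b x; has_wirtinger g a' b' x\<rbrakk> \<Longrightarrow> has_wirtinger (\<lambda>y. f y - g y) (a - a') (b - b') x"
  unfolding has_wirtinger_def by (auto intro!: derivative_eq_intros simp: algebra_simps)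

lemma has_wirtinger_minus:
  "has_wirtinger f a b x \<Longrightarrow> has_wirtinger (\<lambda>y. - f y) (- a) (- b) x"
  unfolding has_wirtinger_def by (auto intro!: derivative_eq_intros simp: algebra_simps)

lemma has_wirtinger_mult:
  "\<lbrakk>has_wirtinger f a b x; has_wirtinger g a' b' x\<rbrakk> \<Longrightarrow>
     has_wirtinger (\<lambda>y. f y * g y) (a * g x + f x * a') (b * g x + f x * b') x"
  unfolding has_wirtinger_def by (auto intro!: derivative_eq_intros simp: algebra_simps)

lemma has_wirtinger_cnj:
  "has_wirtinger f a b x \<Longrightarrow> has_wirtinger (\<lambda>y. cnj (f y)) (cnj b) (cnj a) x"
  unfolding has_wirtinger_def 
  by (drule bounded_linear.has_derivative[OF bounded_linear_cnj]) (simp add: algebra_simps)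

lemma has_wirtinger_compose:
  "\<lbrakk>has_wirtinger g a' b' (f x); has_wirtinger f a b x\<rbrakk> \<Longrightarrow>
     has_wirtinger (\<lambda>y. g (f y)) (a' * a + b' * cnj b) (a' * b + b' * cnj a) x"
  unfolding has_wirtinger_def
  by (drule (1) has_derivative_compose[rotated]) (simp add: algebra_simps)

lemma has_field_derivative_imp_wirtinger:
  "(f has_field_derivative c) (at x) \<Longrightarrow> has_wirtinger f c 0 x"
  unfolding has_wirtinger_def has_field_derivative_def by simp

lemma has_wirtinger_cong:
  assumes "has_wirtinger f a b x" "open S" "x \<in> S" "\<And>y. y \<in> S \<Longrightarrow> f y = g y"
  shows "has_wirtinger g a b x"
  using assms has_derivative_transform_within_open unfolding has_wirtinger_def by blast

lemma has_wirtinger_unique: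
  assumes "has_wirtinger f a b x" "has_wirtinger f a' b' x" shows "a = a'" "b = b'"
  using assms has_wirtinger_del has_wirtinger_delbar by blast+

text \<open>
  The second derivatives in the directions \<open>1\<close> and \<open>\<i>\<close> commute; in terms of \<open>\<partial>\<close> and \<open>\<partial>bar\<close> this reads
  \<open>\<partial>bar \<partial> = \<partial> \<partial>bar\<close>.
\<close>
lemma delbar_del_commute:
  assumes S: "open S" "x \<in> S"
    and f: "\<And>y. y \<in> S \<Longrightarrow> f differentiable (at y)"
    and d: "del f differentiable (at x)" "delbar f differentiable (at x)"
  shows "delbar (del f) x = del (delbar f) x"
proof -
  have D: "(f has_derivative (\<lambda>v. del f y * v + delbar f y * cnj v)) (at y)" if "y \<in> S" for y
    using differentiable_imp_has_wirtinger[OF f[OF that]] unfolding has_wirtinger_def .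
  note w = differentiable_imp_has_wirtinger[OF d(1)] differentiable_imp_has_wirtinger[OF d(2)]
  have *: "has_wirtinger (\<lambda>y. del f y * v + delbar f y * cnj v)
      (del (del f) x * v + del (delbar f) x * cnj v) (delbar (del f) x * v + delbar (delbar f) x * cnj v)
        x" for v
    using has_wirtinger_add[OF has_wirtinger_mult[OF w(1) has_wirtinger_const[of v]]
        has_wirtinger_mult[OF w(2) has_wirtinger_const[of "cnj v"]]] by simp
  have "(del (del f) x * 1 + del (delbar f) x * cnj 1) * \<i> + (delbar (del f) x * 1 + delbar (delbar f) x
    * cnj 1) * cnj \<i>
      = (del (del f) x * \<i> + del (delbar f) x * cnj \<i>) * 1 + (delbar (del f) x * \<i> + delbar (delbar f) x
        * cnj \<i>) * cnj 1"
    by (rule second_derivative_symmetric[OF S D, of 1 _ \<i>])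
       (use *[of 1] *[of \<i>] in \<open>simp_all only: has_wirtinger_def\<close>)
  then show ?thesis by (simp add: algebra_simps)
qed

section \<open>Functions of class \<open>C\<^sup>k\<close> on open sets\<close>

lemma Ck_on_differentiable: "Ck_on (Suc k) f S \<Longrightarrow> x \<in> S \<Longrightarrow> f differentiable (at x)"
  by simp

lemma Ck_on_SucD: "Ck_on (Suc k) f S \<Longrightarrow> Ck_on k f S"
proof (induction k arbitrary: f)
  case 0
  then show ?case
    by (auto intro!: continuous_at_imp_continuous_on differentiable_imp_continuous_within)
next
  case (Suc k)
  have "Ck_on k (\<lambda>x. frechet_derivative f (at x) v) S" for v
    by (rule Suc.IH) (use Suc.prems in simp)
  moreover have "\<forall>x\<in>S. f differentiable (at x)" using Suc.prems by simp
  ultimately show ?case by simp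
qed

lemma Ck_on_local:
  assumes "\<And>x. x \<in> S \<Longrightarrow> \<exists>T. open T \<and> x \<in> T \<and> Ck_on k f T"
  shows "Ck_on k f S"
  using assms
proof (induction k arbitrary: f)
  case 0
  have "isCont f x" if "x \<in> S" for x
    using 0[OF that] by (auto simp: continuous_on_eq_continuous_at)
  then show ?case by (simp add: continuous_at_imp_continuous_on)
next
  case (Suc k)
  have "f differentiable (at x)" if "x \<in> S" for x
    using Suc.prems[OF that] by auto
  moreover have "Ck_on k (\<lambda>x. frechet_derivative f (at x) v) S" for v
  proof (rule Suc.IH)
    fix x assume "x \<in> S"
    from Suc.prems[OF this] show "\<exists>T. open T \<and> x \<in> T \<and> Ck_on k (\<lambda>x. frechet_derivative f (at x) v) T"
      by auto
  qed
  ultimately show ?case by simp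
qed

lemma Ck_on_subset: "Ck_on k f T \<Longrightarrow> S \<subseteq> T \<Longrightarrow> Ck_on k f S"
  by (induction k arbitrary: f) (auto intro: continuous_on_subset)

lemma Ck_on_cong:
  assumes "open S" "\<And>x. x \<in> S \<Longrightarrow> f x = g x" "Ck_on k f S"
  shows "Ck_on k g S"
  using assms(2,3)
proof (induction k arbitrary: f g)
  case 0 then show ?case using continuous_on_cong[OF refl 0(1)] by simp
next
  case (Suc k)
  have "(g has_derivative frechet_derivative f (at x)) (at x)" if x: "x \<in> S" for x
  proof -
    have "(f has_derivative frechet_derivative f (at x)) (at x)"
      using Suc.prems(2) x frechet_derivative_works by auto
    then show ?thesis
      by (rule has_derivative_transform_within_open[OF _ assms(1) x Suc.prems(1)])
  qed
  note g = this
  have d: "g differentiable (at x)" "frechet_derivative g (at x) = frechet_derivative f (at x)" if "x \<in>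
    S" for x
    using g[OF that] frechet_derivative_at[OF g[OF that]] by (auto simp: differentiable_def)
  show ?case unfolding Ck_on.simps
  proof (intro conjI ballI allI)
    fix v show "Ck_on k (\<lambda>x. frechet_derivative g (at x) v) S"
      by (rule Suc.IH[of "\<lambda>x. frechet_derivative f (at x) v"]) (use d Suc.prems in auto)
  qed (use d in auto)
qed

text \<open>
  The form in which the recursion for \<open>Ck_on\<close> is used below: on an open set any explicit formula for
  the derivative may stand in for the Frechet derivative.
\<close>
lemma Ck_on_SucI:
  assumes "open S" "\<And>x. x \<in> S \<Longrightarrow> (f has_derivative D x) (at x)"
    "\<And>v. Ck_on k (\<lambda>x. D x v) S"
  shows "Ck_on (Suc k) f S"
  unfolding Ck_on.simps
proof (intro conjI ballI allI)
  fix v show "Ck_on k (\<lambda>x. frechet_derivative f (at x) v) S"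
    by (rule Ck_on_cong[OF assms(1) _ assms(3)[of v]])
       (simp add: frechet_derivative_at[OF assms(2), symmetric])
qed (use assms(2) in \<open>auto simp: differentiable_def\<close>)

lemma Ck_on_SucD_derivative:
  assumes "Ck_on (Suc k) f S"
  shows "\<And>x. x \<in> S \<Longrightarrow> (f has_derivative frechet_derivative f (at x)) (at x)"
    and "\<And>v. Ck_on k (\<lambda>x. frechet_derivative f (at x) v) S"
  using assms by (auto simp: frechet_derivative_works)

lemma Ck_on_const: "Ck_on k (\<lambda>x. c) S"
  by (induction k arbitrary: c) auto

lemma Ck_on_linear:
  assumes "bounded_linear L" "open S" "Ck_on k f S"
  shows "Ck_on k (\<lambda>x. L (f x)) S"
  using assms(3)
proof (induction k arbitrary: f)
  case 0 then show ?case
    using bounded_linear.continuous_on[OF assms(1)] by auto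
next
  case (Suc k)
  note f = Ck_on_SucD_derivative[OF Suc.prems]
  show ?case
    by (rule Ck_on_SucI[OF assms(2) bounded_linear.has_derivative[OF assms(1) f(1)] Suc.IH[OF f(2)]])
qed

lemma Ck_on_add:
  assumes "open S" "Ck_on k f S" "Ck_on k g S"
  shows "Ck_on k (\<lambda>x. f x + g x) S"
  using assms(2,3)
proof (induction k arbitrary: f g)
  case 0 then show ?case by (auto intro: continuous_on_add)
next
  case (Suc k)
  note f = Ck_on_SucD_derivative[OF Suc.prems(1)] and g = Ck_on_SucD_derivative[OF Suc.prems(2)]
  show ?case
    by (rule Ck_on_SucI[OF assms(1) has_derivative_add[OF f(1) g(1)] Suc.IH[OF f(2) g(2)]])
qed

lemma Ck_on_Pair:
  assumes "open S" "Ck_on k f S" "Ck_on k g S"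
  shows "Ck_on k (\<lambda>x. (f x, g x)) S"
  using assms(2,3)
proof (induction k arbitrary: f g)
  case 0 then show ?case by (auto intro: continuous_on_Pair)
next
  case (Suc k)
  note f = Ck_on_SucD_derivative[OF Suc.prems(1)] and g = Ck_on_SucD_derivative[OF Suc.prems(2)]
  show ?case
    by (rule Ck_on_SucI[OF assms(1) has_derivative_Pair[OF f(1) g(1)] Suc.IH[OF f(2) g(2)]])
qed

lemma Ck_on_mult:
  fixes f g :: "complex \<Rightarrow> complex"
  assumes "open S" "Ck_on k f S" "Ck_on k g S"
  shows "Ck_on k (\<lambda>x. f x * g x) S"
  using assms(2,3)
proof (induction k arbitrary: f g)
  case 0 then show ?case by (auto intro: continuous_on_mult)
next
  case (Suc k)
  note f = Ck_on_SucD_derivative[OF Suc.prems(1)] and g = Ck_on_SucD_derivative[OF Suc.prems(2)]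
  show ?case
    by (rule Ck_on_SucI[OF assms(1) has_derivative_mult[OF f(1) g(1)]])
       (assumption | intro Ck_on_add Suc.IH f(2) g(2) Suc.prems[THEN Ck_on_SucD] assms(1))+
qed

lemma Ck_on_inverse:
  fixes f :: "complex \<Rightarrow> complex"
  assumes "open S" "\<And>x. x \<in> S \<Longrightarrow> f x \<noteq> 0" "Ck_on k f S"
  shows "Ck_on k (\<lambda>x. inverse (f x)) S"
  using assms(3)
proof (induction k)
  case 0 then show ?case using assms(2) by (auto intro: continuous_on_inverse)
next
  case (Suc k)
  note f = Ck_on_SucD_derivative[OF Suc.prems] and i = Suc.IH[OF Ck_on_SucD[OF Suc.prems]]
  have "((\<lambda>x. inverse (f x)) has_derivative 
      (\<lambda>v. (-1) * (inverse (f x) * frechet_derivative f (at x) v * inverse (f x)))) (at x)" if "x \<in> S" for x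
    using Deriv.has_derivative_inverse[OF assms(2)[OF that] f(1)[OF that]] by simp
  then show ?case
    by (rule Ck_on_SucI[OF assms(1)]) (assumption | intro Ck_on_mult Ck_on_const i f(2) assms(1))+
qed

lemma Ck_on_del_delbar:
  assumes "open S" "Ck_on (Suc k) f S"
  shows "Ck_on k (del f) S" "Ck_on k (delbar f) S"
proof -
  note f = Ck_on_SucD_derivative(2)[OF assms(2)]
  have "Ck_on k (\<lambda>x. (1/2) * (frechet_derivative f (at x) 1 + (-\<i>) * frechet_derivative f (at x) \<i>)) S"
       "Ck_on k (\<lambda>x. (1/2) * (frechet_derivative f (at x) 1 + \<i> * frechet_derivative f (at x) \<i>)) S"
    by (intro Ck_on_mult Ck_on_add Ck_on_const f assms(1))+
  note * = this
  show "Ck_on k (del f) S" by (rule Ck_on_cong[OF assms(1) _ *(1)]) (simp add: del_def)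
  show "Ck_on k (delbar f) S" by (rule Ck_on_cong[OF assms(1) _ *(2)]) (simp add: delbar_def)
qed

text \<open>
  In Wirtinger form the chain rule only involves products, sums and conjugates of functions that are
  already known to be of class \<open>C\<^sup>k\<close>, so the induction closes.
\<close>
lemma Ck_on_compose:
  fixes f g :: "complex \<Rightarrow> complex"
  assumes "open S" "open T" "f ` S \<subseteq> T" "Ck_on k g T" "Ck_on k f S"
  shows "Ck_on k (\<lambda>x. g (f x)) S"
  using assms(4,5)
proof (induction k arbitrary: g)
  case 0 
  then show ?case using assms(3) by (auto intro: continuous_on_compose2)
next
  case (Suc k)
  note f = Ck_on_SucD_derivative[OF Suc.prems(2)]
    and g = Ck_on_del_delbar[OF assms(2) Suc.prems(1)]
  have gf: "Ck_on k (\<lambda>x. del g (f x)) S" "Ck_on k (\<lambda>x. delbar g (f x)) S"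
    by (rule Suc.IH[OF g(1) Ck_on_SucD[OF Suc.prems(2)]], rule Suc.IH[OF g(2) Ck_on_SucD[OF Suc.prems(2)]])
  have "((\<lambda>x. g (f x)) has_derivative (\<lambda>v. del g (f x) * frechet_derivative f (at x) v +
      delbar g (f x) * cnj (frechet_derivative f (at x) v))) (at x)" if "x \<in> S" for x
    by (rule has_derivative_compose[OF f(1)[OF that]])
       (use differentiable_imp_has_wirtinger[of g "f x"] Suc.prems(1) that assms(3)
        in \<open>auto simp: has_wirtinger_def\<close>)
  then show ?case
    by (rule Ck_on_SucI[OF assms(1)])
       (assumption | intro Ck_on_add Ck_on_mult gf f(2) Ck_on_linear[OF bounded_linear_cnj] assms(1))+
qed

lemma Ck_on_holomorphic:
  fixes f :: "complex \<Rightarrow> complex"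
  assumes "open S" "f holomorphic_on S"
  shows "Ck_on k f S"
  using assms(2)
proof (induction k arbitrary: f)
  case 0 then show ?case by (simp add: holomorphic_on_imp_continuous_on)
next
  case (Suc k)
  have "(f has_derivative (\<lambda>v. deriv f x * v)) (at x)" if "x \<in> S" for x
    using holomorphic_derivI[OF Suc.prems assms(1) that] by (simp add: has_field_derivative_def)
  then show ?case
    by (rule Ck_on_SucI[OF assms(1)])
       (assumption | intro Ck_on_mult Ck_on_const assms(1) Suc.IH holomorphic_deriv Suc.prems)+
qed

text \<open>
  Where \<open>L\<close> varies by less than \<open>\<pi>\<close> it agrees with \<open>L x + Ln (u / u x)\<close>, since a continuous logarithm
  cannot jump by a multiple of \<open>2\<pi>\<i>\<close>.
\<close>
lemma log_branch_has_derivative: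
  assumes S: "open S" "x \<in> S" and L: "log_branch L u S" and u: "(u has_derivative D) (at x)"
  shows "(L has_derivative (\<lambda>v. inverse (u x) * D v)) (at x)"
proof -
  have cont: "isCont L x" and expL: "\<And>y. y \<in> S \<Longrightarrow> exp (L y) = u y"
    using L S by (auto simp: log_branch_def continuous_on_eq_continuous_at)
  define V where "V = {y \<in> S. dist (L y) (L x) < 1}"
  have "continuous_on S L" using L by (simp add: log_branch_def)
  then have "open V"
    unfolding V_def using continuous_open_preimage[OF _ S(1) open_ball[of "L x" 1], of L]
    by (auto simp: vimage_def Int_def dist_commute)
  have xV: "x \<in> V" using S by (simp add: V_def)
  have ux: "u x \<noteq> 0" using expL[OF S(2)] by (metis exp_not_eq_zero)
  have eq: "L x + Ln (u y / u x) = L y" if "y \<in> V" for y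
  proof -
    have y: "y \<in> S" "norm (L y - L x) < 1" using that by (auto simp: V_def dist_norm)
    then have "\<bar>Im (L y - L x)\<bar> < pi" using abs_Im_le_cmod[of "L y - L x"] pi_gt3 by linarith
    then have "Ln (exp (L y - L x)) = L y - L x" by (intro Ln_exp) auto
    then show ?thesis using expL y S by (simp add: exp_diff)
  qed
  have 1: "((\<lambda>y. u y / u x) has_derivative (\<lambda>v. inverse (u x) * D v)) (at x)"
    using has_derivative_mult_left[OF u, of "inverse (u x)"] by (simp add: field_simps)
  have 2: "(Ln has_derivative (*) 1) (at (u x / u x))"
    using has_field_derivative_Ln[of 1] ux by (simp add: has_field_derivative_def)
  have "((\<lambda>y. L x + Ln (u y / u x)) has_derivative (\<lambda>v. inverse (u x) * D v)) (at x)"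
    using has_derivative_add[OF has_derivative_const[of "L x"] has_derivative_compose[OF 1 2]] by simp
  then show ?thesis
    by (rule has_derivative_transform_within_open[OF _ \<open>open V\<close> xV eq])
qed

lemma Ck_on_log_branch:
  assumes "open S" "log_branch L u S" "Ck_on k u S"
  shows "Ck_on k L S"
proof (cases k)
  case 0 then show ?thesis using assms(2) by (simp add: log_branch_def)
next
  case (Suc m)
  have nz: "u x \<noteq> 0" if "x \<in> S" for x using that assms(2) by (metis exp_not_eq_zero log_branch_def)
  have um: "Ck_on (Suc m) u S" using assms(3) Suc by simp
  note u = Ck_on_SucD_derivative[OF um]
  have "(L has_derivative (\<lambda>v. inverse (u x) * frechet_derivative u (at x) v)) (at x)" if "x \<in> S" for x
    by (rule log_branch_has_derivative[OF assms(1) that assms(2) u(1)[OF that]])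
  moreover have "Ck_on m (\<lambda>x. inverse (u x) * frechet_derivative u (at x) v) S" for v
    by (rule Ck_on_mult[OF assms(1) Ck_on_inverse[OF assms(1) nz Ck_on_SucD[OF um]] u(2)])
  ultimately show ?thesis unfolding Suc
    by (rule Ck_on_SucI[OF assms(1)])
qed

section \<open>Smooth functions\<close>

lemma smooth_on_const: "smooth_on (\<lambda>x. c) S"
  by (simp add: smooth_on_def Ck_on_const)

lemma smooth_on_add:
  "open S \<Longrightarrow> smooth_on f S \<Longrightarrow> smooth_on g S \<Longrightarrow> smooth_on (\<lambda>x. f x + g x) S"
  by (simp add: smooth_on_def Ck_on_add)

lemma smooth_on_mult:
  fixes f g :: "complex \<Rightarrow> complex"
  shows "open S \<Longrightarrow> smooth_on f S \<Longrightarrow> smooth_on g S \<Longrightarrow> smooth_on (\<lambda>x. f x * g x) S"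
  by (simp add: smooth_on_def Ck_on_mult)

lemma smooth_on_minus:
  fixes f :: "complex \<Rightarrow> complex"
  shows "open S \<Longrightarrow> smooth_on f S \<Longrightarrow> smooth_on (\<lambda>x. - f x) S"
  using smooth_on_mult[OF _ smooth_on_const[of "-1"]] by simp

lemma smooth_on_diff:
  fixes f g :: "complex \<Rightarrow> complex"
  shows "open S \<Longrightarrow> smooth_on f S \<Longrightarrow> smooth_on g S \<Longrightarrow> smooth_on (\<lambda>x. f x - g x) S"
  using smooth_on_add[OF _ _ smooth_on_minus, of S f g] by simp

lemma smooth_on_divide:
  fixes f g :: "complex \<Rightarrow> complex"
  assumes "open S" "smooth_on f S" "smooth_on g S" "\<And>x. x \<in> S \<Longrightarrow> g x \<noteq> 0"
  shows "smooth_on (\<lambda>x. f x / g x) S"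
  unfolding divide_inverse using assms
  by (intro smooth_on_mult) (auto simp: smooth_on_def Ck_on_inverse)

lemma smooth_on_cong:
  "open S \<Longrightarrow> (\<And>x. x \<in> S \<Longrightarrow> f x = g x) \<Longrightarrow> smooth_on f S \<Longrightarrow> smooth_on g S"
  unfolding smooth_on_def using Ck_on_cong by blast

lemma smooth_on_subset: "smooth_on f T \<Longrightarrow> S \<subseteq> T \<Longrightarrow> smooth_on f S"
  unfolding smooth_on_def using Ck_on_subset by blast

lemma smooth_on_local:
  assumes "\<And>x. x \<in> S \<Longrightarrow> \<exists>T. open T \<and> x \<in> T \<and> smooth_on f T"
  shows "smooth_on f S"
  unfolding smooth_on_def using assms by (intro allI Ck_on_local) (meson smooth_on_def)

lemma smooth_on_Pair:
  "open S \<Longrightarrow> smooth_on f S \<Longrightarrow> smooth_on g S \<Longrightarrow> smooth_on (\<lambda>x. (f x, g x)) S"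
  by (simp add: smooth_on_def Ck_on_Pair)

lemma smooth_on_compose:
  fixes f g :: "complex \<Rightarrow> complex"
  shows "open S \<Longrightarrow> open T \<Longrightarrow> f ` S \<subseteq> T \<Longrightarrow> smooth_on g T \<Longrightarrow> smooth_on f S \<Longrightarrow>
    smooth_on (\<lambda>x. g (f x)) S"
  unfolding smooth_on_def using Ck_on_compose by blast

lemma smooth_on_holomorphic: "open S \<Longrightarrow> f holomorphic_on S \<Longrightarrow> smooth_on f S"
  by (simp add: smooth_on_def Ck_on_holomorphic)

lemma smooth_on_log_branch: "open S \<Longrightarrow> log_branch L u S \<Longrightarrow> smooth_on u S \<Longrightarrow> smooth_on L S"
  unfolding smooth_on_def using Ck_on_log_branch by blast

lemma smooth_on_del: "open S \<Longrightarrow> smooth_on f S \<Longrightarrow> smooth_on (del f) S"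
  and smooth_on_delbar: "open S \<Longrightarrow> smooth_on f S \<Longrightarrow> smooth_on (delbar f) S"
  unfolding smooth_on_def using Ck_on_del_delbar by blast+

lemma smooth_on_differentiable: "smooth_on f S \<Longrightarrow> x \<in> S \<Longrightarrow> f differentiable (at x)"
  unfolding smooth_on_def by (metis Ck_on_differentiable)

lemma smooth_on_has_wirtinger:
  "smooth_on f S \<Longrightarrow> x \<in> S \<Longrightarrow> has_wirtinger f (del f x) (delbar f x) x"
  using smooth_on_differentiable differentiable_imp_has_wirtinger by blast

lemma smooth_on_delbar_del:
  assumes "open S" "smooth_on f S" "x \<in> S"
  shows "delbar (del f) x = del (delbar f) x"
  using delbar_del_commute[OF assms(1,3)] smooth_on_differentiable assms
    smooth_on_del[OF assms(1,2)] smooth_on_delbar[OF assms(1,2)] by blast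

lemma log_branch_nonzero: "log_branch L u S \<Longrightarrow> x \<in> S \<Longrightarrow> u x \<noteq> 0"
  unfolding log_branch_def by (metis exp_not_eq_zero)

lemma log_branch_holomorphic:
  assumes "open S" "log_branch L u S" "u holomorphic_on S"
  shows "L holomorphic_on S"
    and "\<And>x. x \<in> S \<Longrightarrow> (L has_field_derivative deriv u x / u x) (at x)"
proof -
  show *: "(L has_field_derivative deriv u x / u x) (at x)" if "x \<in> S" for x
  proof -
    have "(u has_derivative (*) (deriv u x)) (at x)"
      using holomorphic_derivI[OF assms(3,1) that] by (simp add: has_field_derivative_def)
    from log_branch_has_derivative[OF assms(1) that assms(2) this]
    show ?thesis unfolding has_field_derivative_def
      by (rule has_derivative_eq_rhs) (simp add: fun_eq_iff field_simps)
  qed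
  then show "L holomorphic_on S"
    using assms(1) holomorphic_on_open by blast
qed

lemma log_branch_has_wirtinger:
  assumes "open S" "log_branch L u S" "x \<in> S" "has_wirtinger u a b x"
  shows "has_wirtinger L (a / u x) (b / u x) x"
  using log_branch_has_derivative[OF assms(1,3,2) assms(4)[unfolded has_wirtinger_def]]
  unfolding has_wirtinger_def
  by (rule has_derivative_eq_rhs) (simp add: fun_eq_iff divide_inverse algebra_simps)

text \<open>
  The preimage of \<open>1\<close> under \<open>exp\<close> is discrete, so a continuous function into it is constant on a
  connected set.
\<close>
lemma exp_one_constant:
  assumes "connected S" "continuous_on S g" "\<And>x. x \<in> S \<Longrightarrow> exp (g x) = 1"
  obtains k :: int where "\<And>x. x \<in> S \<Longrightarrow> g x = 2 * of_real pi * \<i> * of_int k"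
proof -
  have int: "\<exists>k::int. g x = 2 * of_real pi * \<i> * of_int k" if x: "x \<in> S" for x
    using assms(3)[OF x] unfolding exp_eq_1 by (auto simp: complex_eq_iff intro: exI)
  have "g constant_on S"
  proof (rule continuous_discrete_range_constant[OF assms(1,2)])
    fix x assume x: "x \<in> S"
    show "\<exists>e>0. \<forall>y. y \<in> S \<and> g y \<noteq> g x \<longrightarrow> e \<le> norm (g y - g x)"
    proof (intro exI[of _ "2 * pi"] conjI allI impI)
      fix y assume y: "y \<in> S \<and> g y \<noteq> g x"
      obtain k l :: int where kl: "g x = 2 * of_real pi * \<i> * of_int k" "g y = 2 * of_real pi * \<i> * of_int l"
        using int x y by metis
      then have "l \<noteq> k" using y by auto
      then have "1 \<le> \<bar>of_int (l - k) :: real\<bar>" by linarith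
      moreover have "g y - g x = of_real (2 * pi * of_int (l - k)) * \<i>"
        unfolding kl by (simp add: algebra_simps)
      moreover have "norm (of_real r * \<i>) = \<bar>r\<bar>" for r by (simp add: norm_mult)
      ultimately have "norm (g y - g x) = 2 * pi * \<bar>of_int (l - k)\<bar>" "1 \<le> \<bar>of_int (l - k) :: real\<bar>"
        by (simp_all only: abs_mult) simp
      then show "2 * pi \<le> norm (g y - g x)" by simp
    qed simp
  qed
  then obtain c where c: "\<And>x. x \<in> S \<Longrightarrow> g x = c" unfolding constant_on_def by blast
  show ?thesis
  proof (cases "S = {}")
    case True then show ?thesis using that[of 0] by simp
  next
    case False
    then obtain x where "x \<in> S" by blast
    with int c obtain k :: int where "c = 2 * of_real pi * \<i> * of_int k" by metis
    with c that show ?thesis by blast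
  qed
qed

section \<open>Forms and the Cech differential\<close>

text \<open>
  A holomorphic change of coordinate does not mix \<open>dz\<close> and \<open>dzbar\<close>, so \<open>\<delta>\<close> acts on each coefficient
  separately.
\<close>
lemma pullback_holomorphic:
  assumes "(u has_field_derivative c) (at x)"
  shows "pullback u \<eta> x = (coef_one \<eta> (u x), coef_dz \<eta> (u x) * c, coef_dzbar \<eta> (u x) * cnj c,
           coef_dz_dzbar \<eta> (u x) * (c * cnj c))"
proof -
  note w = has_field_derivative_imp_wirtinger[OF assms]
  note w' = has_wirtinger_cnj[OF w]
  show ?thesis
    using w w' by (simp add: pullback_def Let_def has_wirtinger_del has_wirtinger_delbar)
qed

lemma pullback_zero: "pullback u 0 = 0"
  by (simp add: pullback_def fun_eq_iff zero_prod_def)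

lemma ext_d_zero: "ext_d 0 = 0"
proof -
  have "ext_d 0 x = 0" for x
    using has_wirtinger_del[OF has_wirtinger_const] has_wirtinger_delbar[OF has_wirtinger_const]
    by (simp add: ext_d_def zero_prod_def)
  then show ?thesis by (simp add: fun_eq_iff)
qed

lemma ext_d_at:
  assumes "has_wirtinger (coef_one \<eta>) a a' x"
    and "has_wirtinger (coef_dz \<eta>) b b' x" and "has_wirtinger (coef_dzbar \<eta>) c c' x"
  shows "ext_d \<eta> x = (0, a, a', c - b')"
  using assms by (simp add: ext_d_def has_wirtinger_del has_wirtinger_delbar)

lemma ext_d_fun_form: "ext_d (fun_form g) = (\<lambda>x. (0, del g x, delbar g x, 0))"
  using has_wirtinger_del[OF has_wirtinger_const] has_wirtinger_delbar[OF has_wirtinger_const]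
  by (simp add: ext_d_def fun_form_def fun_eq_iff)

lemma cech_delta_2:
  "cech_delta C \<phi> [i, j] x = \<phi> [j] x - pullback (transition C i j) (\<phi> [i]) x"
  by (simp add: cech_delta_def Let_def)

lemma cech_delta_3:
  "cech_delta C \<phi> [i, j, k] x = \<phi> [j, k] x - \<phi> [i, k] x + pullback (transition C j k) (\<phi> [i, j]) x"
  by (simp add: cech_delta_def Let_def eval_nat_numeral)

lemma cech_delta_4:
  "cech_delta C \<phi> [i, j, k, l] x = \<phi> [j, k, l] x - \<phi> [i, k, l] x + \<phi> [i, j, l] x
     - pullback (transition C k l) (\<phi> [i, j, k]) x"
  by (simp add: cech_delta_def Let_def eval_nat_numeral)

lemma cech_delta_5:
  "cech_delta C \<phi> [i, j, k, l, m] x = \<phi> [j, k, l, m] x - \<phi> [i, k, l, m] x + \<phi> [i, j, l, m] x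
     - \<phi> [i, j, k, m] x + pullback (transition C l m) (\<phi> [i, j, k, l]) x"
  by (simp add: cech_delta_def Let_def eval_nat_numeral)

text \<open>
  The \<open>\<delta>\<close> half of \<open>D\<Omega> = 0\<close> in the bidegrees where \<open>\<Omega>\<close> has no component.
\<close>
lemma cech_delta_vanishing:
  assumes "\<And>js. Suc (length js) = length is \<Longrightarrow> \<phi> js = 0"
  shows "cech_delta C \<phi> is = 0"
proof (cases "length is \<le> 1")
  case True then show ?thesis by (simp add: cech_delta_def Let_def fun_eq_iff)
next
  case False
  have "\<phi> (take k is @ drop (Suc k) is) = 0" if "k < length is - 1" for k
    by (rule assms) (use that False in simp)
  moreover have "\<phi> (butlast is) = 0" by (rule assms) (use False in simp)
  ultimately have "cech_delta C \<phi> is x = 0" for x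
    by (simp add: cech_delta_def Let_def pullback_zero)
  then show ?thesis by (simp add: fun_eq_iff)
qed

lemma cech_delta_fun_3:
  "cech_delta_fun C \<phi> [i, j, k] x = \<phi> [j, k] x - \<phi> [i, k] x + \<phi> [i, j] (transition C j k x)"
  by (simp add: cech_delta_fun_def cech_delta_3 fun_form_def pullback_def Let_def)

lemma cech_delta_fun_4:
  "cech_delta_fun C \<phi> [i, j, k, l] x = \<phi> [j, k, l] x - \<phi> [i, k, l] x + \<phi> [i, j, l] x
     - \<phi> [i, j, k] (transition C k l x)"
  by (simp add: cech_delta_fun_def cech_delta_4 fun_form_def pullback_def Let_def)

section \<open>Covers by holomorphic coordinates\<close>

text \<open>
  What the local computations need to know of a cover of a Riemann surface. It is shared by the
  source and the target of the deformation map.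
\<close>
locale coordinate_cover =
  fixes C :: "('i, 'a) coord_cover"
  assumes inj_coord: "i \<in> idx C \<Longrightarrow> inj_on (coord C i) (patch C i)"
    and open_cdom: "is \<noteq> [] \<Longrightarrow> set is \<subseteq> idx C \<Longrightarrow> open (cdom C is)"
    and transition_holomorphic: "i \<in> idx C \<Longrightarrow> j \<in> idx C \<Longrightarrow> transition C i j holomorphic_on cdom C [i, j]"
begin

lemma transition_coord:
  "j \<in> idx C \<Longrightarrow> p \<in> patch C j \<Longrightarrow> transition C i j (coord C j p) = coord C i p"
  by (simp add: transition_def inj_coord)

text \<open>
  Deleting indices from a list, the last one included, is a change of coordinate between overlaps.
\<close>
lemma transition_mem:
  assumes "x \<in> cdom C is" "is \<noteq> []" "set is \<subseteq> idx C" "js \<noteq> []" "set js \<subseteq> set is"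
  shows "transition C (last js) (last is) x \<in> cdom C js"
proof -
  obtain p where p: "x = coord C (last is) p" "\<And>i. i \<in> set is \<Longrightarrow> p \<in> patch C i"
    using assms(1) by (auto simp: cdom_def)
  have l: "last is \<in> set is" using assms(2) by simp
  have "transition C (last js) (last is) x = coord C (last js) p"
    using p l assms(3) transition_coord by blast
  moreover have "p \<in> (\<Inter>i\<in>set js. patch C i)" using p(2) assms(5) by auto
  ultimately show ?thesis by (simp add: cdom_def)
qed

lemma cdom_subset:
  assumes "js \<noteq> []" "set js \<subseteq> set is" "last js = last is"
  shows "cdom C is \<subseteq> cdom C js"
  using assms by (auto simp: cdom_def)

text \<open>
  The cocycle identity \<open>z\<^sub>i\<^sub>j \<circ> z\<^sub>j\<^sub>k = z\<^sub>i\<^sub>k\<close>.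
\<close>
lemma transition_transition:
  assumes "x \<in> cdom C is" "is \<noteq> []" "set is \<subseteq> idx C" "i \<in> set is" "j \<in> set is"
  shows "transition C i j (transition C j (last is) x) = transition C i (last is) x"
proof -
  obtain p where p: "x = coord C (last is) p" "\<And>i. i \<in> set is \<Longrightarrow> p \<in> patch C i"
    using assms(1) by (auto simp: cdom_def)
  have l: "last is \<in> set is" using assms(2) by simp
  show ?thesis
    using p l assms(3,4,5) by (auto simp: cdom_def transition_coord subset_iff)
qed

lemma transition_has_field_derivative:
  assumes "i \<in> idx C" "j \<in> idx C" "x \<in> cdom C [i, j]"
  shows "(transition C i j has_field_derivative deriv (transition C i j) x) (at x)"
  using holomorphic_derivI[OF transition_holomorphic[OF assms(1,2)] open_cdom assms(3)] assms by auto

lemma pullback_transition: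
  assumes "i \<in> idx C" "j \<in> idx C" "x \<in> cdom C [i, j]"
  shows "pullback (transition C i j) \<eta> x =
    (let y = transition C i j x; c = deriv (transition C i j) x in
     (coef_one \<eta> y, coef_dz \<eta> y * c, coef_dzbar \<eta> y * cnj c, coef_dz_dzbar \<eta> y * (c * cnj c)))"
  unfolding Let_def by (rule pullback_holomorphic[OF transition_has_field_derivative[OF assms]])

lemma deriv_transition_transition:
  assumes "x \<in> cdom C [i, j, k]" "i \<in> idx C" "j \<in> idx C" "k \<in> idx C"
  shows "deriv (transition C i j) (transition C j k x) * deriv (transition C j k) x = deriv (transition C
    i k) x"
proof -
  let ?S = "cdom C [i, j, k]"
  have sub: "x \<in> cdom C [j, k]" "x \<in> cdom C [i, k]" "transition C j k x \<in> cdom C [i, j]"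
    using cdom_subset[of "[j,k]" "[i,j,k]"] cdom_subset[of "[i,k]" "[i,j,k]"]
      transition_mem[OF assms(1), of "[i, j]"] assms by auto
  have "((\<lambda>y. transition C i j (transition C j k y)) has_field_derivative
      deriv (transition C i j) (transition C j k x) * deriv (transition C j k) x) (at x)"
    by (rule DERIV_chain2) (intro transition_has_field_derivative sub assms)+
  then have "(transition C i k has_field_derivative
      deriv (transition C i j) (transition C j k x) * deriv (transition C j k) x) (at x)"
    by (rule has_field_derivative_transform_within_open[OF _ open_cdom assms(1)])
       (use assms transition_transition[of _ "[i, j, k]" i j] in auto)
  then show ?thesis by (simp add: DERIV_imp_deriv)
qed

end

section \<open>Riemann surfaces provide coordinate covers\<close>

lemma holomorphic_coordinateD:
  assumes "holomorphic_coordinate X A U u"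
  shows "openin X U" "inj_on u U" "\<And>V. openin X V \<Longrightarrow> V \<subseteq> U \<Longrightarrow> open (u ` V)"
    "continuous_map (subtopology X U) euclidean u"
    "continuous_map (top_of_set (u ` U)) X (inv_into U u)"
proof -
  have o: "openin X U" "open (u ` U)"
    and h: "homeomorphic_map (subtopology X U) (top_of_set (u ` U)) u"
    using assms by (auto simp: holomorphic_coordinate_def is_chart_def)
  have ts: "topspace (subtopology X U) = U"
    using openin_subset[OF o(1)] by auto
  show "openin X U" by fact
  show inj: "inj_on u U" using homeomorphic_imp_injective_map[OF h] ts by simp
  show "open (u ` V)" if "openin X V" "V \<subseteq> U" for V
  proof -
    have "openin (subtopology X U) V" using that by (metis openin_subtopology_Int2 inf.absorb_iff2
      inf.commute)
    then have "openin (top_of_set (u ` U)) (u ` V)"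
      using homeomorphic_imp_open_map[OF h] by (simp add: open_map_def)
    then show ?thesis using o(2) openin_open_trans by blast
  qed
  show "continuous_map (subtopology X U) euclidean u"
    using homeomorphic_imp_continuous_map[OF h] continuous_map_into_fulltopology by blast
  obtain g where g: "homeomorphic_maps (subtopology X U) (top_of_set (u ` U)) u g"
    using h homeomorphic_map_maps by blast
  have "continuous_map (top_of_set (u ` U)) (subtopology X U) (inv_into U u)"
  proof (rule continuous_map_eq)
    show "continuous_map (top_of_set (u ` U)) (subtopology X U) g"
      using g by (simp add: homeomorphic_maps_def)
    fix y assume "y \<in> topspace (top_of_set (u ` U))"
    then obtain p where "p \<in> U" "y = u p" by auto
    then show "g y = inv_into U u y" using g inj ts by (simp add: homeomorphic_maps_def)
  qed
  then show "continuous_map (top_of_set (u ` U)) X (inv_into U u)"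
    using continuous_map_into_fulltopology by blast
qed

lemma open_coordinate_cdom:
  assumes "\<And>i. i \<in> idx C \<Longrightarrow> holomorphic_coordinate X A (patch C i) (coord C i)"
    and "is \<noteq> []" "set is \<subseteq> idx C"
  shows "open (cdom C is)"
  unfolding cdom_def
proof (rule holomorphic_coordinateD(3)[OF assms(1)])
  show "last is \<in> idx C" using assms(2,3) by auto
  show "openin X (\<Inter>i\<in>set is. patch C i)"
    using assms(2,3) holomorphic_coordinateD(1)[OF assms(1)] by (intro openin_INT2) auto
  show "(\<Inter>i\<in>set is. patch C i) \<subseteq> patch C (last is)" using assms(2) by auto
qed

lemma chart_around:
  assumes "riemann_surface X A" "p \<in> topspace X"
  shows "\<exists>W w. (W, w) \<in> A \<and> p \<in> W"
proof -
  have "p \<in> (\<Union>c\<in>A. fst c)" using assms by (simp add: riemann_surface_def)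
  then show ?thesis by force
qed

lemma atlas_chart_coordinate:
  "riemann_surface X A \<Longrightarrow> (W, w) \<in> A \<Longrightarrow> holomorphic_coordinate X A W w"
  by (simp add: holomorphic_coordinate_def riemann_surface_def)

text \<open>
  Compatibility is only given between a coordinate and the charts of the atlas, so near each point
  the change of coordinate is factored through a chart of the atlas around that point.
\<close>
lemma coordinate_change_holomorphic:
  assumes X: "riemann_surface X A"
    and U: "holomorphic_coordinate X A U u" and V: "holomorphic_coordinate X A V v"
  shows "(v \<circ> inv_into U u) holomorphic_on u ` (U \<inter> V)"
proof -
  note HU = holomorphic_coordinateD[OF U] and HV = holomorphic_coordinateD[OF V]
  have "\<exists>T. open T \<and> x \<in> T \<and> (v \<circ> inv_into U u) holomorphic_on T" if x: "x \<in> u ` (U \<inter> V)" for x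
  proof -
    obtain p where p: "p \<in> U" "p \<in> V" "x = u p" using x by auto
    then have "p \<in> topspace X" using openin_subset[OF HU(1)] by auto
    then obtain W w where W: "(W, w) \<in> A" "p \<in> W"
      using chart_around[OF X] by blast
    have ch: "is_chart X (W, w)" using X W by (auto simp: riemann_surface_def)
    have oW: "openin X W" and injW: "inj_on w W"
      using ch homeomorphic_imp_injective_map[of "subtopology X W" _ w] openin_subset[of X W]
      by (auto simp: is_chart_def Int_absorb1 Int_absorb2)
    let ?T = "u ` (U \<inter> V \<inter> W)"
    have 1: "(w \<circ> inv_into U u) holomorphic_on u ` (U \<inter> W)"
      and 2: "(v \<circ> inv_into W w) holomorphic_on w ` (W \<inter> V)"
      using U V W(1) by (auto simp: holomorphic_coordinate_def chart_change_holomorphic_def)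
    have "((v \<circ> inv_into W w) \<circ> (w \<circ> inv_into U u)) holomorphic_on ?T"
      by (rule holomorphic_on_compose_gen[OF holomorphic_on_subset[OF 1] 2])
         (auto simp: HU(2))
    then have "(v \<circ> inv_into U u) holomorphic_on ?T"
      by (rule holomorphic_transform) (auto simp: HU(2) injW)
    moreover have "open ?T" by (rule HU(3)) (use HU(1) HV(1) oW in auto)
    ultimately show ?thesis using p W(2) by blast
  qed
  then obtain T where T: "\<And>x. x \<in> u ` (U \<inter> V) \<Longrightarrow> open (T x) \<and> x \<in> T x \<and> (v \<circ> inv_into U u) holomorphic_on T x"
    by metis
  have "(v \<circ> inv_into U u) holomorphic_on (\<Union>x\<in>u ` (U \<inter> V). T x)"
    using T by (intro holomorphic_on_UN_open) auto
  then show ?thesis by (rule holomorphic_on_subset) (use T in auto)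
qed

lemma coordinate_coverI:
  assumes X: "riemann_surface X A"
    and hol: "\<And>i. i \<in> idx C \<Longrightarrow> holomorphic_coordinate X A (patch C i) (coord C i)"
  shows "coordinate_cover C"
proof
  show "inj_on (coord C i) (patch C i)" if "i \<in> idx C" for i
    using holomorphic_coordinateD(2)[OF hol[OF that]] .
  show "open (cdom C is)" if "is \<noteq> []" "set is \<subseteq> idx C" for "is"
    by (rule open_coordinate_cdom[OF hol that])
  show "transition C i j holomorphic_on cdom C [i, j]" if "i \<in> idx C" "j \<in> idx C" for i j
    using coordinate_change_holomorphic[OF X hol[OF that(2)] hol[OF that(1)]]
    by (simp add: transition_def cdom_def Int_commute)
qed

text \<open>
  Overlaps of a good cover are contractible, and connectedness passes to their coordinate images.
\<close>
lemma connected_cdom: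
  assumes hol: "\<And>i. i \<in> idx C \<Longrightarrow> holomorphic_coordinate X A (patch C i) (coord C i)"
    and good: "good_cover X (idx C) (patch C)"
    and "is": "is \<noteq> []" "set is \<subseteq> idx C"
  shows "connected (cdom C is)"
proof -
  let ?P = "\<Inter>i\<in>set is. patch C i"
  have l: "last is \<in> set is" "last is \<in> idx C" using "is" by auto
  have "connectedin X ?P"
  proof (cases "?P = {}")
    case True then show ?thesis by simp
  next
    case False
    then have "contractible_space (subtopology X ?P)"
      using good "is" unfolding good_cover_def by (metis List.finite_set set_empty)
    then have "connected_space (subtopology X ?P)"
      using contractible_imp_path_connected_space path_connected_imp_connected_space by blast
    moreover have "?P \<subseteq> topspace X"
      using l openin_subset[OF holomorphic_coordinateD(1)[OF hol[OF l(2)]]] by auto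
    ultimately show ?thesis by (simp add: connectedin_def)
  qed
  then have "connectedin (subtopology X (patch C (last is))) ?P"
    using l by (auto simp: connectedin_subtopology)
  then have "connectedin euclidean (coord C (last is) ` ?P)"
    by (rule connectedin_continuous_map_image[OF holomorphic_coordinateD(4)[OF hol[OF l(2)]]])
  then show ?thesis by (simp add: cdom_def)
qed

text \<open>
  Smoothness is given in charts of the two atlases; near each point the local representative is
  the one in such charts, composed on both sides with holomorphic changes of coordinate.
\<close>
lemma local_rep_smooth:
  assumes X: "riemann_surface X A" and Y: "riemann_surface Y B"
    and f: "smooth_map X A Y B f"
    and U: "holomorphic_coordinate X A U u" and V: "holomorphic_coordinate Y B V v"
    and fU: "f ` U \<subseteq> V"
  shows "smooth_on (v \<circ> f \<circ> inv_into U u) (u ` U)"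
proof (rule smooth_on_local)
  note HU = holomorphic_coordinateD[OF U] and HV = holomorphic_coordinateD[OF V]
  fix x assume "x \<in> u ` U"
  then obtain p where p: "p \<in> U" "x = u p" by auto
  have fcont: "continuous_map X Y f" using f by (simp add: smooth_map_def)
  have pX: "p \<in> topspace X" using p openin_subset[OF HU(1)] by auto
  then have "f p \<in> topspace Y" using continuous_map_image_subset_topspace[OF fcont] by auto
  then obtain W w where W: "(W, w) \<in> B" "f p \<in> W" using chart_around[OF Y] by blast
  obtain P q where P: "(P, q) \<in> A" "p \<in> P" using chart_around[OF X pX] by blast
  note cP = atlas_chart_coordinate[OF X P(1)] and cW = atlas_chart_coordinate[OF Y W(1)]
  note HP = holomorphic_coordinateD[OF cP] and HW = holomorphic_coordinateD[OF cW]
  define N where "N = {p \<in> topspace X. f p \<in> W} \<inter> P \<inter> U"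
  have oN: "openin X N" unfolding N_def
    using openin_continuous_map_preimage[OF fcont HW(1)] HP(1) HU(1) by auto
  have "smooth_on (w \<circ> f \<circ> inv_into P q) (q ` (P \<inter> f -` W))"
    using f P(1) W(1) by (auto simp: smooth_map_def)
  then have s2: "smooth_on (w \<circ> f \<circ> inv_into P q) (q ` N)"
    by (rule smooth_on_subset) (auto simp: N_def)
  have oU: "open (u ` N)" by (rule HU(3)[OF oN]) (auto simp: N_def)
  have oP: "open (q ` N)" by (rule HP(3)[OF oN]) (auto simp: N_def)
  have oW: "open (w ` (W \<inter> V))" by (rule HW(3)) (use HW(1) HV(1) in auto)
  note o = oU oP oW
  have s1: "smooth_on (q \<circ> inv_into U u) (u ` N)"
    by (rule smooth_on_holomorphic[OF o(1)], rule holomorphic_on_subset[OF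
      coordinate_change_holomorphic[OF X U cP]])
       (auto simp: N_def)
  have s3: "smooth_on (v \<circ> inv_into W w) (w ` (W \<inter> V))"
    by (rule smooth_on_holomorphic[OF o(3) coordinate_change_holomorphic[OF Y cW V]])
  have inv: "inv_into P q (q a) = a" "inv_into U u (u a) = a" if "a \<in> N" for a
    using that HP(2) HU(2) by (auto simp: N_def)
  have "smooth_on (\<lambda>y. (w \<circ> f \<circ> inv_into P q) ((q \<circ> inv_into U u) y)) (u ` N)"
    by (rule smooth_on_compose[OF o(1,2) _ s2 s1]) (auto simp: inv)
  then have "smooth_on (\<lambda>y. (v \<circ> inv_into W w) ((w \<circ> f \<circ> inv_into P q) ((q \<circ> inv_into U u) y))) (u ` N)"
    by (rule smooth_on_compose[OF o(1,3) _ s3, rotated])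
       (use fU in \<open>auto simp: inv N_def HP(2) HU(2)\<close>)
  then have "smooth_on (v \<circ> f \<circ> inv_into U u) (u ` N)"
    by (rule smooth_on_cong[OF o(1), rotated]) (auto simp: N_def inv HW(2) HP(2) HU(2))
  then show "\<exists>T. open T \<and> x \<in> T \<and> smooth_on (v \<circ> f \<circ> inv_into U u) T"
    using o(1) p P(2) W(2) pX by (intro exI[of _ "u ` N"]) (auto simp: N_def)
qed

section \<open>The deformation map in local coordinates\<close>

text \<open>
  The deformation map together with the chosen logarithms. Connectedness of the overlaps is what
  makes differences of logarithms constant. The logarithms \<open>Lz\<close> and \<open>Lf\<close> also witness that \<open>z\<^sub>i\<^sub>j'\<close> and
  \<open>\<partial>F\<^sub>i\<close> vanish nowhere, so that \<open>\<mu>\<close> is smooth.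
\<close>
locale deformation = src: coordinate_cover C + tgt: coordinate_cover E
  for C :: "('i, 'a) coord_cover" and E :: "('i, 'b) coord_cover" +
  fixes f :: "'a \<Rightarrow> 'b" and Lz Lw :: "'i list \<Rightarrow> complex \<Rightarrow> complex" and Lf :: "'i \<Rightarrow> complex \<Rightarrow> complex"
  assumes idx_eq: "idx E = idx C"
    and patch_eq: "i \<in> idx C \<Longrightarrow> patch E i = f ` patch C i"
    and F_smooth: "i \<in> idx C \<Longrightarrow> smooth_on (local_rep C E f i) (cdom C [i])"
    and connected: "is \<noteq> [] \<Longrightarrow> set is \<subseteq> idx C \<Longrightarrow> connected (cdom C is)"
    and Lz: "i \<in> idx C \<Longrightarrow> j \<in> idx C \<Longrightarrow> log_branch (Lz [i, j]) (deriv (transition C i j)) (cdom C [i, j])"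
    and Lw: "i \<in> idx C \<Longrightarrow> j \<in> idx C \<Longrightarrow> log_branch (Lw [i, j]) (deriv (transition E i j)) (cdom E [i, j])"
    and Lf: "i \<in> idx C \<Longrightarrow> log_branch (Lf i) (del (local_rep C E f i)) (cdom C [i])"
begin

abbreviation "F \<equiv> local_rep C E f"
abbreviation "\<mu> \<equiv> beltrami C E f"
abbreviation "z \<equiv> transition C"
abbreviation "w \<equiv> transition E"
abbreviation "V i j \<equiv> \<lambda>x. Lw [i, j] (F j x)"

lemma F_mem:
  assumes "x \<in> cdom C is" "is \<noteq> []" "set is \<subseteq> idx C"
  shows "F (last is) x \<in> cdom E is"
proof -
  obtain p where p: "x = coord C (last is) p" "\<And>i. i \<in> set is \<Longrightarrow> p \<in> patch C i"
    using assms(1) by (auto simp: cdom_def)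
  have l: "last is \<in> set is" "last is \<in> idx C" using assms by auto
  have "F (last is) x = coord E (last is) (f p)"
    using p l by (simp add: local_rep_def src.inj_coord)
  moreover have "f p \<in> (\<Inter>i\<in>set is. patch E i)" using p(2) assms(3) patch_eq by auto
  ultimately show ?thesis by (simp add: cdom_def)
qed

text \<open>
  The identity \<open>F\<^sub>i \<circ> z\<^sub>i\<^sub>j = w\<^sub>i\<^sub>j \<circ> F\<^sub>j\<close>: both sides are \<open>f\<close> read in the coordinates \<open>z\<^sub>j\<close> and \<open>w\<^sub>i\<close>.
\<close>
lemma F_transition:
  assumes "i \<in> idx C" "j \<in> idx C" "x \<in> cdom C [i, j]"
  shows "F i (z i j x) = w i j (F j x)"
proof -
  obtain p where p: "x = coord C j p" "p \<in> patch C i" "p \<in> patch C j"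
    using assms(3) by (auto simp: cdom_def)
  have "f p \<in> patch E j" using p assms patch_eq by auto
  then have "w i j (F j x) = coord E i (f p)"
    using p assms tgt.transition_coord[of j "f p" i] by (simp add: local_rep_def src.inj_coord idx_eq)
  then show ?thesis
    using p assms src.transition_coord[of j p i] by (simp add: local_rep_def src.inj_coord)
qed

lemma open_src: "set (i # is) \<subseteq> idx C \<Longrightarrow> open (cdom C (i # is))"
  and open_tgt: "set (i # is) \<subseteq> idx C \<Longrightarrow> open (cdom E (i # is))"
  using src.open_cdom[of "i # is"] tgt.open_cdom[of "i # is"] by (auto simp: idx_eq)

lemma cdom_last: "x \<in> cdom C is \<Longrightarrow> is \<noteq> [] \<Longrightarrow> last is = k \<Longrightarrow> x \<in> cdom C [k]"
  using src.cdom_subset[of "[k]" "is"] by auto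

lemma F_has_wirtinger:
  "k \<in> idx C \<Longrightarrow> x \<in> cdom C [k] \<Longrightarrow> has_wirtinger (F k) (del (F k) x) (delbar (F k) x) x"
  by (rule smooth_on_has_wirtinger[OF F_smooth])

lemma del_F_nonzero: "k \<in> idx C \<Longrightarrow> x \<in> cdom C [k] \<Longrightarrow> del (F k) x \<noteq> 0"
  using log_branch_nonzero[OF Lf] .

lemma Lf_smooth: "k \<in> idx C \<Longrightarrow> smooth_on (Lf k) (cdom C [k])"
  using smooth_on_log_branch[OF _ Lf smooth_on_del[OF _ F_smooth]] open_src by simp

lemma beltrami_smooth: "k \<in> idx C \<Longrightarrow> smooth_on (\<mu> k) (cdom C [k])"
  unfolding beltrami_def
  using smooth_on_divide[OF _ smooth_on_delbar smooth_on_del] F_smooth open_src del_F_nonzero by simp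

lemma delbar_F: "k \<in> idx C \<Longrightarrow> x \<in> cdom C [k] \<Longrightarrow> delbar (F k) x = \<mu> k x * del (F k) x"
  by (simp add: beltrami_def del_F_nonzero)

text \<open>
  For the second formula, \<open>\<partial>bar \<partial>F = \<partial> \<partial>bar F = \<partial>(\<mu> \<partial>F)\<close> by symmetry of second derivatives; divide
  by \<open>\<partial>F\<close>.
\<close>
lemma del_Lf: "k \<in> idx C \<Longrightarrow> x \<in> cdom C [k] \<Longrightarrow> del (Lf k) x = del (del (F k)) x / del (F k) x"
  and delbar_Lf: "k \<in> idx C \<Longrightarrow> x \<in> cdom C [k] \<Longrightarrow> delbar (Lf k) x = del (\<mu> k) x + \<mu> k x * del (Lf k) x"
proof -
  assume k: "k \<in> idx C" and x: "x \<in> cdom C [k]"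
  have o: "open (cdom C [k])" using open_src k by simp
  have D: "has_wirtinger (del (F k)) (del (del (F k)) x) (delbar (del (F k)) x) x"
    by (rule smooth_on_has_wirtinger[OF smooth_on_del[OF o F_smooth[OF k]] x])
  have L: "has_wirtinger (Lf k) (del (del (F k)) x / del (F k) x) (delbar (del (F k)) x / del (F k) x) x"
    by (rule log_branch_has_wirtinger[OF o Lf[OF k] x D])
  show 1: "del (Lf k) x = del (del (F k)) x / del (F k) x" by (rule has_wirtinger_del[OF L])
  have "has_wirtinger (\<lambda>y. \<mu> k y * del (F k) y)
     (del (\<mu> k) x * del (F k) x + \<mu> k x * del (del (F k)) x)
     (delbar (\<mu> k) x * del (F k) x + \<mu> k x * delbar (del (F k)) x) x"
    by (rule has_wirtinger_mult[OF smooth_on_has_wirtinger[OF beltrami_smooth[OF k] x] D])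
  then have "has_wirtinger (delbar (F k))
     (del (\<mu> k) x * del (F k) x + \<mu> k x * del (del (F k)) x)
     (delbar (\<mu> k) x * del (F k) x + \<mu> k x * delbar (del (F k)) x) x"
    by (rule has_wirtinger_cong[OF _ o x]) (simp add: delbar_F k)
  then have "delbar (del (F k)) x = del (\<mu> k) x * del (F k) x + \<mu> k x * del (del (F k)) x"
    using smooth_on_delbar_del[OF o F_smooth[OF k] x] by (simp add: has_wirtinger_del)
  then show "delbar (Lf k) x = del (\<mu> k) x + \<mu> k x * del (Lf k) x"
    unfolding has_wirtinger_delbar[OF L] 1 using del_F_nonzero[OF k x] by (simp add: field_simps)
qed

lemma Lz_holomorphic: "i \<in> idx C \<Longrightarrow> j \<in> idx C \<Longrightarrow> Lz [i, j] holomorphic_on cdom C [i, j]"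
  using log_branch_holomorphic(1)[OF _ Lz holomorphic_deriv[OF src.transition_holomorphic]] open_src by simp

lemma Lw_holomorphic: "i \<in> idx C \<Longrightarrow> j \<in> idx C \<Longrightarrow> Lw [i, j] holomorphic_on cdom E [i, j]"
  using log_branch_holomorphic(1)[OF _ Lw holomorphic_deriv[OF tgt.transition_holomorphic]] open_tgt by
    (simp add: idx_eq)

lemma deriv_Lz:
  "i \<in> idx C \<Longrightarrow> j \<in> idx C \<Longrightarrow> x \<in> cdom C [i, j] \<Longrightarrow> deriv (Lz [i, j]) x = deriv (deriv (z i j)) x / deriv (z i
    j) x"
  using log_branch_holomorphic(2)[OF _ Lz holomorphic_deriv[OF src.transition_holomorphic]] open_src
  by (simp add: DERIV_imp_deriv)

lemma Lz_has_wirtinger: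
  "i \<in> idx C \<Longrightarrow> j \<in> idx C \<Longrightarrow> x \<in> cdom C [i, j] \<Longrightarrow> has_wirtinger (Lz [i, j]) (deriv (Lz [i, j]) x) 0 x"
  using has_field_derivative_imp_wirtinger[OF holomorphic_derivI[OF Lz_holomorphic]] open_src by simp

lemma F_mem2: "i \<in> idx C \<Longrightarrow> j \<in> idx C \<Longrightarrow> x \<in> cdom C [i, j] \<Longrightarrow> F j x \<in> cdom E [i, j]"
  using F_mem[of x "[i, j]"] by simp

lemma transition_mem2: "i \<in> idx C \<Longrightarrow> j \<in> idx C \<Longrightarrow> x \<in> cdom C [i, j] \<Longrightarrow> z i j x \<in> cdom C [i]"
  using src.transition_mem[of x "[i, j]" "[i]"] by simp

lemma F_has_wirtinger2:
  "i \<in> idx C \<Longrightarrow> j \<in> idx C \<Longrightarrow> x \<in> cdom C [i, j] \<Longrightarrow> has_wirtinger (F j) (del (F j) x) (delbar (F j) x) x"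
  using F_has_wirtinger cdom_last by simp

lemma compose_F_has_wirtinger:
  assumes "i \<in> idx C" "j \<in> idx C" "x \<in> cdom C [i, j]" "g holomorphic_on cdom E [i, j]"
  shows "has_wirtinger (\<lambda>y. g (F j y)) (deriv g (F j x) * del (F j) x) (deriv g (F j x) * delbar (F j) x) x"
  using has_wirtinger_compose[OF has_field_derivative_imp_wirtinger F_has_wirtinger2[OF assms(1-3)]]
    holomorphic_derivI[OF assms(4) _ F_mem2[OF assms(1-3)]] open_tgt assms(1,2) by auto

lemma V_has_wirtinger:
  assumes "i \<in> idx C" "j \<in> idx C" "x \<in> cdom C [i, j]"
  shows "has_wirtinger (V i j) (deriv (Lw [i, j]) (F j x) * del (F j) x) (deriv (Lw [i, j]) (F j x) *
    delbar (F j) x) x"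
  by (rule compose_F_has_wirtinger[OF assms Lw_holomorphic[OF assms(1,2)]])

lemma compose_transition_has_wirtinger:
  assumes "i \<in> idx C" "j \<in> idx C" "x \<in> cdom C [i, j]" "has_wirtinger g a b (z i j x)"
  shows "has_wirtinger (\<lambda>y. g (z i j y)) (a * deriv (z i j) x) (b * cnj (deriv (z i j) x)) x"
  using has_wirtinger_compose[OF assms(4) has_field_derivative_imp_wirtinger[OF
    src.transition_has_field_derivative[OF assms(1-3)]]]
  by simp

lemma chain_rule_F:
  assumes "i \<in> idx C" "j \<in> idx C" "x \<in> cdom C [i, j]"
  shows "del (F i) (z i j x) * deriv (z i j) x = deriv (w i j) (F j x) * del (F j) x"
    and "delbar (F i) (z i j x) * cnj (deriv (z i j) x) = deriv (w i j) (F j x) * delbar (F j) x"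
proof -
  have "has_wirtinger (\<lambda>y. F i (z i j y)) (del (F i) (z i j x) * deriv (z i j) x)
      (delbar (F i) (z i j x) * cnj (deriv (z i j) x)) x"
    by (rule compose_transition_has_wirtinger[OF assms F_has_wirtinger[OF assms(1) transition_mem2[OF
      assms]]])
  moreover have "has_wirtinger (\<lambda>y. w i j (F j y)) (deriv (w i j) (F j x) * del (F j) x)
      (deriv (w i j) (F j x) * delbar (F j) x) x"
    by (rule compose_F_has_wirtinger[OF assms tgt.transition_holomorphic]) (use assms idx_eq in auto)
  then have "has_wirtinger (\<lambda>y. F i (z i j y)) (deriv (w i j) (F j x) * del (F j) x)
      (deriv (w i j) (F j x) * delbar (F j) x) x"
    by (rule has_wirtinger_cong[OF _ open_src assms(3)]) (use assms F_transition in auto)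
  ultimately show "del (F i) (z i j x) * deriv (z i j) x = deriv (w i j) (F j x) * del (F j) x"
    and "delbar (F i) (z i j x) * cnj (deriv (z i j) x) = deriv (w i j) (F j x) * delbar (F j) x"
    using has_wirtinger_unique by blast+
qed

lemma deriv_z_nonzero: "i \<in> idx C \<Longrightarrow> j \<in> idx C \<Longrightarrow> x \<in> cdom C [i, j] \<Longrightarrow> deriv (z i j) x \<noteq> 0"
  using log_branch_nonzero[OF Lz] .

lemma deriv_w_nonzero: "i \<in> idx C \<Longrightarrow> j \<in> idx C \<Longrightarrow> x \<in> cdom E [i, j] \<Longrightarrow> deriv (w i j) x \<noteq> 0"
  using log_branch_nonzero[OF Lw] .

text \<open>
  Dividing the second chain rule by the first: \<open>\<mu>\<close> is a \<open>(-1,1)\<close>-form.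
\<close>
lemma beltrami_transition:
  assumes "i \<in> idx C" "j \<in> idx C" "x \<in> cdom C [i, j]"
  shows "\<mu> i (z i j x) * cnj (deriv (z i j) x) = \<mu> j x * deriv (z i j) x"
proof -
  have nz: "del (F i) (z i j x) \<noteq> 0" "del (F j) x \<noteq> 0" "deriv (z i j) x \<noteq> 0"
    using del_F_nonzero transition_mem2[OF assms] cdom_last[OF assms(3)] deriv_z_nonzero assms by auto
  have "\<mu> i (z i j x) * cnj (deriv (z i j) x) * (del (F i) (z i j x) * deriv (z i j) x)
     = (delbar (F i) (z i j x) * cnj (deriv (z i j) x)) * deriv (z i j) x"
    using delbar_F[OF assms(1) transition_mem2[OF assms]] by (simp add: mult_ac)
  also have "\<dots> = deriv (w i j) (F j x) * (\<mu> j x * del (F j) x) * deriv (z i j) x"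
    using chain_rule_F(2)[OF assms] delbar_F[OF assms(2) cdom_last[OF assms(3)]] by simp
  also have "\<dots> = \<mu> j x * deriv (z i j) x * (del (F i) (z i j x) * deriv (z i j) x)"
    using chain_rule_F(1)[OF assms] by simp
  finally show ?thesis using nz by simp
qed

text \<open>
  The \<open>\<partial>\<close>-derivative of \<open>beltrami_transition\<close>, where the antiholomorphic factor behaves as a constant.
\<close>
lemma del_beltrami_transition:
  assumes "i \<in> idx C" "j \<in> idx C" "x \<in> cdom C [i, j]"
  shows "del (\<mu> i) (z i j x) * deriv (z i j) x * cnj (deriv (z i j) x)
    = del (\<mu> j) x * deriv (z i j) x + \<mu> j x * deriv (deriv (z i j)) x"
proof -
  have o: "open (cdom C [i, j])" using open_src assms by simp
  have z': "has_wirtinger (deriv (z i j)) (deriv (deriv (z i j)) x) 0 x"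
    using has_field_derivative_imp_wirtinger[OF holomorphic_derivI[OF holomorphic_deriv[OF
      src.transition_holomorphic] o assms(3)]] o assms by simp
  have "has_wirtinger (\<lambda>y. \<mu> i (z i j y)) (del (\<mu> i) (z i j x) * deriv (z i j) x) (delbar (\<mu> i) (z i j x)
    * cnj (deriv (z i j) x)) x"
    by (rule compose_transition_has_wirtinger[OF assms smooth_on_has_wirtinger[OF beltrami_smooth[OF
      assms(1)] transition_mem2[OF assms]]])
  from has_wirtinger_mult[OF this has_wirtinger_cnj[OF z']]
  have 1: "del (\<lambda>y. \<mu> i (z i j y) * cnj (deriv (z i j) y)) x = del (\<mu> i) (z i j x) * deriv (z i j) x *
    cnj (deriv (z i j) x)"
    using has_wirtinger_del by fastforce
  have "has_wirtinger (\<mu> j) (del (\<mu> j) x) (delbar (\<mu> j) x) x"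
    by (rule smooth_on_has_wirtinger[OF beltrami_smooth[OF assms(2)] cdom_last[OF assms(3)]]) simp_all
  from has_wirtinger_mult[OF this z']
  have "has_wirtinger (\<lambda>y. \<mu> i (z i j y) * cnj (deriv (z i j) y))
      (del (\<mu> j) x * deriv (z i j) x + \<mu> j x * deriv (deriv (z i j)) x)
      (delbar (\<mu> j) x * deriv (z i j) x + \<mu> j x * 0) x"
    by (rule has_wirtinger_cong[OF _ o assms(3)]) (simp add: beltrami_transition assms)
  from has_wirtinger_del[OF this] 1 show ?thesis by simp
qed

text \<open>
  The first chain rule says that the exponential of the left-hand side is \<open>1\<close>. The integer \<open>k\<close>
  drops out of all derivatives and reappears in \<open>m\<close>.
\<close>
lemma log_del_F_transition:
  assumes "i \<in> idx C" "j \<in> idx C"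
  obtains k :: int where "\<And>x. x \<in> cdom C [i, j] \<Longrightarrow>
    Lf i (z i j x) + Lz [i, j] x - V i j x - Lf j x = 2 * of_real pi * \<i> * of_int k"
proof (rule exp_one_constant)
  let ?S = "cdom C [i, j]"
  show "connected ?S" using connected assms by simp
  have c: "continuous_on ?S (Lz [i, j])" "continuous_on (cdom E [i, j]) (Lw [i, j])"
    "continuous_on (cdom C [i]) (Lf i)" "continuous_on (cdom C [j]) (Lf j)"
    using Lz Lw Lf assms by (auto simp: log_branch_def)
  have cz: "continuous_on ?S (z i j)"
    using src.transition_holomorphic assms holomorphic_on_imp_continuous_on by blast
  have cF: "continuous_on ?S (F j)"
    using F_has_wirtinger2[OF assms] has_wirtinger_differentiable differentiable_imp_continuous_within
    by (intro continuous_at_imp_continuous_on) blast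
  show "continuous_on ?S (\<lambda>x. Lf i (z i j x) + Lz [i, j] x - V i j x - Lf j x)"
    by (intro continuous_on_add continuous_on_diff c continuous_on_compose2[OF c(3) cz]
          continuous_on_compose2[OF c(2) cF] continuous_on_subset[OF c(4)])
       (use transition_mem2 F_mem2 assms cdom_last in auto)
  fix x assume x: "x \<in> ?S"
  have "exp (Lf i (z i j x)) = del (F i) (z i j x)" "exp (Lf j x) = del (F j) x"
    "exp (Lz [i, j] x) = deriv (z i j) x" "exp (V i j x) = deriv (w i j) (F j x)"
    using Lf Lz Lw assms x transition_mem2[OF assms x] F_mem2[OF assms x] cdom_last[OF x]
    by (auto simp: log_branch_def)
  then show "exp (Lf i (z i j x) + Lz [i, j] x - V i j x - Lf j x) = 1"
    using chain_rule_F(1)[OF assms x] del_F_nonzero[OF assms(2), of x] deriv_w_nonzero[OF assms F_mem2[OF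
      assms x]] cdom_last[OF x]
    by (simp add: exp_diff exp_add)
qed (use that in blast)

lemma d_log_del_F_transition:
  assumes "i \<in> idx C" "j \<in> idx C" "x \<in> cdom C [i, j]"
  shows "del (Lf i) (z i j x) * deriv (z i j) x
      = del (Lf j) x + deriv (Lw [i, j]) (F j x) * del (F j) x - deriv (Lz [i, j]) x"
    and "delbar (Lf i) (z i j x) * cnj (deriv (z i j) x)
      = delbar (Lf j) x + deriv (Lw [i, j]) (F j x) * delbar (F j) x"
proof -
  obtain k :: int where k: "\<And>x. x \<in> cdom C [i, j] \<Longrightarrow>
    Lf i (z i j x) + Lz [i, j] x - V i j x - Lf j x = 2 * of_real pi * \<i> * of_int k"
    using log_del_F_transition[OF assms(1,2)] by blast
  have o: "open (cdom C [i, j])" using open_src assms by simp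
  have "has_wirtinger (\<lambda>y. 2 * of_real pi * \<i> * of_int k + Lf j y + V i j y - Lz [i, j] y)
     (0 + del (Lf j) x + deriv (Lw [i, j]) (F j x) * del (F j) x - deriv (Lz [i, j]) x)
     (0 + delbar (Lf j) x + deriv (Lw [i, j]) (F j x) * delbar (F j) x - 0) x"
    by (intro has_wirtinger_diff has_wirtinger_add has_wirtinger_const V_has_wirtinger Lz_has_wirtinger
          smooth_on_has_wirtinger[OF Lf_smooth] assms cdom_last[OF assms(3)]) simp_all
  then have "has_wirtinger (\<lambda>y. Lf i (z i j y))
     (0 + del (Lf j) x + deriv (Lw [i, j]) (F j x) * del (F j) x - deriv (Lz [i, j]) x)
     (0 + delbar (Lf j) x + deriv (Lw [i, j]) (F j x) * delbar (F j) x - 0) x"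
    by (rule has_wirtinger_cong[OF _ o assms(3)]) (use k in \<open>auto simp: algebra_simps\<close>)
  moreover have "has_wirtinger (\<lambda>y. Lf i (z i j y)) (del (Lf i) (z i j x) * deriv (z i j) x)
      (delbar (Lf i) (z i j x) * cnj (deriv (z i j) x)) x"
    by (rule compose_transition_has_wirtinger[OF assms smooth_on_has_wirtinger[OF Lf_smooth[OF assms(1)]
      transition_mem2[OF assms]]])
  ultimately show "del (Lf i) (z i j x) * deriv (z i j) x
      = del (Lf j) x + deriv (Lw [i, j]) (F j x) * del (F j) x - deriv (Lz [i, j]) x"
    and "delbar (Lf i) (z i j x) * cnj (deriv (z i j) x)
      = delbar (Lf j) x + deriv (Lw [i, j]) (F j x) * delbar (F j) x"
    using has_wirtinger_unique by fastforce+
qed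

end

section \<open>The components of the cochain\<close>

context coordinate_cover begin

lemma triple_overlap:
  assumes "x \<in> cdom C [i, j, k]" "i \<in> idx C" "j \<in> idx C" "k \<in> idx C"
  shows "x \<in> cdom C [j, k]" "x \<in> cdom C [i, k]" "transition C j k x \<in> cdom C [i, j]"
  using cdom_subset[of "[j,k]" "[i,j,k]"] cdom_subset[of "[i,k]" "[i,j,k]"]
      transition_mem[OF assms(1), of "[i, j]"] assms by auto

text \<open>
  The \<open>dz\<close> coefficient of \<open>- U dU = \<delta>\<tau> + d\<phi>\<close>, which is all of it since the data are holomorphic.
\<close>
lemma tame_trivialization_dz:
  assumes "tame_trivialization C L \<tau> \<phi> n"
    and L: "L [j, k] holomorphic_on cdom C [j, k]"
    and x: "x \<in> cdom C [i, j, k]" and I: "i \<in> idx C" "j \<in> idx C" "k \<in> idx C"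
  shows "- (L [i, j] (transition C j k x) * deriv (L [j, k]) x)
    = \<tau> [j, k] x - \<tau> [i, k] x + \<tau> [i, j] (transition C j k x) * deriv (transition C j k) x
      + deriv (\<phi> [i, j, k]) x"
proof -
  have o: "open (cdom C [j, k])" "open (cdom C [i, j, k])" using open_cdom I by auto
  note sub = triple_overlap[OF x I]
  have hol: "\<phi> [i, j, k] holomorphic_on cdom C [i, j, k]"
    and eq: "(- ((L [i, j] \<circ> transition C j k) \<odot> ext_d (fun_form (L [j, k])))) x
           = (cech_delta C (\<lambda>is. \<tau> is \<odot> dz) [i, j, k] + ext_d (fun_form (\<phi> [i, j, k]))) x"
    using assms(1) x I unfolding tame_trivialization_def by blast+
  have d: "del (L [j, k]) x = deriv (L [j, k]) x" "del (\<phi> [i, j, k]) x = deriv (\<phi> [i, j, k]) x"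
    using has_wirtinger_del[OF has_field_derivative_imp_wirtinger[OF holomorphic_derivI[OF L o(1) sub(1)]]]
      has_wirtinger_del[OF has_field_derivative_imp_wirtinger[OF holomorphic_derivI[OF hol o(2) x]]] by auto
  show ?thesis
    using arg_cong[OF eq, of "\<lambda>t. fst (snd t)"]
    by (simp add: ext_d_fun_form scale_form_def dz_def cech_delta_3 pullback_transition[OF I(2,3) sub(1)]
      d Let_def)
qed

end

locale polyakov_setting = deformation C E f Lz Lw Lf
  for C :: "('i, 'a) coord_cover" and E :: "('i, 'b) coord_cover" and f :: "'a \<Rightarrow> 'b"
    and Lz Lw :: "'i list \<Rightarrow> complex \<Rightarrow> complex" and Lf :: "'i \<Rightarrow> complex \<Rightarrow> complex" +
  fixes h :: "'i \<Rightarrow> complex \<Rightarrow> complex"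
    and \<tau> \<phi> \<tau>' \<phi>' :: "'i list \<Rightarrow> complex \<Rightarrow> complex" and n n' :: "'i list \<Rightarrow> complex"
  assumes connection: "smooth_projective_connection C h"
    and triv: "tame_trivialization C Lz \<tau> \<phi> n"
    and triv': "tame_trivialization E Lw \<tau>' \<phi>' n'"
begin

lemma tau_holomorphic: "i \<in> idx C \<Longrightarrow> j \<in> idx C \<Longrightarrow> \<tau> [i, j] holomorphic_on cdom C [i, j]"
  and tau'_holomorphic: "i \<in> idx C \<Longrightarrow> j \<in> idx C \<Longrightarrow> \<tau>' [i, j] holomorphic_on cdom E [i, j]"
  using triv triv' by (auto simp: tame_trivialization_def idx_eq)

lemma phi_holomorphic:
    "i \<in> idx C \<Longrightarrow> j \<in> idx C \<Longrightarrow> k \<in> idx C \<Longrightarrow> \<phi> [i, j, k] holomorphic_on cdom C [i, j, k]"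
  and phi'_holomorphic:
    "i \<in> idx C \<Longrightarrow> j \<in> idx C \<Longrightarrow> k \<in> idx C \<Longrightarrow> \<phi>' [i, j, k] holomorphic_on cdom E [i, j, k]"
  using triv triv' by (auto simp: tame_trivialization_def idx_eq)

text \<open>
  The Polyakov form, with \<open>\<partial>\<^sup>2F / \<partial>F\<close> written as \<open>\<partial>\<Lambda>\<close>.
\<close>
definition omega_coef :: "'i \<Rightarrow> complex \<Rightarrow> complex" where
  "omega_coef i x = del (Lf i) x * del (\<mu> i) x + 2 * \<mu> i x * h i x"

text \<open>
  The two coefficients of \<open>\<theta>\<close>, with \<open>z'' / z'\<close> written as \<open>U'\<close> and with \<open>\<partial>bar U = 0\<close> inserted. They
  represent \<open>\<theta>\<close> only on the overlap.
\<close>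
definition theta_dz :: "'i \<Rightarrow> 'i \<Rightarrow> complex \<Rightarrow> complex" where
  "theta_dz i j x = - ((V i j x + Lz [i, j] x) * del (Lf j) x) + V i j x * deriv (Lz [i, j]) x
     - \<tau>' [i, j] (F j x) * del (F j) x + \<tau> [i, j] x"

definition theta_dzbar :: "'i \<Rightarrow> 'i \<Rightarrow> complex \<Rightarrow> complex" where
  "theta_dzbar i j x = 2 * \<mu> j x * deriv (Lz [i, j]) x - (V i j x + Lz [i, j] x) * delbar (Lf j) x
     - \<tau>' [i, j] (F j x) * delbar (F j) x"

lemma polyakov_form_coef:
  assumes "i \<in> idx C" "x \<in> cdom C [i]"
  shows "polyakov_form C E f h i x = (0, 0, 0, omega_coef i x)"
  using assms by (simp add: polyakov_form_def Let_def scale_form_def dz_dzbar_def omega_coef_def del_Lf)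

lemma theta_coef:
  assumes "i \<in> idx C" "j \<in> idx C" "x \<in> cdom C [i, j]"
  shows "theta C E f Lz Lw Lf \<tau> \<tau>' i j x = (0, theta_dz i j x, theta_dzbar i j x, 0)"
proof -
  note L = Lz_has_wirtinger[OF assms]
  have "del (Lz [i, j]) x = deriv (Lz [i, j]) x" "delbar (Lz [i, j]) x = 0"
    using has_wirtinger_del[OF L] has_wirtinger_delbar[OF L] by auto
  then show ?thesis
    by (simp add: theta_def Let_def scale_form_def dz_def dzbar_def ext_d_fun_form pullback_def
        theta_dz_def theta_dzbar_def deriv_Lz[OF assms] eval_nat_numeral)
qed

lemma omega_coef_smooth: "i \<in> idx C \<Longrightarrow> smooth_on (omega_coef i) (cdom C [i])"
  unfolding omega_coef_def using connection open_src
  by (intro smooth_on_add smooth_on_mult smooth_on_const smooth_on_del Lf_smooth beltrami_smooth)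
     (auto simp: smooth_projective_connection_def)

lemma on_overlap: "smooth_on g (cdom C [j]) \<Longrightarrow> smooth_on g (cdom C [i, j])"
  by (erule smooth_on_subset) (simp add: cdom_def image_mono)

lemma compose_F_smooth:
  assumes "is \<noteq> []" "set is \<subseteq> idx C" "last is = k" "g holomorphic_on cdom E is"
  shows "smooth_on (\<lambda>x. g (F k x)) (cdom C is)"
proof (rule smooth_on_compose[where T = "cdom E is" and f = "F k" and g = g])
  have k: "k \<in> idx C" using assms by auto
  show "open (cdom C is)" using src.open_cdom assms by auto
  show o: "open (cdom E is)" using tgt.open_cdom assms idx_eq by auto
  show "F k ` cdom C is \<subseteq> cdom E is" using F_mem assms by auto
  show "smooth_on g (cdom E is)" using smooth_on_holomorphic o assms(4) by blast
  show "smooth_on (F k) (cdom C is)"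
    by (rule smooth_on_subset[OF F_smooth[OF k]]) (use cdom_last assms in auto)
qed

lemma theta_smooth:
  assumes "i \<in> idx C" "j \<in> idx C"
  shows "smooth_on (theta_dz i j) (cdom C [i, j])" "smooth_on (theta_dzbar i j) (cdom C [i, j])"
proof -
  have o: "open (cdom C [i, j])" "open (cdom C [j])" using open_src assms by auto
  have F: "smooth_on (V i j) (cdom C [i, j])" "smooth_on (\<lambda>x. \<tau>' [i, j] (F j x)) (cdom C [i, j])"
    by (rule compose_F_smooth; use assms Lw_holomorphic tau'_holomorphic in simp)+
  have s: "smooth_on (Lz [i, j]) (cdom C [i, j])" "smooth_on (deriv (Lz [i, j])) (cdom C [i, j])"
    "smooth_on (\<tau> [i, j]) (cdom C [i, j])"
    using assms Lz_holomorphic tau_holomorphic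
    by (auto intro!: smooth_on_holomorphic holomorphic_deriv o)
  note t = smooth_on_del smooth_on_delbar smooth_on_mult smooth_on_minus smooth_on_add smooth_on_diff 
    F_smooth[OF assms(2)] Lf_smooth[OF assms(2)] beltrami_smooth[OF assms(2)] o s smooth_on_const
  have d: "smooth_on (del (Lf j)) (cdom C [i, j])" "smooth_on (delbar (Lf j)) (cdom C [i, j])"
     "smooth_on (del (F j)) (cdom C [i, j])" "smooth_on (delbar (F j)) (cdom C [i, j])" "smooth_on (\<mu> j)
       (cdom C [i, j])"
    by (rule on_overlap, intro t)+
  show "smooth_on (theta_dz i j) (cdom C [i, j])" "smooth_on (theta_dzbar i j) (cdom C [i, j])"
    unfolding theta_dz_def theta_dzbar_def 
    by (intro smooth_on_mult smooth_on_minus smooth_on_add smooth_on_diff smooth_on_const d o s F)+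
qed

text \<open>
  The pullback of \<open>\<omega>\<^sub>i\<close> along \<open>z\<^sub>i\<^sub>j\<close>, expressed through data with index \<open>j\<close>.
\<close>
lemma omega_coef_transition:
  assumes "i \<in> idx C" "j \<in> idx C" "x \<in> cdom C [i, j]"
  shows "omega_coef i (z i j x) * (deriv (z i j) x * cnj (deriv (z i j) x))
    = (del (Lf j) x + deriv (Lw [i, j]) (F j x) * del (F j) x - deriv (Lz [i, j]) x)
        * (del (\<mu> j) x + \<mu> j x * deriv (Lz [i, j]) x)
      + 2 * \<mu> j x * (h j x - schwarzian (z i j) x)"
proof -
  have nz: "deriv (z i j) x \<noteq> 0" by (rule deriv_z_nonzero[OF assms])
  \<comment> \<open>\<open>z'' = U' z'\<close> for \<open>U = log z'\<close>.\<close>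
  have a: "deriv (deriv (z i j)) x = deriv (Lz [i, j]) x * deriv (z i j) x"
    using deriv_Lz[OF assms] nz by simp
  have "h j x - h i (z i j x) * (deriv (z i j) x)\<^sup>2 = schwarzian (z i j) x"
    using connection assms by (simp add: smooth_projective_connection_def)
  then have h: "h i (z i j x) * (deriv (z i j) x)\<^sup>2 = h j x - schwarzian (z i j) x"
    by (simp add: algebra_simps)
  have "omega_coef i (z i j x) * (deriv (z i j) x * cnj (deriv (z i j) x)) 
     = del (Lf i) (z i j x) * (del (\<mu> i) (z i j x) * deriv (z i j) x * cnj (deriv (z i j) x))
       + 2 * (\<mu> i (z i j x) * cnj (deriv (z i j) x)) * (h i (z i j x) * deriv (z i j) x)"
    by (simp add: omega_coef_def algebra_simps)
  also have "\<dots> = (del (Lf i) (z i j x) * deriv (z i j) x) * (del (\<mu> j) x + \<mu> j x * deriv (Lz [i, j]) x)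
       + 2 * \<mu> j x * (h i (z i j x) * (deriv (z i j) x)\<^sup>2)"
    unfolding del_beltrami_transition[OF assms] beltrami_transition[OF assms] a
    by (simp add: algebra_simps power2_eq_square)
  finally show ?thesis unfolding h d_log_del_F_transition(1)[OF assms] .
qed

text \<open>
  From \<open>z'' = U' z'\<close> follows \<open>z''' = (U'' + U'\<^sup>2) z'\<close>.
\<close>
lemma schwarzian_via_log:
  assumes "i \<in> idx C" "j \<in> idx C" "x \<in> cdom C [i, j]"
  shows "schwarzian (z i j) x = deriv (deriv (Lz [i, j])) x - (deriv (Lz [i, j]) x)\<^sup>2 / 2"
proof -
  have o: "open (cdom C [i, j])" using open_src assms by simp
  have nz: "deriv (z i j) x \<noteq> 0" by (rule deriv_z_nonzero[OF assms])
  have a: "deriv (deriv (z i j)) y = deriv (Lz [i, j]) y * deriv (z i j) y" if "y \<in> cdom C [i, j]" for y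
    using deriv_Lz[OF assms(1,2) that] deriv_z_nonzero[OF assms(1,2) that] by simp
  have "((\<lambda>y. deriv (Lz [i, j]) y * deriv (z i j) y) has_field_derivative
      deriv (deriv (Lz [i, j])) x * deriv (z i j) x + deriv (deriv (z i j)) x * deriv (Lz [i, j]) x) (at x)"
    by (rule DERIV_mult[OF holomorphic_derivI[OF holomorphic_deriv[OF Lz_holomorphic[OF assms(1,2)] o] o
      assms(3)]
          holomorphic_derivI[OF holomorphic_deriv[OF src.transition_holomorphic[OF assms(1,2)] o] o
            assms(3)]])
  then have "(deriv (deriv (z i j)) has_field_derivative
      deriv (deriv (Lz [i, j])) x * deriv (z i j) x + deriv (deriv (z i j)) x * deriv (Lz [i, j]) x) (at x)"
    by (rule has_field_derivative_transform_within_open[OF _ o assms(3)]) (simp add: a)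
  then have "deriv (deriv (deriv (z i j))) x = (deriv (deriv (Lz [i, j])) x + (deriv (Lz [i, j]) x)\<^sup>2) *
    deriv (z i j) x"
    by (simp add: DERIV_imp_deriv a[OF assms(3)] algebra_simps power2_eq_square)
  then show ?thesis
    using nz by (simp add: schwarzian_def eval_nat_numeral a[OF assms(3)] field_simps)
qed

text \<open>
  The equation \<open>d\<theta> = \<delta>\<omega>\<close>. On the left \<open>d\<tau>\<close>, \<open>f\<^sup>* d\<tau>'\<close> and \<open>d d\<Lambda>\<close> vanish, and what remains is
  \<open>d(2\<mu> U' dzbar) - (dU + dV) \<and> d\<Lambda> + dV \<and> dU\<close>. On the right the transformation rules of \<open>\<partial>\<Lambda>\<close>, \<open>\<partial>\<mu>\<close> and
  \<open>h\<close> apply. Both sides become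
  \<open>2\<mu> U'' + U' \<partial>\<mu> - (\<partial>V) \<partial>\<mu> - \<mu> U' \<partial>\<Lambda> - \<mu> U' \<partial>V\<close>.
\<close>
lemma d_theta:
  assumes "i \<in> idx C" "j \<in> idx C" "x \<in> cdom C [i, j]"
  shows "del (theta_dzbar i j) x - delbar (theta_dz i j) x
    = omega_coef j x - omega_coef i (z i j x) * (deriv (z i j) x * cnj (deriv (z i j) x))"
proof -
  have o: "open (cdom C [i, j])" "open (cdom C [j])" using open_src assms by auto
  have xj: "x \<in> cdom C [j]" using cdom_last[OF assms(3)] by simp
  define lw where "lw = deriv (Lw [i, j]) (F j x)"
  note wV = V_has_wirtinger[OF assms, folded lw_def] and wU = Lz_has_wirtinger[OF assms]
  have wA: "has_wirtinger (deriv (Lz [i, j])) (deriv (deriv (Lz [i, j])) x) 0 x"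
    by (rule has_field_derivative_imp_wirtinger[OF holomorphic_derivI[OF
          holomorphic_deriv[OF Lz_holomorphic[OF assms(1,2)] o(1)] o(1) assms(3)]])
  note wt' = compose_F_has_wirtinger[OF assms tau'_holomorphic[OF assms(1,2)]]
  have wt: "has_wirtinger (\<tau> [i, j]) (deriv (\<tau> [i, j]) x) 0 x"
    by (rule has_field_derivative_imp_wirtinger[OF holomorphic_derivI[OF
          tau_holomorphic[OF assms(1,2)] o(1) assms(3)]])
  note wmu = smooth_on_has_wirtinger[OF beltrami_smooth[OF assms(2)] xj]
    and wl = smooth_on_has_wirtinger[OF smooth_on_del[OF o(2) Lf_smooth[OF assms(2)]] xj]
    and wlb = smooth_on_has_wirtinger[OF smooth_on_delbar[OF o(2) Lf_smooth[OF assms(2)]] xj]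
    and wF = smooth_on_has_wirtinger[OF smooth_on_del[OF o(2) F_smooth[OF assms(2)]] xj]
    and wFb = smooth_on_has_wirtinger[OF smooth_on_delbar[OF o(2) F_smooth[OF assms(2)]] xj]
  have PP: "theta_dzbar i j = (\<lambda>x. 2 * \<mu> j x * deriv (Lz [i, j]) x - (V i j x + Lz [i, j] x) * delbar (Lf j) x
     - \<tau>' [i, j] (F j x) * delbar (F j) x)" by (simp add: fun_eq_iff theta_dzbar_def)
  have QQ: "theta_dz i j = (\<lambda>x. - ((V i j x + Lz [i, j] x) * del (Lf j) x) + V i j x * deriv (Lz [i, j]) x
     - \<tau>' [i, j] (F j x) * del (F j) x + \<tau> [i, j] x)" by (simp add: fun_eq_iff theta_dz_def)
  \<comment> \<open>The rules follow the shape of \<open>PP\<close> and \<open>QQ\<close> from the outside in.\<close>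
  note P = has_wirtinger_del[OF has_wirtinger_diff[OF has_wirtinger_diff[OF 
      has_wirtinger_mult[OF has_wirtinger_mult[OF has_wirtinger_const[of 2] wmu] wA]
      has_wirtinger_mult[OF has_wirtinger_add[OF wV wU] wlb]] has_wirtinger_mult[OF wt' wFb]], folded PP]
  note Q = has_wirtinger_delbar[OF has_wirtinger_add[OF has_wirtinger_diff[OF has_wirtinger_add[OF
      has_wirtinger_minus[OF has_wirtinger_mult[OF has_wirtinger_add[OF wV wU] wl]]
      has_wirtinger_mult[OF wV wA]] has_wirtinger_mult[OF wt' wF]] wt], folded QQ]
  have c: "delbar (del (F j)) x = del (delbar (F j)) x" "delbar (del (Lf j)) x = del (delbar (Lf j)) x"
    using smooth_on_delbar_del[OF o(2)] F_smooth Lf_smooth assms xj by auto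
  show ?thesis
    unfolding P Q omega_coef_transition[OF assms] schwarzian_via_log[OF assms] lw_def[symmetric]
    by (simp add: c delbar_F[OF assms(2) xj] delbar_Lf[OF assms(2) xj] omega_coef_def algebra_simps
      power2_eq_square
       add_divide_distrib diff_divide_distrib)
qed

end

section \<open>The Cech coboundary of theta\<close>

context coordinate_cover begin

lemma
  assumes L: "\<And>i j. i \<in> idx C \<Longrightarrow> j \<in> idx C \<Longrightarrow> log_branch (L [i, j]) (deriv (transition C i j)) (cdom C [i, j])"
    and I: "i \<in> idx C" "j \<in> idx C" "k \<in> idx C"
  shows exp_log_cocycle: "x \<in> cdom C [i, j, k] \<Longrightarrow> exp (cech_delta_fun C L [i, j, k] x) = 1"
    and continuous_log_cocycle: "continuous_on (cdom C [i, j, k]) (cech_delta_fun C L [i, j, k])"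
proof -
  have e: "exp (L [i, j] x) = deriv (transition C i j) x" if "i \<in> idx C" "j \<in> idx C" "x \<in> cdom C [i, j]"
    for i j x
    using L that by (auto simp: log_branch_def)
  have c: "continuous_on (cdom C [i, j]) (L [i, j])" if "i \<in> idx C" "j \<in> idx C" for i j
    using L that by (auto simp: log_branch_def)
  show "exp (cech_delta_fun C L [i, j, k] x) = 1" if x: "x \<in> cdom C [i, j, k]"
  proof -
    note sub = triple_overlap[OF x I]
    have "exp (L [i, k] x) \<noteq> 0" by simp
    then show ?thesis
      using deriv_transition_transition[OF x I] sub I
      by (simp add: cech_delta_fun_3 exp_add exp_diff e field_simps)
  qed
  have z: "continuous_on (cdom C [j, k]) (transition C j k)"
    using transition_holomorphic I holomorphic_on_imp_continuous_on by blast
  have "continuous_on (cdom C [i, j, k]) (\<lambda>x. L [j, k] x - L [i, k] x + L [i, j] (transition C j k x))"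
    using triple_overlap[OF _ I]
    by (intro continuous_on_add continuous_on_diff continuous_on_compose2[OF c[OF I(1,2)]]
          continuous_on_subset[OF c] continuous_on_subset[OF z] I) auto
  then show "continuous_on (cdom C [i, j, k]) (cech_delta_fun C L [i, j, k])"
    by (rule continuous_on_eq) (simp add: cech_delta_fun_3)
qed

end

text \<open>
  One coefficient of \<open>\<delta>\<theta> = d\<Theta>\<close> without its \<open>\<mu>\<close> term: capitals are values on a triple overlap, small
  letters their derivatives in one of the directions \<open>\<partial>\<close> and \<open>\<partial>bar\<close>, \<open>l\<close> that of \<open>\<Lambda>\<^sub>k\<close>, while \<open>T\<close> and \<open>t\<close>
  stand for \<open>\<tau>'\<close> and \<open>\<tau>\<close>, and \<open>p'\<close> and \<open>p\<close> for the derivatives of \<open>\<phi>'\<close> and \<open>\<phi>\<close>. For \<open>\<partial>bar\<close> all quantities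
  coming from holomorphic functions on the source are \<open>0\<close>, so the same identity serves both coefficients.
\<close>
lemma theta_cocycle_identity:
  fixes Vjk Vik Vij Ujk Uik Uij :: complex
  assumes "p' = - (Vij * vjk) - (Tjk - Tik + Tij)"
    and "p = - (Uij * ujk) - (tjk - tik + tij)"
    and "ujk - uik + uij = 0"
  shows "(- ((Vjk + Ujk) * l) + Vjk * ujk - Tjk + tjk) - (- ((Vik + Uik) * l) + Vik * uik - Tik + tik)
       + (- ((Vij + Uij) * (l + vjk - ujk)) + Vij * uij - Tij + tij)
     = p' - p - ((Vjk - Vik + Vij) + (Ujk - Uik + Uij)) * l - (uij * Vjk + Uij * vjk) + (Vjk - Vik + Vij)
       * uik"
proof -
  have uik: "uik = ujk + uij" using assms(3) by (simp add: algebra_simps)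
  show ?thesis unfolding assms(1,2) uik by (simp add: algebra_simps)
qed

context polyakov_setting begin

text \<open>
  The cocycles \<open>c = \<delta>U\<close> and \<open>c' = \<delta>V\<close>.
\<close>
abbreviation "cz i j k \<equiv> cech_delta_fun C Lz [i, j, k]"
abbreviation "cw i j k \<equiv> cech_delta_fun C (\<lambda>is. Lw is \<circ> F (last is)) [i, j, k]"

lemma F_transition3:
  assumes "x \<in> cdom C [i, j, k]" "i \<in> idx C" "j \<in> idx C" "k \<in> idx C"
  shows "w j k (F k x) = F j (z j k x)"
  using F_transition[OF assms(3,4) src.triple_overlap(1)[OF assms]] by simp

text \<open>
  Thus \<open>c'\<close> is the pullback along \<open>f\<close> of the cocycle formed on the target.
\<close>
lemma cw_eq:
  assumes "x \<in> cdom C [i, j, k]" "i \<in> idx C" "j \<in> idx C" "k \<in> idx C"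
  shows "cw i j k x = cech_delta_fun E Lw [i, j, k] (F k x)"
  by (simp add: cech_delta_fun_3 F_transition3[OF assms])

lemma cz_constant:
  assumes "i \<in> idx C" "j \<in> idx C" "k \<in> idx C"
  obtains m :: int where "\<And>x. x \<in> cdom C [i, j, k] \<Longrightarrow> cz i j k x = 2 * of_real pi * \<i> * of_int m"
proof (rule exp_one_constant)
  show "connected (cdom C [i, j, k])" using connected assms by simp
  show "continuous_on (cdom C [i, j, k]) (cz i j k)"
    by (rule src.continuous_log_cocycle[where L = Lz, OF Lz assms])
  show "exp (cz i j k x) = 1" if "x \<in> cdom C [i, j, k]" for x
    by (rule src.exp_log_cocycle[where L = Lz, OF Lz assms that])
qed (use that in blast)

lemma cw_constant:
  assumes "i \<in> idx C" "j \<in> idx C" "k \<in> idx C"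
  obtains m :: int where "\<And>x. x \<in> cdom C [i, j, k] \<Longrightarrow> cw i j k x = 2 * of_real pi * \<i> * of_int m"
proof (rule exp_one_constant)
  let ?S = "cdom C [i, j, k]"
  have F: "F k x \<in> cdom E [i, j, k]" if "x \<in> ?S" for x using F_mem[OF that] assms by simp
  have b: "\<And>i j. i \<in> idx E \<Longrightarrow> j \<in> idx E \<Longrightarrow> log_branch (Lw [i, j]) (deriv (w i j)) (cdom E [i, j])"
    using Lw idx_eq by simp
  have I: "i \<in> idx E" "j \<in> idx E" "k \<in> idx E" using assms idx_eq by auto
  show "connected ?S" using connected assms by simp
  have cF: "continuous_on ?S (F k)"
    using F_has_wirtinger[OF assms(3)] has_wirtinger_differentiable differentiable_imp_continuous_within
      cdom_last
    by (intro continuous_at_imp_continuous_on) fastforce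
  have "continuous_on ?S (\<lambda>x. cech_delta_fun E Lw [i, j, k] (F k x))"
    by (rule continuous_on_compose2[OF tgt.continuous_log_cocycle[where L = Lw, OF b I] cF]) (use F in auto)
  then show "continuous_on ?S (cw i j k)"
    by (rule continuous_on_eq) (simp add: cw_eq assms)
  show "exp (cw i j k x) = 1" if "x \<in> ?S" for x
    using tgt.exp_log_cocycle[where L = Lw, OF b I F[OF that]] by (simp add: cw_eq that assms)
qed (use that in blast)

lemma Theta_eq:
  "Theta C E f Lz Lw Lf \<phi> \<phi>' i j k x = \<phi>' [i, j, k] (F k x) - \<phi> [i, j, k] x - (cw i j k x + cz i j k x) *
    Lf k x
     - Lz [i, j] (z j k x) * V j k x + cw i j k x * Lz [i, k] x"
  by (simp add: Theta_def Let_def)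

text \<open>
  The cocycles \<open>c\<close> and \<open>c'\<close> are replaced by their constant values.
\<close>
lemma Theta_smooth:
  assumes "i \<in> idx C" "j \<in> idx C" "k \<in> idx C"
  shows "smooth_on (Theta C E f Lz Lw Lf \<phi> \<phi>' i j k) (cdom C [i, j, k])"
proof -
  let ?S = "cdom C [i, j, k]"
  obtain m :: int where c1: "\<And>x. x \<in> ?S \<Longrightarrow> cz i j k x = 2 * of_real pi * \<i> * of_int m"
    using cz_constant[OF assms] by blast
  obtain m' :: int where c2: "\<And>x. x \<in> ?S \<Longrightarrow> cw i j k x = 2 * of_real pi * \<i> * of_int m'"
    using cw_constant[OF assms] by blast
  note c = c1 c2
  have o: "open ?S" using open_src assms by simp
  have sub: "?S \<subseteq> cdom C [j, k]" "?S \<subseteq> cdom C [i, k]" "z j k ` ?S \<subseteq> cdom C [i, j]" "?S \<subseteq> cdom C [k]"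
    using src.triple_overlap[OF _ assms] cdom_last by auto
  have hol: "(\<lambda>x. Lz [i, j] (z j k x)) holomorphic_on ?S"
    using holomorphic_on_compose_gen[OF holomorphic_on_subset[OF src.transition_holomorphic[OF
      assms(2,3)] sub(1)]
        Lz_holomorphic[OF assms(1,2)] sub(3)] by (simp add: o_def)
  have s: "smooth_on (\<lambda>x. \<phi>' [i, j, k] (F k x)) ?S" "smooth_on (\<phi> [i, j, k]) ?S" "smooth_on (Lf k) ?S"
     "smooth_on (\<lambda>x. Lz [i, j] (z j k x)) ?S" "smooth_on (V j k) ?S" "smooth_on (Lz [i, k]) ?S"
    subgoal by (rule compose_F_smooth) (use assms phi'_holomorphic in auto)
    subgoal by (rule smooth_on_holomorphic[OF o phi_holomorphic[OF assms]])
    subgoal by (rule smooth_on_subset[OF Lf_smooth[OF assms(3)] sub(4)])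
    subgoal by (rule smooth_on_holomorphic[OF o hol])
    subgoal by (rule smooth_on_subset[OF compose_F_smooth sub(1)]) (use assms Lw_holomorphic in auto)
    subgoal by (rule smooth_on_holomorphic[OF o holomorphic_on_subset[OF Lz_holomorphic[OF assms(1,3)]
      sub(2)]])
    done
  have "smooth_on (\<lambda>x. \<phi>' [i, j, k] (F k x) - \<phi> [i, j, k] x
      - (2 * of_real pi * \<i> * of_int m' + 2 * of_real pi * \<i> * of_int m) * Lf k x
     - Lz [i, j] (z j k x) * V j k x + 2 * of_real pi * \<i> * of_int m' * Lz [i, k] x) ?S"
    by (intro smooth_on_add smooth_on_diff smooth_on_mult smooth_on_const s o)
  then show ?thesis
    by (rule smooth_on_cong[OF o, rotated]) (simp only: c Theta_eq)
qed

text \<open>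
  The equation \<open>\<delta>\<theta> = d\<Theta>\<close>, one coefficient at a time. The terms with \<open>\<mu>\<close> drop out because \<open>\<mu>\<close> is a
  \<open>(-1,1)\<close>-form and \<open>\<delta>(dU) = dc = 0\<close>.
\<close>
lemma delta_theta:
  assumes "i \<in> idx C" "j \<in> idx C" "k \<in> idx C" and x: "x \<in> cdom C [i, j, k]"
  defines "T \<equiv> Theta C E f Lz Lw Lf \<phi> \<phi>' i j k"
  shows "theta_dz j k x - theta_dz i k x + theta_dz i j (z j k x) * deriv (z j k) x = del T x"
    and "theta_dzbar j k x - theta_dzbar i k x + theta_dzbar i j (z j k x) * cnj (deriv (z j k) x) =
      delbar T x"
proof -
  let ?S = "cdom C [i, j, k]"
  note I = assms(1-3)
  obtain m :: int where c1: "\<And>x. x \<in> ?S \<Longrightarrow> cz i j k x = 2 * of_real pi * \<i> * of_int m"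
    using cz_constant[OF I] by blast
  obtain m' :: int where c2: "\<And>x. x \<in> ?S \<Longrightarrow> cw i j k x = 2 * of_real pi * \<i> * of_int m'"
    using cw_constant[OF I] by blast
  note c = c1 c2
  define K K' where K: "K = 2 * of_real pi * \<i> * complex_of_int m" and K': "K' = 2 * of_real pi * \<i> *
    complex_of_int m'"
  have o: "open ?S" "open (cdom E [i, j, k])" using open_src open_tgt I by auto
  note sub = src.triple_overlap[OF x I]
  have xk: "x \<in> cdom C [k]" using cdom_last[OF x] by simp
  have Fx: "F k x \<in> cdom E [i, j, k]" using F_mem[OF x] I by simp
  have IE: "i \<in> idx E" "j \<in> idx E" "k \<in> idx E" using I idx_eq by auto
  let ?z = "z j k x" and ?z' = "deriv (z j k) x" and ?D = "del (F k) x" and ?Db = "delbar (F k) x"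
  let ?u = "deriv (Lz [i, j]) ?z * ?z'"
  let ?v = "deriv (Lw [j, k]) (F k x)"
  note wU = compose_transition_has_wirtinger[OF I(2,3) sub(1) Lz_has_wirtinger[OF I(1,2) sub(3)]]
  note wUjk = Lz_has_wirtinger[OF I(2,3) sub(1)] and wUik = Lz_has_wirtinger[OF I(1,3) sub(2)]
  note wV = V_has_wirtinger[OF I(2,3) sub(1)]
  \<comment> \<open>The cocycle \<open>c\<close> of the logarithms is locally constant, hence its differential vanishes.\<close>
  have "has_wirtinger (\<lambda>y. Lz [j, k] y - Lz [i, k] y + Lz [i, j] (z j k y))
      (deriv (Lz [j, k]) x - deriv (Lz [i, k]) x + ?u) (0 - 0 + 0 * cnj ?z') x"
    by (rule has_wirtinger_add[OF has_wirtinger_diff[OF wUjk wUik] wU])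
  moreover have "has_wirtinger (\<lambda>y. Lz [j, k] y - Lz [i, k] y + Lz [i, j] (z j k y)) 0 0 x"
    by (rule has_wirtinger_cong[OF has_wirtinger_const[of K] o(1) x]) (use c(1) in \<open>simp add:
      cech_delta_fun_3 K\<close>)
  ultimately have u: "deriv (Lz [j, k]) x - deriv (Lz [i, k]) x + ?u = 0"
    using has_wirtinger_unique by blast
  have wphi: "has_wirtinger (\<phi> [i, j, k]) (deriv (\<phi> [i, j, k]) x) 0 x"
    by (rule has_field_derivative_imp_wirtinger[OF holomorphic_derivI[OF phi_holomorphic[OF I] o(1) x]])
  have wphi': "has_wirtinger (\<lambda>y. \<phi>' [i, j, k] (F k y)) (deriv (\<phi>' [i, j, k]) (F k x) * ?D) (deriv (\<phi>'
    [i, j, k]) (F k x) * ?Db) x"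
    using has_wirtinger_compose[OF has_field_derivative_imp_wirtinger[OF holomorphic_derivI[OF
      phi'_holomorphic[OF I] o(2) Fx]]
        F_has_wirtinger[OF I(3) xk]] by simp
  note wL = smooth_on_has_wirtinger[OF Lf_smooth[OF I(3)] xk]
  have "has_wirtinger (\<lambda>y. \<phi>' [i, j, k] (F k y) - \<phi> [i, j, k] y - (K' + K) * Lf k y
       - Lz [i, j] (z j k y) * V j k y + K' * Lz [i, k] y)
     (deriv (\<phi>' [i, j, k]) (F k x) * ?D - deriv (\<phi> [i, j, k]) x - (0 * Lf k x + (K' + K) * del (Lf k) x)
       - (?u * V j k x + Lz [i, j] ?z * (?v * ?D)) + (0 * Lz [i, k] x + K' * deriv (Lz [i, k]) x))
     (deriv (\<phi>' [i, j, k]) (F k x) * ?Db - 0 - (0 * Lf k x + (K' + K) * delbar (Lf k) x)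
       - (0 * cnj ?z' * V j k x + Lz [i, j] ?z * (?v * ?Db)) + (0 * Lz [i, k] x + K' * 0)) x"
    by (intro has_wirtinger_add has_wirtinger_diff has_wirtinger_mult has_wirtinger_const wphi wphi' wL
      wU wV wUik)
  then have "has_wirtinger T
     (deriv (\<phi>' [i, j, k]) (F k x) * ?D - deriv (\<phi> [i, j, k]) x - (0 * Lf k x + (K' + K) * del (Lf k) x)
       - (?u * V j k x + Lz [i, j] ?z * (?v * ?D)) + (0 * Lz [i, k] x + K' * deriv (Lz [i, k]) x))
     (deriv (\<phi>' [i, j, k]) (F k x) * ?Db - 0 - (0 * Lf k x + (K' + K) * delbar (Lf k) x)
       - (0 * cnj ?z' * V j k x + Lz [i, j] ?z * (?v * ?Db)) + (0 * Lz [i, k] x + K' * 0)) x"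
    by (rule has_wirtinger_cong[OF _ o(1) x]) (simp only: T_def Theta_eq c K K')
  note dT = has_wirtinger_del[OF this] has_wirtinger_delbar[OF this]
  have KK: "K = Lz [j, k] x - Lz [i, k] x + Lz [i, j] ?z" "K' = V j k x - V i k x + V i j ?z"
    using c[OF x] by (simp_all add: cech_delta_fun_3 K K')
  have t: "- (Lz [i, j] ?z * deriv (Lz [j, k]) x)
      = \<tau> [j, k] x - \<tau> [i, k] x + \<tau> [i, j] ?z * ?z' + deriv (\<phi> [i, j, k]) x"
    by (rule src.tame_trivialization_dz[OF triv Lz_holomorphic x]) (use I in auto)
  have t': "- (V i j ?z * ?v)
      = \<tau>' [j, k] (F k x) - \<tau>' [i, k] (F k x) + \<tau>' [i, j] (F j ?z) * deriv (w j k) (F k x) + deriv (\<phi>'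
        [i, j, k]) (F k x)"
    using tgt.tame_trivialization_dz[OF triv' Lw_holomorphic[OF I(2,3)] Fx IE] by (simp add:
      F_transition3[OF x I])
  note ch = chain_rule_F[OF I(2,3) sub(1)] and dl = d_log_del_F_transition[OF I(2,3) sub(1)]
  have A1: "deriv (\<phi>' [i, j, k]) (F k x) * ?D = - (V i j ?z * (?v * ?D)) - (\<tau>' [j, k] (F k x) * ?D - \<tau>'
    [i, k] (F k x) * ?D
        + \<tau>' [i, j] (F j ?z) * (del (F j) ?z * ?z'))"
    unfolding ch using arg_cong[OF t', of "\<lambda>s. s * ?D"] by (simp add: algebra_simps)
  have A2: "deriv (\<phi>' [i, j, k]) (F k x) * ?Db = - (V i j ?z * (?v * ?Db)) - (\<tau>' [j, k] (F k x) * ?Db -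
    \<tau>' [i, k] (F k x) * ?Db
        + \<tau>' [i, j] (F j ?z) * (delbar (F j) ?z * cnj ?z'))"
    unfolding ch using arg_cong[OF t', of "\<lambda>s. s * ?Db"] by (simp add: algebra_simps)
  have B: "deriv (\<phi> [i, j, k]) x = - (Lz [i, j] ?z * deriv (Lz [j, k]) x) - (\<tau> [j, k] x - \<tau> [i, k] x + \<tau>
    [i, j] ?z * ?z')"
    using t by (simp add: algebra_simps)
  have "theta_dz j k x - theta_dz i k x + theta_dz i j ?z * ?z' = 
     (- ((V j k x + Lz [j, k] x) * del (Lf k) x) + V j k x * deriv (Lz [j, k]) x - \<tau>' [j, k] (F k x) * ?D
       + \<tau> [j, k] x)
     - (- ((V i k x + Lz [i, k] x) * del (Lf k) x) + V i k x * deriv (Lz [i, k]) x - \<tau>' [i, k] (F k x) *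
       ?D + \<tau> [i, k] x)
     + (- ((V i j ?z + Lz [i, j] ?z) * (del (Lf k) x + ?v * ?D - deriv (Lz [j, k]) x)) + V i j ?z * ?u
        - \<tau>' [i, j] (F j ?z) * (del (F j) ?z * ?z') + \<tau> [i, j] ?z * ?z')"
    unfolding theta_dz_def dl(1)[symmetric] by (simp add: algebra_simps)
  also note theta_cocycle_identity[OF A1 B u]
  finally show "theta_dz j k x - theta_dz i k x + theta_dz i j ?z * ?z' = del T x"
    unfolding dT KK by simp
  have "2 * \<mu> k x * deriv (Lz [j, k]) x - 2 * \<mu> k x * deriv (Lz [i, k]) x + 2 * (\<mu> j ?z * cnj ?z') *
    deriv (Lz [i, j]) ?z
     = 2 * \<mu> k x * (deriv (Lz [j, k]) x - deriv (Lz [i, k]) x + ?u)"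
    unfolding beltrami_transition[OF I(2,3) sub(1)] by (simp add: algebra_simps)
  then have mu: "2 * \<mu> k x * deriv (Lz [j, k]) x - 2 * \<mu> k x * deriv (Lz [i, k]) x + 2 * (\<mu> j ?z * cnj
    ?z') * deriv (Lz [i, j]) ?z = 0"
    using u by simp
  have "theta_dzbar j k x - theta_dzbar i k x + theta_dzbar i j ?z * cnj ?z' = 
     (2 * \<mu> k x * deriv (Lz [j, k]) x - 2 * \<mu> k x * deriv (Lz [i, k]) x + 2 * (\<mu> j ?z * cnj ?z') * deriv
       (Lz [i, j]) ?z) +
     ((- ((V j k x + Lz [j, k] x) * delbar (Lf k) x) + V j k x * 0 - \<tau>' [j, k] (F k x) * ?Db + 0)
     - (- ((V i k x + Lz [i, k] x) * delbar (Lf k) x) + V i k x * 0 - \<tau>' [i, k] (F k x) * ?Db + 0)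
     + (- ((V i j ?z + Lz [i, j] ?z) * (delbar (Lf k) x + ?v * ?Db - 0)) + V i j ?z * 0
        - \<tau>' [i, j] (F j ?z) * (delbar (F j) ?z * cnj ?z') + 0))"
    unfolding theta_dzbar_def diff_0_right dl(2)[symmetric] by (simp add: algebra_simps)
  also have "\<dots> = delbar T x"
    unfolding mu dT KK by (subst theta_cocycle_identity[OF A2, of 0 _ 0 0 0 0 0 0]) simp_all
  finally show "theta_dzbar j k x - theta_dzbar i k x + theta_dzbar i j ?z * cnj ?z' = delbar T x" .
qed

section \<open>Integrality of the constants m\<close>

text \<open>
  Three groups of terms of \<open>\<delta>\<Theta>\<close> are rewritten: \<open>\<delta>\<phi>' - \<delta>\<phi>\<close> by the trivializations, \<open>\<delta>((c + c') \<Lambda>)\<close> by the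
  transformation of \<open>\<Lambda>\<close> and \<open>\<delta>c = \<delta>c' = 0\<close>, and \<open>\<delta>(U V)\<close> by the Leibniz rule for the cup product. All
  products of a logarithm with a cocycle then cancel up to
  \<open>c'\<^sub>j\<^sub>k\<^sub>l c\<^sub>i\<^sub>j\<^sub>l - c'\<^sub>i\<^sub>j\<^sub>k c\<^sub>i\<^sub>k\<^sub>l\<close>. Since \<open>\<int>(1) \<int>(1) \<subseteq> \<int>(2)\<close>, the result lies in \<open>\<int>(2)\<close>; it does not
  depend on the point because each cocycle is constant on its connected overlap.
\<close>
lemma m_cochain_in_Ztw:
  assumes I: "i \<in> idx C" "j \<in> idx C" "k \<in> idx C" "l \<in> idx C"
  shows "\<exists>m\<in>Ztw 2. \<forall>x\<in>cdom C [i, j, k, l]. m_cochain C E f Lz Lw Lf \<phi> \<phi>' i j k l x = m"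
proof (cases "cdom C [i, j, k, l] = {}")
  case True
  have "0 \<in> Ztw 2" unfolding Ztw_def by (rule range_eqI[of _ _ 0]) simp
  with True show ?thesis by blast
next
  case False
  then obtain x0 where x0: "x0 \<in> cdom C [i, j, k, l]" by blast
  define P where "P = 2 * of_real pi * \<i>"
  obtain e :: int where e: "\<And>x. x \<in> cdom C [k, l] \<Longrightarrow>
    Lf k (z k l x) + Lz [k, l] x - V k l x - Lf l x = P * of_int e"
    using log_del_F_transition[OF I(3,4)] unfolding P_def by blast
  obtain a :: int where a1: "\<And>x. x \<in> cdom C [i, j, k] \<Longrightarrow> cz i j k x = P * of_int a"
    using cz_constant[OF I(1,2,3)] unfolding P_def by blast
  obtain a' :: int where a2: "\<And>x. x \<in> cdom C [i, j, k] \<Longrightarrow> cw i j k x = P * of_int a'"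
    using cw_constant[OF I(1,2,3)] unfolding P_def by blast
  note a = a1 a2
  obtain b' :: int where b: "\<And>x. x \<in> cdom C [j, k, l] \<Longrightarrow> cw j k l x = P * of_int b'"
    using cw_constant[OF I(2,3,4)] unfolding P_def by blast
  obtain d :: int where d: "\<And>x. x \<in> cdom C [i, j, l] \<Longrightarrow> cz i j l x = P * of_int d"
    using cz_constant[OF I(1,2,4)] unfolding P_def by blast
  obtain g :: int where g: "\<And>x. x \<in> cdom C [i, k, l] \<Longrightarrow> cz i k l x = P * of_int g"
    using cz_constant[OF I(1,3,4)] unfolding P_def by blast
  have n: "n [i, j, k, l] \<in> Ztw 2" using triv x0 I unfolding tame_trivialization_def by blast
  have "F l x0 \<in> cdom E [i, j, k, l]" using F_mem[OF x0] I by simp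
  then have n': "n' [i, j, k, l] \<in> Ztw 2" using triv' I unfolding tame_trivialization_def idx_eq by blast
  define m where "m = n' [i, j, k, l] - n [i, j, k, l] + P ^ 2 * of_int (e * (a + a') + b' * d - a' * g)"
  have "m \<in> Ztw 2"
  proof -
    obtain q q' :: int where "n [i, j, k, l] = P ^ 2 * of_int q" "n' [i, j, k, l] = P ^ 2 * of_int q'"
      using n n' unfolding Ztw_def P_def by blast
    then have "m = P ^ 2 * of_int (q' - q + (e * (a + a') + b' * d - a' * g))"
      unfolding m_def by (simp add: algebra_simps)
    then show ?thesis unfolding Ztw_def P_def by blast
  qed
  moreover have "m_cochain C E f Lz Lw Lf \<phi> \<phi>' i j k l x = m" if x: "x \<in> cdom C [i, j, k, l]" for x
  proof -
    have s: "set [i, j, k, l] \<subseteq> idx C" using I by simp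
    have sub: "x \<in> cdom C [k, l]" "x \<in> cdom C [j, k, l]" "x \<in> cdom C [i, j, l]" "x \<in> cdom C [i, k, l]"
      using x by (auto simp: cdom_def)
    have zx: "z k l x \<in> cdom C [i, j, k]"
      using src.transition_mem[OF x _ s, of "[i, j, k]"] by simp
    have zz: "z j k (z k l x) = z j l x" "z i j (z j l x) = z i l x"
      using src.transition_transition[OF x _ s] by simp_all
    have Fl: "F l x \<in> cdom E [i, j, k, l]" using F_mem[OF x] I by simp
    have wF: "w k l (F l x) = F k (z k l x)" "w j k (F k (z k l x)) = F j (z j l x)"
      using F_transition[OF I(3,4) sub(1)] F_transition[OF I(2,3), of "z k l x"] src.triple_overlap(1)[OF
        zx I(1-3)] zz by auto
    have t: "cz i j k (z k l x) * Lz [k, l] x = - cech_delta_fun C \<phi> [i, j, k, l] x + n [i, j, k, l]"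
      using triv x I unfolding tame_trivialization_def by blast
    have "cech_delta_fun E Lw [i, j, k] (w k l (F l x)) * Lw [k, l] (F l x)
       = - cech_delta_fun E \<phi>' [i, j, k, l] (F l x) + n' [i, j, k, l]"
      using triv' Fl I unfolding tame_trivialization_def idx_eq by blast
    then have t': "cw i j k (z k l x) * V k l x = - (\<phi>' [j, k, l] (F l x) - \<phi>' [i, k, l] (F l x) + \<phi>' [i,
      j, l] (F l x)
        - \<phi>' [i, j, k] (F k (z k l x))) + n' [i, j, k, l]"
      unfolding cech_delta_fun_4 wF cw_eq[OF zx I(1-3)] .
    \<comment> \<open>All logarithms are evaluated at the point with coordinate \<open>x\<close> with respect to \<open>l\<close>.\<close>
    define Vij Vik Vil Vjk Vjl Vkl where V: "Vij = V i j (z j l x)" "Vik = V i k (z k l x)" "Vil = V i l x"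
      "Vjk = V j k (z k l x)" "Vjl = V j l x" "Vkl = V k l x"
    define Uij Uik Uil Ujk Ujl Ukl where U: "Uij = Lz [i, j] (z j l x)" "Uik = Lz [i, k] (z k l x)" "Uil
      = Lz [i, l] x"
      "Ujk = Lz [j, k] (z k l x)" "Ujl = Lz [j, l] x" "Ukl = Lz [k, l] x"
    have cc: "cz i j k (z k l x) = Ujk - Uik + Uij" "cz j k l x = Ukl - Ujl + Ujk" "cz i j l x = Ujl -
      Uil + Uij"
      "cz i k l x = Ukl - Uil + Uik" "cw i j k (z k l x) = Vjk - Vik + Vij" "cw j k l x = Vkl - Vjl + Vjk"
      "cw i j l x = Vjl - Vil + Vij" "cw i k l x = Vkl - Vil + Vik"
      unfolding U V by (simp_all add: cech_delta_fun_3 zz)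
    have L: "Lf k (z k l x) = Lf l x + Vkl - Ukl + P * of_int e"
      using e[OF sub(1)] unfolding U V by (simp add: algebra_simps)
    have p: "\<phi> [j, k, l] x - \<phi> [i, k, l] x + \<phi> [i, j, l] x - \<phi> [i, j, k] (z k l x) = n [i, j, k, l] -
      (Ujk - Uik + Uij) * Ukl"
      using t unfolding cech_delta_fun_4 cc U by (simp add: algebra_simps)
    have p': "\<phi>' [j, k, l] (F l x) - \<phi>' [i, k, l] (F l x) + \<phi>' [i, j, l] (F l x) - \<phi>' [i, j, k] (F k (z k
      l x))
       = n' [i, j, k, l] - (Vjk - Vik + Vij) * Vkl"
      using t' unfolding cc V by (simp add: algebra_simps)
    have "m_cochain C E f Lz Lw Lf \<phi> \<phi>' i j k l x
      = (\<phi>' [j, k, l] (F l x) - \<phi>' [i, k, l] (F l x) + \<phi>' [i, j, l] (F l x) - \<phi>' [i, j, k] (F k (z k l x)))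
       - (\<phi> [j, k, l] x - \<phi> [i, k, l] x + \<phi> [i, j, l] x - \<phi> [i, j, k] (z k l x))
       + (- (((Vkl - Vjl + Vjk) + (Ukl - Ujl + Ujk)) * Lf l x) - Ujk * Vkl + (Vkl - Vjl + Vjk) * Ujl)
       - (- (((Vkl - Vil + Vik) + (Ukl - Uil + Uik)) * Lf l x) - Uik * Vkl + (Vkl - Vil + Vik) * Uil)
       + (- (((Vjl - Vil + Vij) + (Ujl - Uil + Uij)) * Lf l x) - Uij * Vjl + (Vjl - Vil + Vij) * Uil)
       - (- (((Vjk - Vik + Vij) + (Ujk - Uik + Uij)) * Lf k (z k l x)) - Uij * Vjk + (Vjk - Vik + Vij) * Uik)"
      unfolding m_cochain_def cech_delta_fun_4 
      by (simp add: Theta_eq cc zz U[symmetric] V[symmetric] eval_nat_numeral) 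
    also have "\<dots> = n' [i, j, k, l] - n [i, j, k, l] + P * of_int e * ((Vjk - Vik + Vij) + (Ujk - Uik + Uij))
        + (Vkl - Vjl + Vjk) * (Ujl - Uil + Uij) - (Vjk - Vik + Vij) * (Ukl - Uil + Uik)"
      unfolding p p' L by (simp add: algebra_simps)
    also have "\<dots> = m"
      using a[OF zx] b[OF sub(2)] d[OF sub(3)] g[OF sub(4)] unfolding cc m_def
      by (simp add: algebra_simps power2_eq_square)
    finally show ?thesis .
  qed
  ultimately show ?thesis by blast
qed

end

section \<open>The total cochain is a cocycle\<close>

text \<open>
  The components of \<open>\<Omega>\<close> are cut off outside an open overlap; at its points \<open>d\<close> only sees the explicit
  smooth coefficients.
\<close>
lemma ext_d_local:
  assumes S: "open S" "x \<in> S" and eq: "\<And>y. y \<in> S \<Longrightarrow> \<eta> y = (a y, b y, c y, e y)"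
    and smooth: "smooth_on a S" "smooth_on b S" "smooth_on c S"
  shows "ext_d \<eta> x = (0, del a x, delbar a x, del c x - delbar b x)"
proof (rule ext_d_at)
  show "has_wirtinger (coef_one \<eta>) (del a x) (delbar a x) x"
    by (rule has_wirtinger_cong[OF smooth_on_has_wirtinger[OF smooth(1) S(2)] S]) (simp add: eq)
  show "has_wirtinger (coef_dz \<eta>) (del b x) (delbar b x) x"
    by (rule has_wirtinger_cong[OF smooth_on_has_wirtinger[OF smooth(2) S(2)] S]) (simp add: eq)
  show "has_wirtinger (coef_dzbar \<eta>) (del c x) (delbar c x) x"
    by (rule has_wirtinger_cong[OF smooth_on_has_wirtinger[OF smooth(3) S(2)] S]) (simp add: eq)
qed

lemma del_cmult: "g differentiable (at x) \<Longrightarrow> del (\<lambda>y. \<kappa> * g y) x = \<kappa> * del g x"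
  and delbar_cmult: "g differentiable (at x) \<Longrightarrow> delbar (\<lambda>y. \<kappa> * g y) x = \<kappa> * delbar g x"
  using has_wirtinger_mult[OF has_wirtinger_const[of \<kappa> x] differentiable_imp_has_wirtinger[of g x]]
  by (auto dest: has_wirtinger_del has_wirtinger_delbar)

lemma smooth_formsI:
  assumes "open S" and eq: "\<And>y. y \<in> S \<Longrightarrow> \<eta> y = (a y, b y, c y, e y)"
    and "smooth_on a S" "smooth_on b S" "smooth_on c S" "smooth_on e S"
    and "\<And>y. y \<in> S \<Longrightarrow> homogeneous r (a y, b y, c y, e y)" "\<And>y. y \<notin> S \<Longrightarrow> \<eta> y = 0"
  shows "\<eta> \<in> smooth_forms r S"
proof -
  have "smooth_on \<eta> S"
    by (rule smooth_on_cong[OF assms(1), where f = "\<lambda>y. (a y, b y, c y, e y)"])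
       (intro smooth_on_Pair assms | simp add: eq)+
  then show ?thesis using assms by (simp add: smooth_forms_def)
qed

lemma tot_D_at:
  assumes "is \<noteq> []" "set is \<subseteq> idx C" "x \<in> cdom C is"
  shows "tot_D N C \<Psi> p is x = (if p = 0 then 0 else deligne_d N (p - 1) (\<Psi> (p - 1) is) x)
     + (-1) ^ p *\<^sub>R cech_delta C (\<Psi> p) is x"
  using assms by (simp add: tot_D_def restrict_form_def)

context polyakov_setting begin

abbreviation "\<kappa> \<equiv> 2 * complex_of_real pi * \<i>"
abbreviation "\<Omega> \<equiv> Omega C E f h Lz Lw Lf \<tau> \<phi> \<tau>' \<phi>'"
abbreviation "\<Theta> \<equiv> Theta C E f Lz Lw Lf \<phi> \<phi>'"
abbreviation "m_co \<equiv> m_cochain C E f Lz Lw Lf \<phi> \<phi>'"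

lemma Omega_3:
  assumes "i \<in> idx C" "x \<in> cdom C [i]"
  shows "\<Omega> 3 [i] x = (0, 0, 0, \<kappa> * omega_coef i x)"
  using assms by (simp add: Omega_def restrict_form_def scale_form_def polyakov_form_coef)

lemma Omega_2:
  assumes "i \<in> idx C" "j \<in> idx C" "x \<in> cdom C [i, j]"
  shows "\<Omega> 2 [i, j] x = (0, \<kappa> * theta_dz i j x, \<kappa> * theta_dzbar i j x, 0)"
  using assms by (simp add: Omega_def restrict_form_def scale_form_def theta_coef)

lemma Omega_1:
  assumes "i \<in> idx C" "j \<in> idx C" "k \<in> idx C" "x \<in> cdom C [i, j, k]"
  shows "\<Omega> (Suc 0) [i, j, k] x = (- \<kappa> * \<Theta> i j k x, 0, 0, 0)"
  using assms by (simp add: Omega_def restrict_form_def scale_form_def fun_form_def eval_nat_numeral)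

lemma Omega_0:
  assumes "i \<in> idx C" "j \<in> idx C" "k \<in> idx C" "l \<in> idx C" "x \<in> cdom C [i, j, k, l]"
  shows "\<Omega> 0 [i, j, k, l] x = (- \<kappa> * m_co i j k l x, 0, 0, 0)"
  using assms by (simp add: Omega_def restrict_form_def scale_form_def fun_form_def eval_nat_numeral)

lemma Omega_off: "x \<notin> cdom C is \<Longrightarrow> \<Omega> p is x = 0"
  by (simp add: Omega_def restrict_form_def)

lemma Omega_vanishing: "\<not> (p \<le> 3 \<and> length is = 3 - p + 1 \<and> set is \<subseteq> idx C) \<Longrightarrow> \<Omega> p is = 0"
  by (simp only: Omega_def if_False)

lemma Omega_in_deligne_sections:
  assumes "p \<le> 3" "length is = 3 - p + 1" "set is \<subseteq> idx C"
  shows "\<Omega> p is \<in> deligne_sections 3 p (cdom C is)"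
proof -
  have o: "open (cdom C is)" by (rule src.open_cdom) (use assms in auto)
  consider "p = 0" | "p = 1" | "p = 2" | "p = 3" using assms(1) by linarith
  then show ?thesis
  proof cases
    case 1
    then obtain i j k l where l: "is = [i, j, k, l]" using assms(2) by (auto simp: length_Suc_conv
      eval_nat_numeral)
    then have I: "i \<in> idx C" "j \<in> idx C" "k \<in> idx C" "l \<in> idx C" using assms(3) by auto
    obtain m where m: "m \<in> Ztw 2" "\<And>x. x \<in> cdom C is \<Longrightarrow> m_co i j k l x = m"
      using m_cochain_in_Ztw[OF I] l by blast
    then obtain q :: int where "m = \<kappa> ^ 2 * of_int q" by (auto simp: Ztw_def)
    then have "- \<kappa> * m = \<kappa> ^ 3 * of_int (- q)" by (simp add: power2_eq_square power3_eq_cube)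
    then have K: "- \<kappa> * m \<in> Ztw 3" unfolding Ztw_def by blast
    have "\<Omega> 0 is x = (- \<kappa> * m, 0, 0, 0)" if "x \<in> cdom C is" for x
      using Omega_0[OF I] that m(2)[OF that] l by simp
    then show ?thesis using K 1 Omega_off
      by (auto simp: deligne_sections_def Ztw_sections_def intro!: bexI[OF _ K] always_eventually)
  next
    case 2
    then obtain i j k where l: "is = [i, j, k]" using assms(2) by (auto simp: length_Suc_conv
      eval_nat_numeral)
    then have I: "i \<in> idx C" "j \<in> idx C" "k \<in> idx C" using assms(3) by auto
    have "smooth_on (\<lambda>x. - \<kappa> * \<Theta> i j k x) (cdom C is)"
      using Theta_smooth[OF I] o l by (intro smooth_on_mult smooth_on_const) auto
    then have "\<Omega> 1 is \<in> smooth_forms 0 (cdom C is)"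
      by (intro smooth_formsI[OF o, where a = "\<lambda>x. - \<kappa> * \<Theta> i j k x" and b = "\<lambda>x. 0" and c = "\<lambda>x. 0" and e
        = "\<lambda>x. 0"]
          smooth_on_const) (use Omega_1[OF I] l Omega_off in auto)
    then show ?thesis using 2 by (simp add: deligne_sections_def)
  next
    case 3
    then obtain i j where l: "is = [i, j]" using assms(2) by (auto simp: length_Suc_conv eval_nat_numeral)
    then have I: "i \<in> idx C" "j \<in> idx C" using assms(3) by auto
    have "smooth_on (\<lambda>x. \<kappa> * theta_dz i j x) (cdom C is)" "smooth_on (\<lambda>x. \<kappa> * theta_dzbar i j x) (cdom C is)"
      using theta_smooth[OF I] o l by (auto intro!: smooth_on_mult smooth_on_const)
    then have "\<Omega> 2 is \<in> smooth_forms 1 (cdom C is)"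
      by (intro smooth_formsI[OF o, where a = "\<lambda>x. 0" and b = "\<lambda>x. \<kappa> * theta_dz i j x" and c = "\<lambda>x. \<kappa> *
        theta_dzbar i j x" and e = "\<lambda>x. 0"]
          smooth_on_const) (use Omega_2[OF I] l Omega_off in auto)
    then show ?thesis using 3 by (simp add: deligne_sections_def)
  next
    case 4
    then obtain i where l: "is = [i]" using assms(2) by (auto simp: length_Suc_conv eval_nat_numeral)
    then have I: "i \<in> idx C" using assms(3) by auto
    have "smooth_on (\<lambda>x. \<kappa> * omega_coef i x) (cdom C is)"
      using omega_coef_smooth[OF I] o l by (auto intro!: smooth_on_mult smooth_on_const)
    then have "\<Omega> 3 is \<in> smooth_forms 2 (cdom C is)"
      by (intro smooth_formsI[OF o, where a = "\<lambda>x. 0" and b = "\<lambda>x. 0" and c = "\<lambda>x. 0" and e = "\<lambda>x. \<kappa> *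
        omega_coef i x"]
          smooth_on_const) (use Omega_3[OF I] l Omega_off in auto)
    then show ?thesis using 4 by (simp add: deligne_sections_def)
  qed
qed

lemma Omega_cochain: "\<Omega> \<in> tot_cochains 3 C 3"
  unfolding tot_cochains_def using Omega_in_deligne_sections Omega_vanishing by auto

lemma tot_D_Omega_3:
  assumes I: "i \<in> idx C" "j \<in> idx C" and x: "x \<in> cdom C [i, j]"
  shows "tot_D 3 C \<Omega> 3 [i, j] x = 0"
proof -
  have o: "open (cdom C [i, j])" using open_src I by simp
  note th = theta_smooth[OF I]
  have s: "smooth_on (\<lambda>x. \<kappa> * theta_dz i j x) (cdom C [i, j])" "smooth_on (\<lambda>x. \<kappa> * theta_dzbar i j x)
    (cdom C [i, j])"
    using th o by (auto intro!: smooth_on_mult smooth_on_const)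
  have "ext_d (\<Omega> 2 [i, j]) x = (0, del (\<lambda>x. 0) x, delbar (\<lambda>x. 0) x,
      del (\<lambda>x. \<kappa> * theta_dzbar i j x) x - delbar (\<lambda>x. \<kappa> * theta_dz i j x) x)"
    by (rule ext_d_local[OF o x Omega_2[OF I] smooth_on_const s])
  also have "\<dots> = (0, 0, 0, \<kappa> * (del (theta_dzbar i j) x - delbar (theta_dz i j) x))"
    using smooth_on_differentiable[OF th(1) x] smooth_on_differentiable[OF th(2) x]
      has_wirtinger_del[OF has_wirtinger_const] has_wirtinger_delbar[OF has_wirtinger_const]
    by (simp add: del_cmult delbar_cmult algebra_simps)
  finally have d: "ext_d (\<Omega> 2 [i, j]) x = (0, 0, 0, \<kappa> * (del (theta_dzbar i j) x - delbar (theta_dz i j)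
    x))" .
  have c: "cech_delta C (\<Omega> 3) [i, j] x = (0, 0, 0, \<kappa> * (omega_coef j x - omega_coef i (z i j x) * (deriv
    (z i j) x * cnj (deriv (z i j) x))))"
    using cdom_last[OF x] 
    by (simp add: cech_delta_2 src.pullback_transition[OF I x] Let_def Omega_3[OF I(1) transition_mem2[OF
      I x]] Omega_3[OF I(2)] algebra_simps)
  show ?thesis
    using I x by (simp add: tot_D_at deligne_d_def d c d_theta[OF I x] zero_prod_def)
qed

lemma tot_D_Omega_2:
  assumes I: "i \<in> idx C" "j \<in> idx C" "k \<in> idx C" and x: "x \<in> cdom C [i, j, k]"
  shows "tot_D 3 C \<Omega> 2 [i, j, k] x = 0"
proof -
  have o: "open (cdom C [i, j, k])" using open_src I by simp
  note th = Theta_smooth[OF I] and sub = src.triple_overlap[OF x I]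
  have s: "smooth_on (\<lambda>x. - \<kappa> * \<Theta> i j k x) (cdom C [i, j, k])"
    by (intro smooth_on_mult smooth_on_const th o)
  have "ext_d (\<Omega> (Suc 0) [i, j, k]) x = (0, del (\<lambda>x. - \<kappa> * \<Theta> i j k x) x, delbar (\<lambda>x. - \<kappa> * \<Theta> i j k x) x,
      del (\<lambda>x. 0) x - delbar (\<lambda>x. 0) x)"
    by (rule ext_d_local[OF o x Omega_1[OF I] s smooth_on_const smooth_on_const])
  also have "\<dots> = (0, - \<kappa> * del (\<Theta> i j k) x, - \<kappa> * delbar (\<Theta> i j k) x, 0)"
    using has_wirtinger_del[OF has_wirtinger_const] has_wirtinger_delbar[OF has_wirtinger_const]
    by (simp only: del_cmult[OF smooth_on_differentiable[OF th x]] delbar_cmult[OF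
      smooth_on_differentiable[OF th x]]) simp
  finally have d: "ext_d (\<Omega> (Suc 0) [i, j, k]) x = (0, - \<kappa> * del (\<Theta> i j k) x, - \<kappa> * delbar (\<Theta> i j k) x, 0)" .
  have c: "cech_delta C (\<Omega> 2) [i, j, k] x = (0, 
      \<kappa> * (theta_dz j k x - theta_dz i k x + theta_dz i j (z j k x) * deriv (z j k) x),
      \<kappa> * (theta_dzbar j k x - theta_dzbar i k x + theta_dzbar i j (z j k x) * cnj (deriv (z j k) x)), 0)"
    by (simp add: cech_delta_3 src.pullback_transition[OF I(2,3) sub(1)] Let_def
        Omega_2[OF I(1,2) sub(3)] Omega_2[OF I(2,3) sub(1)] Omega_2[OF I(1,3) sub(2)] algebra_simps)
  show ?thesis
    using I x by (simp add: tot_D_at deligne_d_def d c delta_theta[OF I x] zero_prod_def)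
qed

lemma tot_D_Omega_1:
  assumes I: "i \<in> idx C" "j \<in> idx C" "k \<in> idx C" "l \<in> idx C" and x: "x \<in> cdom C [i, j, k, l]"
  shows "tot_D 3 C \<Omega> (Suc 0) [i, j, k, l] x = 0"
proof -
  have sub: "x \<in> cdom C [k, l]" "x \<in> cdom C [j, k, l]" "x \<in> cdom C [i, j, l]" "x \<in> cdom C [i, k, l]"
    using x by (auto simp: cdom_def)
  have zx: "z k l x \<in> cdom C [i, j, k]"
    using src.transition_mem[OF x, of "[i, j, k]"] I by simp
  have c: "cech_delta C (\<Omega> (Suc 0)) [i, j, k, l] x = (- \<kappa> * m_co i j k l x, 0, 0, 0)"
    by (simp add: cech_delta_4 src.pullback_transition[OF I(3,4) sub(1)] Let_def 
        Omega_1[OF I(2,3,4) sub(2)] Omega_1[OF I(1,2,4) sub(3)] Omega_1[OF I(1,3,4) sub(4)] Omega_1[OF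
          I(1,2,3) zx]
        m_cochain_def cech_delta_fun_4 eval_nat_numeral zero_prod_def algebra_simps)
  show ?thesis
    using I x by (simp add: tot_D_at deligne_d_def Omega_0[OF I x] c zero_prod_def)
qed

text \<open>
  An instance of \<open>\<delta>\<delta> = 0\<close>; the only pullbacks of pullbacks are along \<open>z\<^sub>k\<^sub>l \<circ> z\<^sub>l\<^sub>q = z\<^sub>k\<^sub>q\<close>.
\<close>
lemma tot_D_Omega_0:
  assumes I: "i \<in> idx C" "j \<in> idx C" "k \<in> idx C" "l \<in> idx C" "q \<in> idx C" and x: "x \<in> cdom C [i, j, k, l, q]"
  shows "tot_D 3 C \<Omega> 0 [i, j, k, l, q] x = 0"
proof -
  have s: "set [i, j, k, l, q] \<subseteq> idx C" using I by simp
  have sub: "x \<in> cdom C [l, q]" "x \<in> cdom C [j, k, l, q]" "x \<in> cdom C [i, k, l, q]" "x \<in> cdom C [i, j, l,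
    q]" "x \<in> cdom C [i, j, k, q]"
    using x by (auto simp: cdom_def)
  have zx: "z l q x \<in> cdom C [i, j, k, l]"
    using src.transition_mem[OF x _ s, of "[i, j, k, l]"] by simp
  have zz: "z k l (z l q x) = z k q x"
    using src.transition_transition[OF x _ s, of k l] by simp
  have "cech_delta C (\<Omega> 0) [i, j, k, l, q] x = (- \<kappa> * (m_co j k l q x - m_co i k l q x + m_co i j l q x -
    m_co i j k q x + m_co i j k l (z l q x)), 0, 0, 0)"
    by (simp add: cech_delta_5 src.pullback_transition[OF I(4,5) sub(1)] Let_def 
        Omega_0[OF I(2,3,4,5) sub(2)] Omega_0[OF I(1,3,4,5) sub(3)] Omega_0[OF I(1,2,4,5) sub(4)]
          Omega_0[OF I(1,2,3,5) sub(5)]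
        Omega_0[OF I(1,2,3,4) zx] algebra_simps)
  moreover have "m_co j k l q x - m_co i k l q x + m_co i j l q x - m_co i j k q x + m_co i j k l (z l q
    x) = 0"
    by (simp add: m_cochain_def cech_delta_fun_4 eval_nat_numeral zz)
  ultimately show ?thesis
    using I x by (simp add: tot_D_at zero_prod_def)
qed

lemma tot_D_Omega: "tot_D 3 C \<Omega> = 0"
proof (intro ext)
  fix p "is" x
  show "tot_D 3 C \<Omega> p is x = 0 p is x"
  proof (cases "is \<noteq> [] \<and> set is \<subseteq> idx C \<and> x \<in> cdom C is")
    case False
    then show ?thesis by (auto simp: tot_D_def restrict_form_def)
  next
    case True
    then have I: "is \<noteq> []" "set is \<subseteq> idx C" "x \<in> cdom C is" by auto
    show ?thesis
    proof (cases "p \<le> 3 \<and> length is = 5 - p")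
      case True
      then consider "p = 0" "length is = 5" | "p = 1" "length is = 4" | "p = 2" "length is = 3" | "p = 3"
        "length is = 2"
        by (cases "p = 0"; cases "p = 1"; cases "p = 2"; cases "p = 3") auto
      \<comment> \<open>These are the four bidegrees of total degree \<open>4\<close> in which a component of \<open>\<Omega>\<close> contributes.\<close>
      then show ?thesis
      proof cases
        case 1
        then obtain i j k l q where l: "is = [i, j, k, l, q]" by (auto simp: length_Suc_conv eval_nat_numeral)
        then show ?thesis using tot_D_Omega_0[of i j k l q x] I 1 by simp
      next
        case 2
        then obtain i j k l where l: "is = [i, j, k, l]" by (auto simp: length_Suc_conv eval_nat_numeral)
        then show ?thesis using tot_D_Omega_1[of i j k l x] I 2 by simp
      next
        case 3
        then obtain i j k where l: "is = [i, j, k]" by (auto simp: length_Suc_conv eval_nat_numeral)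
        then show ?thesis using tot_D_Omega_2[of i j k x] I 3 by simp
      next
        case 4
        then obtain i j where l: "is = [i, j]" by (auto simp: length_Suc_conv eval_nat_numeral)
        then show ?thesis using tot_D_Omega_3[of i j x] I 4 by simp
      qed
    next
      case False
      have "cech_delta C (\<Omega> p) is = 0"
        by (rule cech_delta_vanishing, rule Omega_vanishing) (use False in auto)
      moreover have "deligne_d 3 (p - 1) (\<Omega> (p - 1) is) = 0" if "p \<noteq> 0"
      \<comment> \<open>For \<open>p = 4\<close> the component \<open>\<omega>\<close> itself is differentiated, but the complex ends there.\<close>
      proof (cases "p = 4")
        case True then show ?thesis by (simp add: deligne_d_def)
      next
        case False': False
        have "\<Omega> (p - 1) is = 0" by (rule Omega_vanishing) (use False False' that in auto)
        then show ?thesis by (simp add: deligne_d_def ext_d_zero)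
      qed
      ultimately show ?thesis by (simp add: tot_D_at[OF I])
    qed
  qed
qed

lemma Omega_class: "deligne_class 3 C 3 \<Omega> \<in> carrier (deligne_cohomology 3 C 3)"
  using Omega_cochain tot_D_Omega
  by (auto simp: deligne_class_def deligne_cohomology_def FactGroup_def RCOSETS_def cocycle_group_def
    tot_cocycles_def)

end

theorem proposition3p3p1:
  fixes X :: "'a topology" and A :: "'a chart set"
    and Y :: "'b topology" and B :: "'b chart set"
    and g :: nat and f :: "'a \<Rightarrow> 'b"
    and C :: "('i, 'a) coord_cover" and E :: "('i, 'b) coord_cover"
    and h Lf :: "'i \<Rightarrow> complex \<Rightarrow> complex"
    and Lz Lw \<tau> \<phi> \<tau>' \<phi>' :: "'i list \<Rightarrow> complex \<Rightarrow> complex"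
    and n n' :: "'i list \<Rightarrow> complex"
  assumes "riemann_surface X A" and "compact_space X" and "has_genus X g" and "g > 1"
    and "riemann_surface Y B"
    and "diffeomorphism X A Y B f" and "orientation_preserving A B f"
    and "good_cover X (idx C) (patch C)"
    and "\<forall>i\<in>idx C. holomorphic_coordinate X A (patch C i) (coord C i)"
    and "idx E = idx C" and "\<forall>i\<in>idx C. patch E i = f ` patch C i"
    and "\<forall>i\<in>idx C. holomorphic_coordinate Y B (patch E i) (coord E i)"
    and "smooth_projective_connection C h"
    and "\<forall>i\<in>idx C. \<forall>j\<in>idx C. log_branch (Lz [i, j]) (deriv (transition C i j)) (cdom C [i, j])"
    and "\<forall>i\<in>idx C. \<forall>j\<in>idx C. log_branch (Lw [i, j]) (deriv (transition E i j)) (cdom E [i, j])"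
    and "\<forall>i\<in>idx C. log_branch (Lf i) (del (local_rep C E f i)) (cdom C [i])"
    and "tame_trivialization C Lz \<tau> \<phi> n"
    and "tame_trivialization E Lw \<tau>' \<phi>' n'"
  defines "\<Omega> \<equiv> Omega C E f h Lz Lw Lf \<tau> \<phi> \<tau>' \<phi>'"
  shows "(\<forall>i\<in>idx C. \<forall>j\<in>idx C. \<forall>k\<in>idx C. \<forall>l\<in>idx C.
            \<exists>m\<in>Ztw 2. \<forall>x\<in>cdom C [i, j, k, l]. m_cochain C E f Lz Lw Lf \<phi> \<phi>' i j k l x = m)
       \<and> \<Omega> \<in> tot_cochains 3 C 3 \<and> tot_D 3 C \<Omega> = 0
       \<and> deligne_class 3 C 3 \<Omega> \<in> carrier (deligne_cohomology 3 C 3)"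
proof -
  have f: "smooth_map X A Y B f" using assms(6) by (simp add: diffeomorphism_def)
  have src: "coordinate_cover C" by (rule coordinate_coverI[OF assms(1)]) (use assms(9) in blast)
  have tgt: "coordinate_cover E" by (rule coordinate_coverI[OF assms(5)]) (use assms(10,12) in auto)
  have F: "smooth_on (local_rep C E f i) (cdom C [i])" if "i \<in> idx C" for i
    using local_rep_smooth[OF assms(1,5) f, of "patch C i" "coord C i" "patch E i" "coord E i"]
      assms(9,11,12) that
    by (simp add: local_rep_def cdom_def)
  have conn: "connected (cdom C is)" if "is \<noteq> []" "set is \<subseteq> idx C" for "is"
    using connected_cdom[OF _ assms(8) that] assms(9) by blast
  have "deformation C E f Lz Lw Lf"
    by (intro deformation.intro deformation_axioms.intro src tgt F conn) (use assms in auto)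
  then interpret polyakov_setting C E f Lz Lw Lf h \<tau> \<phi> \<tau>' \<phi>' n n'
    by (intro polyakov_setting.intro polyakov_setting_axioms.intro assms)
  show ?thesis
    unfolding \<Omega>_def using m_cochain_in_Ztw Omega_cochain tot_D_Omega Omega_class by blast
qed

end
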